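(* Let $C$ be a thread category and let $k$ be a field. Then the abelian category $\mathrm{rep}^{\mathrm{pwf}}(C)$ of pointwise finite dimensional representations of $C$ over $k$ is hereditary, i.e. $\mathrm{Ext}^2_{\mathrm{rep}^{\mathrm{pwf}}(C)}(X,Y)=0$ for all objects $X,Y$. In particular, for any objects $X,Y\in\mathrm{rep}^{\mathrm{pwf}}(C)$ and any integer $n\geq 2$, $$\mathrm{Ext}^n_{\mathrm{rep}^{\mathrm{pwf}}(C)}(X,Y)=0.$$
   Context: Quivers. A quiver $Q=(Q_0,Q_1,s,t)$ consists of a set $Q_0$ of vertices, a set $Q_1$ of arrows (both possibly infinite) and source and target maps $s,t:Q_1\to Q_0$. Thread quivers. A thread quiver $(Q,P)$ is a quiver $Q$ together with a family $P=\{P_\alpha\}_{\alpha\in Q_1}$ of (possibly empty) linearly ordered sets; $P_\alpha$ is the thread of $\alpha$. Let $\overline{P_\alpha}$ be the linearly ordered set obtained from $P_\alpha$ by adjoining a new minimum $\min(\alpha)$ and a new maximum $\max(\alpha)$. Thread category. The thread category $C$ of $(Q,P)$ is the following small category. Its objects are the elements of $Q_0\sqcup\coprod_{\alpha\in Q_1}P_\alpha$; an element of $\overline{P_\alpha}$ is regarded as an object of $C$ by identifying $\min(\alpha)$ with $s(\alpha)$ and $\max(\alpha)$ with $t(\alpha)$. For every $\alpha\in Q_1$ and all $x\leq y$ in $\overline{P_\alpha}$ there is a generating morphism $\eta_{y,x}:x\to y$ (depending on $\alpha$), with $\eta_{x,x}$ the identity, and with $\eta_{\max(\alpha),\min(\alpha)}$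 identified with the arrow $\alpha$ (also when $\alpha$ is a loop, in which case it is not the identity). Morphisms of $C$ are paths in these generators, composition is concatenation, and the only relations are $\eta_{z,y}\circ\eta_{y,x}=\eta_{z,x}$ for $x\leq y\leq z$ in some $\overline{P_\alpha}$. A thread category is a category of this form. Representations. A representation of $C$ over $k$ is a covariant functor $M:C\to\mathrm{Mod}(k)$; it is pointwise finite dimensional (pwf) if $M(x)$ is finite dimensional for every object $x$ of $C$. $\mathrm{rep}^{\mathrm{pwf}}(C)$ is the full subcategory of pwf representations in the category $\mathrm{Rep}(C)$ of all representations; it is abelian, with kernels and cokernels computed pointwise. Ext. $\mathrm{Ext}^n$ denotes Yoneda Ext: for an abelian category $\mathcal{A}$ and $n\ge1$, $\mathrm{Ext}^n_{\mathcal{A}}(X,Z)$ is the abelian group (under Baer sum) of equivalence classes of exact sequences $0\to Z\to B_1\to\cdots\to B_n\to X\to 0$ in $\mathcal{A}$, where equivalence is generated by morphisms of such sequences that are the identity on $Z$ and $X$. (The category need not have enough projectives or injectives.) *)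

theory Defs
  imports "Graph_Theory.Digraph" "Jordan_Normal_Form.Missing_VectorSpace"
begin

section \<open>Small categories\<close>

record ('o, 'f) cat =
  Ob :: "'o set"
  Hom :: "'o \<Rightarrow> 'o \<Rightarrow> 'f set"
  Ident :: "'o \<Rightarrow> 'f"
  Cmp :: "'f \<Rightarrow> 'f \<Rightarrow> 'f"  \<comment> \<open>\<open>Cmp C g f\<close> is \<open>g \<circ> f\<close>\<close>

locale small_category =
  fixes C :: "('o, 'f) cat"
  assumes Hom_Ob: "f \<in> Hom C x y \<Longrightarrow> x \<in> Ob C \<and> y \<in> Ob C"
    and Hom_disjoint: "f \<in> Hom C x y \<Longrightarrow> f \<in> Hom C x' y' \<Longrightarrow> x = x' \<and> y = y'"
    and Ident_Hom: "x \<in> Ob C \<Longrightarrow> Ident C x \<in> Hom C x x"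
    and Cmp_Hom: "f \<in> Hom C x y \<Longrightarrow> g \<in> Hom C y z \<Longrightarrow> Cmp C g f \<in> Hom C x z"
    and Cmp_Ident: "f \<in> Hom C x y \<Longrightarrow> Cmp C f (Ident C x) = f"
    and Ident_Cmp: "f \<in> Hom C x y \<Longrightarrow> Cmp C (Ident C y) f = f"
    and Cmp_assoc: "f \<in> Hom C x y \<Longrightarrow> g \<in> Hom C y z \<Longrightarrow> h \<in> Hom C z w \<Longrightarrow>
      Cmp C h (Cmp C g f) = Cmp C (Cmp C h g) f"

section \<open>Thread quivers and thread categories\<close>

text \<open>
  A quiver is a directed multigraph in the sense of \<^locale>\<open>wf_digraph\<close>, with
  \<^const>\<open>tail\<close> as source and \<^const>\<open>head\<close> as target map; neither vertices nor arcs are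
  required to be finite. The thread of an arc \<open>\<alpha>\<close> is the reflexive linear order \<open>P \<alpha>\<close> on
  the set \<open>Field (P \<alpha>)\<close>, which may be empty.
\<close>

definition thread_quiver :: "('v, 'a) pre_digraph \<Rightarrow> ('a \<Rightarrow> 'p rel) \<Rightarrow> bool" where
  "thread_quiver Q P \<longleftrightarrow> wf_digraph Q \<and> (\<forall>\<alpha>\<in>arcs Q. Linear_order (P \<alpha>))"

text \<open>\<open>Lo\<close> and \<open>Hi\<close> are the adjoined minimum and maximum of a thread.\<close>

datatype 'p bar = Lo | Mid 'p | Hi

definition bar_carrier :: "'p rel \<Rightarrow> 'p bar set" where
  "bar_carrier r = {Lo, Hi} \<union> Mid ` Field r"

definition bar_order :: "'p rel \<Rightarrow> 'p bar rel" where
  "bar_order r = {(x, y). x \<in> bar_carrier r \<and> y \<in> bar_carrier r \<and>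
     (x = Lo \<or> y = Hi \<or> (\<exists>p q. x = Mid p \<and> y = Mid q \<and> (p, q) \<in> r))}"

datatype ('v, 'a, 'p) tobj = Vertex 'v | Point 'a 'p

definition tc_objects :: "('v, 'a) pre_digraph \<Rightarrow> ('a \<Rightarrow> 'p rel) \<Rightarrow> ('v, 'a, 'p) tobj set" where
  "tc_objects Q P = Vertex ` verts Q \<union> {Point \<alpha> p | \<alpha> p. \<alpha> \<in> arcs Q \<and> p \<in> Field (P \<alpha>)}"

fun bar_obj :: "('v, 'a) pre_digraph \<Rightarrow> 'a \<Rightarrow> 'p bar \<Rightarrow> ('v, 'a, 'p) tobj" where
  "bar_obj Q \<alpha> Lo = Vertex (tail Q \<alpha>)"
| "bar_obj Q \<alpha> (Mid p) = Point \<alpha> p"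
| "bar_obj Q \<alpha> Hi = Vertex (head Q \<alpha>)"

text \<open>
  The generator \<open>(\<alpha>, x, y)\<close> stands for \<open>\<eta>\<^bsub>y,x\<^esub>\<close>, where \<open>x \<le> y\<close> are elements of the
  extended thread of \<open>\<alpha>\<close>, and \<open>(\<alpha>, Lo, Hi)\<close> is the arrow \<open>\<alpha>\<close> itself. As \<open>x\<close> and \<open>y\<close> are
  recorded as elements of the extended thread, \<open>(\<alpha>, Lo, Hi)\<close> is not confused with
  \<open>(\<alpha>, Lo, Lo)\<close> when \<open>\<alpha>\<close> is a loop. The list of generators in a path is in order of
  traversal, and a path carries its two end points.
\<close>

type_synonym ('a, 'p) gen = "'a \<times> 'p bar \<times> 'p bar"
type_synonym ('v, 'a, 'p) tpath =
  "('v, 'a, 'p) tobj \<times> ('a, 'p) gen list \<times> ('v, 'a, 'p) tobj"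

inductive is_path :: "('v, 'a) pre_digraph \<Rightarrow> ('a \<Rightarrow> 'p rel) \<Rightarrow>
    ('v, 'a, 'p) tobj \<Rightarrow> ('a, 'p) gen list \<Rightarrow> ('v, 'a, 'p) tobj \<Rightarrow> bool"
  for Q P where
  Nil: "x \<in> tc_objects Q P \<Longrightarrow> is_path Q P x [] x"
| Cons: "\<alpha> \<in> arcs Q \<Longrightarrow> (a, b) \<in> bar_order (P \<alpha>) \<Longrightarrow> is_path Q P (bar_obj Q \<alpha> b) gs z
    \<Longrightarrow> is_path Q P (bar_obj Q \<alpha> a) ((\<alpha>, a, b) # gs) z"

inductive elem_rel :: "('a, 'p) gen list \<Rightarrow> ('a, 'p) gen list \<Rightarrow> bool" where
  ident: "elem_rel (us @ [(\<alpha>, a, a)] @ vs) (us @ vs)"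
| comp: "elem_rel (us @ [(\<alpha>, a, b), (\<alpha>, b, c)] @ vs) (us @ [(\<alpha>, a, c)] @ vs)"

inductive path_rel :: "('v, 'a) pre_digraph \<Rightarrow> ('a \<Rightarrow> 'p rel) \<Rightarrow>
    ('v, 'a, 'p) tpath \<Rightarrow> ('v, 'a, 'p) tpath \<Rightarrow> bool"
  for Q P where
  "is_path Q P x us y \<Longrightarrow> is_path Q P x vs y \<Longrightarrow> elem_rel us vs
    \<Longrightarrow> path_rel Q P (x, us, y) (x, vs, y)"

definition path_class :: "('v, 'a) pre_digraph \<Rightarrow> ('a \<Rightarrow> 'p rel) \<Rightarrow>
    ('v, 'a, 'p) tpath \<Rightarrow> ('v, 'a, 'p) tpath set" where
  "path_class Q P p = {q. equivclp (path_rel Q P) p q}"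

definition thread_cat :: "('v, 'a) pre_digraph \<Rightarrow> ('a \<Rightarrow> 'p rel) \<Rightarrow>
    (('v, 'a, 'p) tobj, ('v, 'a, 'p) tpath set) cat" where
  "thread_cat Q P =
    \<lparr> Ob = tc_objects Q P,
      Hom = (\<lambda>x y. {path_class Q P (x, us, y) | us. is_path Q P x us y}),
      Ident = (\<lambda>x. path_class Q P (x, [], x)),
      Cmp = (\<lambda>g f. \<Union>{path_class Q P (x, us @ vs, z) | x us y vs z.
                       (x, us, y) \<in> f \<and> (y, vs, z) \<in> g}) \<rparr>"

lemma is_path_ends:
  assumes "thread_quiver Q P" and "is_path Q P x us y"
  shows "x \<in> tc_objects Q P \<and> y \<in> tc_objects Q P"
  using assms(2,1)
proof (induction rule: is_path.induct)
  case (Cons \<alpha> a b gs z)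
  then have "a \<in> bar_carrier (P \<alpha>)" "wf_digraph Q"
    by (auto simp: bar_order_def thread_quiver_def)
  with Cons show ?case
    by (auto simp: bar_carrier_def tc_objects_def wf_digraph.tail_in_verts wf_digraph.head_in_verts)
qed auto

lemma is_path_append:
  "is_path Q P x us y \<Longrightarrow> is_path Q P y vs z \<Longrightarrow> is_path Q P x (us @ vs) z"
  by (induction rule: is_path.induct) (auto intro: is_path.intros)

lemma path_rel_append_right:
  assumes "path_rel Q P (x, us, y) (x, us', y)" and "is_path Q P y vs z"
  shows "path_rel Q P (x, us @ vs, z) (x, us' @ vs, z)"
proof -
  have "elem_rel (us @ vs) (us' @ vs)" if "elem_rel us us'"
    using that
  proof cases
    case (ident u \<alpha> a w)
    then show ?thesis using elem_rel.ident[of u \<alpha> a "w @ vs"] by simp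
  next
    case (comp u \<alpha> a b c w)
    then show ?thesis using elem_rel.comp[of u \<alpha> a b c "w @ vs"] by simp
  qed
  with assms show ?thesis
    by (auto elim!: path_rel.cases intro!: path_rel.intros is_path_append)
qed

lemma path_rel_append_left:
  assumes "path_rel Q P (y, vs, z) (y, vs', z)" and "is_path Q P x us y"
  shows "path_rel Q P (x, us @ vs, z) (x, us @ vs', z)"
proof -
  have "elem_rel (us @ vs) (us @ vs')" if "elem_rel vs vs'"
    using that
  proof cases
    case (ident u \<alpha> a w)
    then show ?thesis using elem_rel.ident[of "us @ u" \<alpha> a w] by simp
  next
    case (comp u \<alpha> a b c w)
    then show ?thesis using elem_rel.comp[of "us @ u" \<alpha> a b c w] by simp
  qed
  with assms show ?thesis
    by (auto elim!: path_rel.cases intro!: path_rel.intros is_path_append)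
qed

lemma equivclp_path_rel:
  assumes "equivclp (path_rel Q P) (x, us, y) q" and "is_path Q P x us y"
  shows "\<exists>us'. q = (x, us', y) \<and> is_path Q P x us' y \<and>
    (\<forall>vs z. is_path Q P y vs z \<longrightarrow> equivclp (path_rel Q P) (x, us @ vs, z) (x, us' @ vs, z)) \<and>
    (\<forall>vs w. is_path Q P w vs x \<longrightarrow> equivclp (path_rel Q P) (w, vs @ us, y) (w, vs @ us', y))"
  using assms(1)
proof (induction rule: equivclp_induct)
  case base
  then show ?case using assms(2) by auto
next
  case (step q r)
  then obtain us' where us': "q = (x, us', y)" "is_path Q P x us' y"
    "\<And>vs z. is_path Q P y vs z \<Longrightarrow> equivclp (path_rel Q P) (x, us @ vs, z) (x, us' @ vs, z)"
    "\<And>vs w. is_path Q P w vs x \<Longrightarrow> equivclp (path_rel Q P) (w, vs @ us, y) (w, vs @ us', y)"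
    by blast
  from step(2) us'(1) obtain us'' where us'': "r = (x, us'', y)" "is_path Q P x us'' y"
    by (auto elim!: path_rel.cases)
  have a: "path_rel Q P (x, us', y) (x, us'', y) \<or> path_rel Q P (x, us'', y) (x, us', y)"
    using step(2) us' us'' by simp
  have "equivclp (path_rel Q P) (x, us' @ vs, z) (x, us'' @ vs, z)" if "is_path Q P y vs z" for vs z
    using a that by (auto dest: path_rel_append_right simp: r_into_equivclp converse_r_into_equivclp)
  moreover
  have 1: "equivclp (path_rel Q P) (w, vs @ us', y) (w, vs @ us'', y)"
    if "is_path Q P w vs x" for vs w
    using a that by (auto dest: path_rel_append_left simp: r_into_equivclp converse_r_into_equivclp)
  ultimately
  have "equivclp (path_rel Q P) (x, us @ vs, z) (x, us'' @ vs, z)" if "is_path Q P y vs z" for vs z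
    using that by (rule_tac equivclp_trans[OF us'(3)])
  moreover
  have "equivclp (path_rel Q P) (w, vs @ us, y) (w, vs @ us'', y)" if "is_path Q P w vs x" for vs w
    using that 1 by (rule_tac equivclp_trans[OF us'(4)])
  ultimately show ?case using us'' by blast
qed

lemma path_class_eqI:
  "equivclp (path_rel Q P) p q \<Longrightarrow> path_class Q P p = path_class Q P q"
  unfolding path_class_def by (auto intro: equivclp_trans equivclp_sym)

lemma thread_cat_Cmp:
  assumes "is_path Q P x us y" and "is_path Q P y vs z"
  shows "Cmp (thread_cat Q P) (path_class Q P (y, vs, z)) (path_class Q P (x, us, y)) =
    path_class Q P (x, us @ vs, z)"
proof -
  have "path_class Q P (x', us' @ vs', z') = path_class Q P (x, us @ vs, z)"
    if "(x', us', y') \<in> path_class Q P (x, us, y)" "(y', vs', z') \<in> path_class Q P (y, vs, z)"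
    for x' us' y' vs' z'
  proof -
    from that(1) assms(1) have 1: "x' = x" "y' = y" "is_path Q P x us' y"
      "equivclp (path_rel Q P) (x, us @ vs, z) (x, us' @ vs, z)"
      unfolding path_class_def using assms(2) by (auto dest: equivclp_path_rel)
    from that(2) assms(2) have "z' = z"
      "equivclp (path_rel Q P) (x, us' @ vs, z) (x, us' @ vs', z)"
      unfolding path_class_def using 1 by (auto dest: equivclp_path_rel)
    with 1 show ?thesis
      by (metis path_class_eqI)
  qed
  moreover have "(x, us, y) \<in> path_class Q P (x, us, y)" "(y, vs, z) \<in> path_class Q P (y, vs, z)"
    by (simp_all add: path_class_def)
  ultimately have "{path_class Q P (x', us' @ vs', z') | x' us' y' vs' z'.
      (x', us', y') \<in> path_class Q P (x, us, y) \<and> (y', vs', z') \<in> path_class Q P (y, vs, z)} =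
    {path_class Q P (x, us @ vs, z)}"
    by fast
  then show ?thesis
    by (simp add: thread_cat_def)
qed

lemma small_category_thread_cat:
  assumes "thread_quiver Q P"
  shows "small_category (thread_cat Q P)"
proof -
  have Hom: "f \<in> Hom (thread_cat Q P) x y \<longleftrightarrow>
      (\<exists>us. f = path_class Q P (x, us, y) \<and> is_path Q P x us y)" for f x y
    by (auto simp: thread_cat_def)
  have Id: "Ident (thread_cat Q P) x = path_class Q P (x, [], x)" for x
    by (simp add: thread_cat_def)
  have Ob: "Ob (thread_cat Q P) = tc_objects Q P"
    by (simp add: thread_cat_def)
  have self: "p \<in> path_class Q P p" for p
    by (simp add: path_class_def)
  show ?thesis
  proof
    fix f x y x' y'
    assume "f \<in> Hom (thread_cat Q P) x y" "f \<in> Hom (thread_cat Q P) x' y'"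
    then obtain us us' where "path_class Q P (x, us, y) = path_class Q P (x', us', y')"
      "is_path Q P x us y" by (auto simp: Hom)
    then have "(x', us', y') \<in> path_class Q P (x, us, y)"
      using self[of "(x', us', y')"] by simp
    then have "equivclp (path_rel Q P) (x, us, y) (x', us', y')"
      unfolding path_class_def by (rule CollectD)
    then show "x = x' \<and> y = y'"
      using equivclp_path_rel[OF _ \<open>is_path Q P x us y\<close>] by fast
  next
    fix f x y
    assume "f \<in> Hom (thread_cat Q P) x y"
    then obtain us where f: "f = path_class Q P (x, us, y)" "is_path Q P x us y"
      by (auto simp: Hom)
    show xy: "x \<in> Ob (thread_cat Q P) \<and> y \<in> Ob (thread_cat Q P)"
      using f is_path_ends[OF assms] by (auto simp: Ob)
    then have "is_path Q P x [] x" "is_path Q P y [] y"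
      by (auto simp: Ob intro: is_path.Nil)
    then show "Cmp (thread_cat Q P) f (Ident (thread_cat Q P) x) = f"
      and "Cmp (thread_cat Q P) (Ident (thread_cat Q P) y) f = f"
      unfolding Id f(1) using f(2) by (simp_all add: thread_cat_Cmp)
  next
    fix x assume "x \<in> Ob (thread_cat Q P)"
    then show "Ident (thread_cat Q P) x \<in> Hom (thread_cat Q P) x x"
      by (auto simp: Hom Id Ob intro: is_path.Nil)
  next
    fix f x y g z
    assume "f \<in> Hom (thread_cat Q P) x y" "g \<in> Hom (thread_cat Q P) y z"
    then show "Cmp (thread_cat Q P) g f \<in> Hom (thread_cat Q P) x z"
      by (auto simp: Hom thread_cat_Cmp intro: is_path_append)
  next
    fix f x y g z h w
    assume "f \<in> Hom (thread_cat Q P) x y" "g \<in> Hom (thread_cat Q P) y z"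
      "h \<in> Hom (thread_cat Q P) z w"
    then show "Cmp (thread_cat Q P) h (Cmp (thread_cat Q P) g f) =
        Cmp (thread_cat Q P) (Cmp (thread_cat Q P) h g) f"
      by (auto simp: Hom thread_cat_Cmp is_path_append)
  qed
qed

section \<open>Pointwise finite dimensional representations\<close>

text \<open>
  The values \<open>Sp M x\<close> are vector spaces whose carriers are arbitrary subsets of the type
  \<open>'m\<close>, which plays the role of the universe of sets. What \<open>Sp M\<close>, \<open>Ar M\<close> and the components
  of a morphism do outside the objects, morphisms and carriers concerned is irrelevant.
\<close>

record ('o, 'f, 'k, 'm) rep =
  Sp :: "'o \<Rightarrow> ('k, 'm) module"
  Ar :: "'f \<Rightarrow> 'm \<Rightarrow> 'm"

definition is_rep :: "('o, 'f) cat \<Rightarrow> ('k, 'r) ring_scheme \<Rightarrow> ('o, 'f, 'k, 'm) rep \<Rightarrow> bool" where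
  "is_rep C K M \<longleftrightarrow>
    (\<forall>x\<in>Ob C. vectorspace K (Sp M x)) \<and>
    (\<forall>x\<in>Ob C. \<forall>y\<in>Ob C. \<forall>f\<in>Hom C x y. Ar M f \<in> module_hom K (Sp M x) (Sp M y)) \<and>
    (\<forall>x\<in>Ob C. \<forall>v\<in>carrier (Sp M x). Ar M (Ident C x) v = v) \<and>
    (\<forall>x\<in>Ob C. \<forall>y\<in>Ob C. \<forall>z\<in>Ob C. \<forall>f\<in>Hom C x y. \<forall>g\<in>Hom C y z. \<forall>v\<in>carrier (Sp M x).
       Ar M (Cmp C g f) v = Ar M g (Ar M f v))"

definition is_pwf_rep :: "('o, 'f) cat \<Rightarrow> ('k, 'r) ring_scheme \<Rightarrow> ('o, 'f, 'k, 'm) rep \<Rightarrow> bool"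
  where "is_pwf_rep C K M \<longleftrightarrow> is_rep C K M \<and> (\<forall>x\<in>Ob C. vectorspace.fin_dim K (Sp M x))"

definition rep_hom :: "('o, 'f) cat \<Rightarrow> ('k, 'r) ring_scheme \<Rightarrow>
    ('o, 'f, 'k, 'm) rep \<Rightarrow> ('o, 'f, 'k, 'm) rep \<Rightarrow> ('o \<Rightarrow> 'm \<Rightarrow> 'm) set" where
  "rep_hom C K M N = {\<phi>.
    (\<forall>x\<in>Ob C. \<phi> x \<in> module_hom K (Sp M x) (Sp N x)) \<and>
    (\<forall>x\<in>Ob C. \<forall>y\<in>Ob C. \<forall>f\<in>Hom C x y. \<forall>v\<in>carrier (Sp M x).
       \<phi> y (Ar M f v) = Ar N f (\<phi> x v))}"

section \<open>Yoneda Ext in the category of pointwise finite dimensional representations\<close>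

text \<open>
  An exact sequence \<open>0 \<rightarrow> Z \<rightarrow> B\<^sub>1 \<rightarrow> \<dots> \<rightarrow> B\<^sub>n \<rightarrow> X \<rightarrow> 0\<close> is a pair \<open>(B, d)\<close> of families
  with \<open>B 0 = Z\<close>, \<open>B (n + 1) = X\<close> and \<open>d i : B i \<rightarrow> B (i + 1)\<close>; indices beyond \<open>n + 1\<close> are
  irrelevant. Exactness is pointwise because kernels and cokernels in the category of
  pointwise finite dimensional representations are.
\<close>

type_synonym ('o, 'f, 'k, 'm) seq =
  "(nat \<Rightarrow> ('o, 'f, 'k, 'm) rep) \<times> (nat \<Rightarrow> 'o \<Rightarrow> 'm \<Rightarrow> 'm)"

definition exact_seqs :: "('o, 'f) cat \<Rightarrow> ('k, 'r) ring_scheme \<Rightarrow> nat \<Rightarrow>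
    ('o, 'f, 'k, 'm) rep \<Rightarrow> ('o, 'f, 'k, 'm) rep \<Rightarrow> ('o, 'f, 'k, 'm) seq set" where
  "exact_seqs C K n X Z = {(B, d).
    B 0 = Z \<and> B (Suc n) = X \<and>
    (\<forall>i\<le>Suc n. is_pwf_rep C K (B i)) \<and>
    (\<forall>i\<le>n. d i \<in> rep_hom C K (B i) (B (Suc i))) \<and>
    (\<forall>x\<in>Ob C.
       inj_on (d 0 x) (carrier (Sp (B 0) x)) \<and>
       (\<forall>i<n. d i x ` carrier (Sp (B i) x) =
          {v \<in> carrier (Sp (B (Suc i)) x). d (Suc i) x v = \<zero>\<^bsub>Sp (B (Suc (Suc i))) x\<^esub>}) \<and>
       d n x ` carrier (Sp (B n) x) = carrier (Sp (B (Suc n)) x))}"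

definition seq_morphism :: "('o, 'f) cat \<Rightarrow> ('k, 'r) ring_scheme \<Rightarrow> nat \<Rightarrow>
    ('o, 'f, 'k, 'm) rep \<Rightarrow> ('o, 'f, 'k, 'm) rep \<Rightarrow>
    ('o, 'f, 'k, 'm) seq \<Rightarrow> ('o, 'f, 'k, 'm) seq \<Rightarrow> bool" where
  "seq_morphism C K n X Z = (\<lambda>(B, d) (B', d').
    (B, d) \<in> exact_seqs C K n X Z \<and> (B', d') \<in> exact_seqs C K n X Z \<and>
    (\<exists>h. (\<forall>i\<le>Suc n. h i \<in> rep_hom C K (B i) (B' i)) \<and>
      (\<forall>x\<in>Ob C.
         (\<forall>v\<in>carrier (Sp Z x). h 0 x v = v) \<and>
         (\<forall>v\<in>carrier (Sp X x). h (Suc n) x v = v) \<and>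
         (\<forall>i\<le>n. \<forall>v\<in>carrier (Sp (B i) x). h (Suc i) x (d i x v) = d' i x (h i x v)))))"

definition seq_class :: "('o, 'f) cat \<Rightarrow> ('k, 'r) ring_scheme \<Rightarrow> nat \<Rightarrow>
    ('o, 'f, 'k, 'm) rep \<Rightarrow> ('o, 'f, 'k, 'm) rep \<Rightarrow>
    ('o, 'f, 'k, 'm) seq \<Rightarrow> ('o, 'f, 'k, 'm) seq set" where
  "seq_class C K n X Z E = {E'. equivclp (seq_morphism C K n X Z) E E'}"

text \<open>The underlying set of the group \<open>Ext\<^sup>n(X, Z)\<close>, for \<open>n \<ge> 1\<close>.\<close>

definition Ext :: "('o, 'f) cat \<Rightarrow> ('k, 'r) ring_scheme \<Rightarrow> nat \<Rightarrow>
    ('o, 'f, 'k, 'm) rep \<Rightarrow> ('o, 'f, 'k, 'm) rep \<Rightarrow> ('o, 'f, 'k, 'm) seq set set" where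
  "Ext C K n X Z = seq_class C K n X Z ` exact_seqs C K n X Z"

definition zero_space :: "('k, 'm) module" where
  "zero_space = \<lparr>carrier = {undefined}, mult = (\<lambda>_ _. undefined), one = undefined,
     zero = undefined, add = (\<lambda>_ _. undefined), smult = (\<lambda>_ _. undefined)\<rparr>"

definition zero_rep :: "('o, 'f, 'k, 'm) rep" where
  "zero_rep = \<lparr>Sp = (\<lambda>_. zero_space), Ar = (\<lambda>_ v. v)\<rparr>"

text \<open>
  For \<open>n \<ge> 2\<close> the neutral element of the Baer sum is the class of
  \<open>0 \<rightarrow> Z \<rightarrow> Z \<rightarrow> 0 \<rightarrow> \<dots> \<rightarrow> 0 \<rightarrow> X \<rightarrow> X \<rightarrow> 0\<close>, whose first and last maps are identities and
  whose other maps are zero. For \<open>n = 1\<close> it is the class of the split sequence, which is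
  not what these definitions give.
\<close>

definition trivial_seq :: "nat \<Rightarrow> ('o, 'f, 'k, 'm) rep \<Rightarrow> ('o, 'f, 'k, 'm) rep \<Rightarrow>
    ('o, 'f, 'k, 'm) seq" where
  "trivial_seq n X Z =
    (let B = (\<lambda>i. if i \<le> 1 then Z else if n \<le> i then X else zero_rep)
     in (B, \<lambda>i x v. if i = 0 \<or> i = n then v else \<zero>\<^bsub>Sp (B (Suc i)) x\<^esub>))"

lemma vectorspace_zero_space:
  assumes "field K"
  shows "vectorspace K (zero_space :: ('k, 'm) module)"
    and "vectorspace.fin_dim K (zero_space :: ('k, 'm) module)"
proof -
  interpret field K by fact
  have "module K (zero_space :: ('k, 'm) module)"
    by (rule Module.moduleI)
      (auto simp: zero_space_def intro!: abelian_groupI is_cring)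
  then interpret vectorspace K "zero_space :: ('k, 'm) module"
    by (simp add: vectorspace_def assms)
  show "vectorspace K (zero_space :: ('k, 'm) module)"
    by unfold_locales
  have "span {} \<subseteq> carrier (zero_space :: ('k, 'm) module)"
    by (simp add: span_is_subset2)
  moreover have "(undefined :: 'm) \<in> span {}"
    using span_is_submodule[of "{}"] by (auto simp: submodule_def zero_space_def)
  ultimately have "span {} = carrier (zero_space :: ('k, 'm) module)"
    by (auto simp: zero_space_def)
  then show "vectorspace.fin_dim K (zero_space :: ('k, 'm) module)"
    unfolding fin_dim_def by (intro exI[of _ "{}"]) auto
qed

lemma is_pwf_rep_zero_rep:
  assumes "field K"
  shows "is_pwf_rep C K zero_rep"
  by (simp add: is_pwf_rep_def is_rep_def zero_rep_def module_hom_def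
      vectorspace_zero_space[OF assms])

lemma trivial_seq_exact:
  assumes "field K" and X: "is_pwf_rep C K X" and Z: "is_pwf_rep C K Z" and n: "2 \<le> n"
  shows "trivial_seq n X Z \<in> exact_seqs C K n X Z"
proof -
  define B where "B = (\<lambda>i. if i \<le> 1 then Z else if n \<le> i then X else zero_rep)"
  define d where "d = (\<lambda>i x v. if i = 0 \<or> i = n then v else \<zero>\<^bsub>Sp (B (Suc i)) x\<^esub>)"
  have B: "is_pwf_rep C K (B i)" for i
    using X Z by (simp add: B_def is_pwf_rep_zero_rep[OF assms(1)])
  have vs: "vectorspace K (Sp (B i) x)" if "x \<in> Ob C" for i x
    using B that by (auto simp: is_pwf_rep_def is_rep_def)
  have ends: "B 0 = Z" "B (Suc 0) = Z" "B n = X" "B (Suc n) = X"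
    using n by (auto simp: B_def)
  have mod: "module K (Sp (B i) x)" if "x \<in> Ob C" for i x
    using vs[OF that] by (simp add: vectorspace_def)
  have zero: "\<zero>\<^bsub>Sp (B i) x\<^esub> \<in> carrier (Sp (B i) x)"
    "\<zero>\<^bsub>Sp (B i) x\<^esub> \<oplus>\<^bsub>Sp (B i) x\<^esub> \<zero>\<^bsub>Sp (B i) x\<^esub> = \<zero>\<^bsub>Sp (B i) x\<^esub>"
    "r \<in> carrier K \<Longrightarrow> r \<odot>\<^bsub>Sp (B i) x\<^esub> \<zero>\<^bsub>Sp (B i) x\<^esub> = \<zero>\<^bsub>Sp (B i) x\<^esub>"
    if "x \<in> Ob C" for i x r
  proof -
    interpret module K "Sp (B i) x" by (rule mod[OF that])
    show "\<zero>\<^bsub>Sp (B i) x\<^esub> \<in> carrier (Sp (B i) x)"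
      "\<zero>\<^bsub>Sp (B i) x\<^esub> \<oplus>\<^bsub>Sp (B i) x\<^esub> \<zero>\<^bsub>Sp (B i) x\<^esub> = \<zero>\<^bsub>Sp (B i) x\<^esub>"
      "r \<in> carrier K \<Longrightarrow> r \<odot>\<^bsub>Sp (B i) x\<^esub> \<zero>\<^bsub>Sp (B i) x\<^esub> = \<zero>\<^bsub>Sp (B i) x\<^esub>"
      by simp_all
  qed
  have Ar: "Ar (B i) f \<in> module_hom K (Sp (B i) x) (Sp (B i) y)"
    if "x \<in> Ob C" "y \<in> Ob C" "f \<in> Hom C x y" for i x y f
    using B that by (auto simp: is_pwf_rep_def is_rep_def)
  have Ar_zero: "Ar (B i) f \<zero>\<^bsub>Sp (B i) x\<^esub> = \<zero>\<^bsub>Sp (B i) y\<^esub>"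
    if "x \<in> Ob C" "y \<in> Ob C" "f \<in> Hom C x y" for i x y f
  proof -
    have "mod_hom K (Sp (B i) x) (Sp (B i) y) (Ar (B i) f)"
      using mod Ar that by (simp add: mod_hom_def mod_hom_axioms_def)
    then show ?thesis by (rule mod_hom.f0_is_0)
  qed
  have carr: "carrier (Sp (B i) x) = {\<zero>\<^bsub>Sp (B i) x\<^esub>}" if "2 \<le> i" "i < n" for i x
    using that by (simp add: B_def zero_rep_def zero_space_def)
  have d_hom: "d i \<in> rep_hom C K (B i) (B (Suc i))" for i
  proof (cases "i = 0 \<or> i = n")
    case True
    then have "B (Suc i) = B i" "d i = (\<lambda>x v. v)" using ends by (auto simp: d_def fun_eq_iff)
    then show ?thesis by (simp add: rep_hom_def module_hom_def)
  next
    case False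
    then have "d i = (\<lambda>x v. \<zero>\<^bsub>Sp (B (Suc i)) x\<^esub>)" by (auto simp: d_def fun_eq_iff)
    then show ?thesis
      using zero Ar_zero by (auto simp: rep_hom_def module_hom_def)
  qed
  have ex: "d i x ` carrier (Sp (B i) x) =
      {v \<in> carrier (Sp (B (Suc i)) x). d (Suc i) x v = \<zero>\<^bsub>Sp (B (Suc (Suc i))) x\<^esub>}"
    if x: "x \<in> Ob C" and i: "i < n" for i x
  proof (cases "i = 0")
    case True
    then show ?thesis using ends n by (auto simp: d_def)
  next
    case i0: False
    have "d i x ` carrier (Sp (B i) x) = {\<zero>\<^bsub>Sp (B (Suc i)) x\<^esub>}"
      using i0 i zero(1)[OF x, of i] by (auto simp: d_def)
    moreover have "{v \<in> carrier (Sp (B (Suc i)) x). d (Suc i) x v = \<zero>\<^bsub>Sp (B (Suc (Suc i))) x\<^esub>}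
        = {\<zero>\<^bsub>Sp (B (Suc i)) x\<^esub>}"
    proof (cases "Suc i = n")
      case True
      then show ?thesis using ends zero(1)[OF x, of n] by (auto simp: d_def)
    next
      case False
      then show ?thesis using carr[of "Suc i" x] i i0 by (auto simp: d_def)
    qed
    ultimately show ?thesis by simp
  qed
  have "trivial_seq n X Z = (B, d)"
    by (simp add: trivial_seq_def Let_def B_def d_def fun_eq_iff)
  moreover have "(B, d) \<in> exact_seqs C K n X Z"
    unfolding exact_seqs_def using ends B d_hom ex by (auto simp: d_def)
  ultimately show ?thesis by simp
qed

definition Ext_zero :: "('o, 'f) cat \<Rightarrow> ('k, 'r) ring_scheme \<Rightarrow> nat \<Rightarrow>
    ('o, 'f, 'k, 'm) rep \<Rightarrow> ('o, 'f, 'k, 'm) rep \<Rightarrow> ('o, 'f, 'k, 'm) seq set" where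
  "Ext_zero C K n X Z = seq_class C K n X Z (trivial_seq n X Z)"

end

theory Submission
  imports Defs
begin

text \<open>
  Let \<open>0 \<rightarrow> Z \<rightarrow> A \<rightarrow> B \<rightarrow> B\<^sub>3 \<rightarrow> \<dots> \<rightarrow> X \<rightarrow> 0\<close> be exact, with \<open>d : A \<rightarrow> B\<close>. If the extension
  \<open>0 \<rightarrow> Z \<rightarrow> A \<rightarrow> im d \<rightarrow> 0\<close> is the restriction of an extension \<open>0 \<rightarrow> Z \<rightarrow> E \<rightarrow> B \<rightarrow> 0\<close> along
  \<open>im d \<subseteq> B\<close>, then \<open>0 \<rightarrow> Z \<rightarrow> Z \<oplus> A \<rightarrow> E \<rightarrow> B\<^sub>3 \<rightarrow> \<dots> \<rightarrow> X \<rightarrow> 0\<close> is exact and maps both to the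
  given sequence and to the trivial one. Extensions split pointwise, so they are described by the
  off-diagonal entries of the action of the generators, and since all relations of the thread
  category hold within single threads, the only condition on these entries is a cocycle identity
  on each thread. It remains to extend a cocycle from \<open>im d\<close> to \<open>B\<close> on a linear order. On a
  finite chain the values on consecutive elements can be prescribed freely, and an infinite thread
  is reduced to its finite subsets by linear compactness of finite dimensional spaces.
\<close>

section \<open>Finite dimensional linear algebra\<close>

text \<open>Behind it stands right exactness of \<open>Ext^1(-, Z)\<close>: the class of a sequence
  is the Yoneda product of its first short exact piece with the rest, and it vanishes once that
  piece extends along the inclusion of \<open>im d\<close> in \<open>B\<close>. For such an
  \<open>E\<close> the sequence starting with \<open>A\<close>, \<open>E\<close>, \<open>B_3\<close>
  is exact because \<open>E / A\<close> is \<open>B / im d\<close>. The summand \<open>Z\<close>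
  makes the sequence start at \<open>Z\<close> with a split first map, and the retraction onto
  \<open>Z\<close> gives the morphism to the trivial sequence. A dense thread has no consecutive
  elements, so no induction can choose the cocycle there; compactness replaces it, and a finite
  dimensional value counts as finitely many scalar unknowns. All spaces lie in the one type
  \<open>'m\<close>, which carries no pairing. Direct sums are therefore arbitrary spaces of the
  right dimension, equipped with injections and projections; this is what the hypothesis on the
  universe provides.\<close>

lemma module_homI:
  assumes "\<And>v. v \<in> carrier M \<Longrightarrow> f v \<in> carrier N"
    and "\<And>v w. v \<in> carrier M \<Longrightarrow> w \<in> carrier M \<Longrightarrow> f (v \<oplus>\<^bsub>M\<^esub> w) = f v \<oplus>\<^bsub>N\<^esub> f w"
    and "\<And>r v. r \<in> carrier R \<Longrightarrow> v \<in> carrier M \<Longrightarrow> f (r \<odot>\<^bsub>M\<^esub> v) = r \<odot>\<^bsub>N\<^esub> f v"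
  shows "f \<in> module_hom R M N"
  using assms by (auto simp: module_hom_def)

lemma module_hom_carrier: "f \<in> module_hom R M N \<Longrightarrow> v \<in> carrier M \<Longrightarrow> f v \<in> carrier N"
  by (auto simp: module_hom_def)

lemma module_hom_zero:
  assumes "module R M" "module R N" "f \<in> module_hom R M N"
  shows "f \<zero>\<^bsub>M\<^esub> = \<zero>\<^bsub>N\<^esub>"
  using assms mod_hom.f0_is_0 by (metis mod_hom.intro mod_hom_axioms.intro)

lemma module_hom_minus:
  assumes "module R M" "module R N" "f \<in> module_hom R M N" "v \<in> carrier M" "w \<in> carrier M"
  shows "f (v \<ominus>\<^bsub>M\<^esub> w) = f v \<ominus>\<^bsub>N\<^esub> f w"
  using assms mod_hom.f_minus by (metis mod_hom.intro mod_hom_axioms.intro)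

lemma module_hom_ident: "(\<lambda>v. v) \<in> module_hom R M M"
  by (rule module_homI) auto

lemma module_hom_compose:
  "f \<in> module_hom R L M \<Longrightarrow> g \<in> module_hom R M N \<Longrightarrow> (\<lambda>v. g (f v)) \<in> module_hom R L N"
  by (rule module_homI) (simp_all add: module_hom_carrier module_hom_add module_hom_smult)

lemma module_hom_const_zero:
  assumes "module R N"
  shows "(\<lambda>_. \<zero>\<^bsub>N\<^esub>) \<in> module_hom R M N"
proof -
  interpret N: module R N by fact
  show ?thesis by (rule module_homI) auto
qed

lemma module_hom_plus:
  assumes "module R N" "f \<in> module_hom R M N" "g \<in> module_hom R M N"
  shows "(\<lambda>v. f v \<oplus>\<^bsub>N\<^esub> g v) \<in> module_hom R M N"
proof -
  interpret N: module R N by fact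
  note [simp] = module_hom_carrier[OF assms(2)] module_hom_carrier[OF assms(3)]
    module_hom_add[OF assms(2)] module_hom_add[OF assms(3)]
    module_hom_smult[OF assms(2)] module_hom_smult[OF assms(3)]
  show ?thesis by (rule module_homI) (auto simp: N.smult_r_distr N.a_ac)
qed

lemma module_hom_diff:
  assumes "module R N" "f \<in> module_hom R M N" "g \<in> module_hom R M N"
  shows "(\<lambda>v. f v \<ominus>\<^bsub>N\<^esub> g v) \<in> module_hom R M N"
proof -
  interpret N: module R N by fact
  have "(\<lambda>v. \<ominus>\<^bsub>N\<^esub> v) \<in> module_hom R N N"
    by (rule module_homI) (auto simp: N.minus_add N.smult_r_minus)
  from module_hom_plus[OF assms(1,2) module_hom_compose[OF assms(3) this]]
  show ?thesis by (simp add: a_minus_def)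
qed

section \<open>Coordinates, bases and maps prescribed on a basis\<close>

context vectorspace
begin

text \<open>Each vector has exactly one extensional coefficient function over a basis. Sums and
  multiples of coefficient functions represent the sums and multiples of the vectors, so uniqueness
  makes the coordinates linear.\<close>

lemma coordinates_exist:
  assumes "finite U" "basis U"
  obtains co where
    "\<And>v u. v \<in> carrier V \<Longrightarrow> u \<in> U \<Longrightarrow> co v u \<in> carrier K"
    "\<And>v. v \<in> carrier V \<Longrightarrow> lincomb (co v) U = v"
    "\<And>a u. a \<in> U \<rightarrow> carrier K \<Longrightarrow> u \<in> U \<Longrightarrow> co (lincomb a U) u = a u"
    "\<And>v w u. v \<in> carrier V \<Longrightarrow> w \<in> carrier V \<Longrightarrow> u \<in> U \<Longrightarrow> co (v \<oplus>\<^bsub>V\<^esub> w) u = co v u \<oplus>\<^bsub>K\<^esub> co w u"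
    "\<And>r v u. r \<in> carrier K \<Longrightarrow> v \<in> carrier V \<Longrightarrow> u \<in> U \<Longrightarrow> co (r \<odot>\<^bsub>V\<^esub> v) u = r \<otimes>\<^bsub>K\<^esub> co v u"
proof -
  have U: "U \<subseteq> carrier V" using assms(2) by (simp add: basis_def)
  have ex1: "\<exists>!a. a \<in> U \<rightarrow>\<^sub>E carrier K \<and> lincomb a U = v" if "v \<in> carrier V" for v
    using basis_criterion[OF assms(1) U] assms(2) that by blast
  define co where "co v = (THE a. a \<in> U \<rightarrow>\<^sub>E carrier K \<and> lincomb a U = v)" for v
  have co: "co v \<in> U \<rightarrow>\<^sub>E carrier K" "lincomb (co v) U = v" if "v \<in> carrier V" for v
    using theI'[OF ex1[OF that]] by (simp_all add: co_def)
  have co1: "co v u \<in> carrier K" if "v \<in> carrier V" "u \<in> U" for v u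
    using co(1)[OF that(1)] that(2) by auto
  have uniq: "co v u = a u" if "a \<in> U \<rightarrow> carrier K" "u \<in> U" "v = lincomb a U" for a u v
  proof -
    have v: "v \<in> carrier V" using that U by auto
    \<comment> \<open>Uniqueness holds among extensional functions only, hence the restriction of
      \<open>a\<close>.\<close>
    have "lincomb (restrict a U) U = v"
      using that U by (auto intro!: lincomb_cong)
    moreover have "restrict a U \<in> U \<rightarrow>\<^sub>E carrier K" using that(1) by auto
    ultimately have "co v = restrict a U"
      using ex1[OF v] co[OF v] by blast
    then show ?thesis using that(2) by simp
  qed
  show ?thesis
  proof
    show "co (v \<oplus>\<^bsub>V\<^esub> w) u = co v u \<oplus>\<^bsub>K\<^esub> co w u"
      if "v \<in> carrier V" "w \<in> carrier V" "u \<in> U" for v w u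
      using that co1 co(2) U assms(1) by (intro uniq) (auto simp: lincomb_sum Pi_I)
    show "co (r \<odot>\<^bsub>V\<^esub> v) u = r \<otimes>\<^bsub>K\<^esub> co v u"
      if "r \<in> carrier K" "v \<in> carrier V" "u \<in> U" for r v u
      using that co1 co(2) U assms(1) by (intro uniq) (auto simp: lincomb_smult Pi_I)
  qed (use co1 co(2) uniq in auto)
qed

lemma lincomb_indicator:
  assumes "finite U" "U \<subseteq> carrier V" "u \<in> U"
  shows "lincomb (\<lambda>w. if w = u then \<one>\<^bsub>K\<^esub> else \<zero>\<^bsub>K\<^esub>) U = u"
proof -
  have "lincomb (\<lambda>w. if w = u then \<one>\<^bsub>K\<^esub> else \<zero>\<^bsub>K\<^esub>) U = (\<Oplus>\<^bsub>V\<^esub>w\<in>U. if u = w then w else \<zero>\<^bsub>V\<^esub>)"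
    unfolding lincomb_def using assms by (intro finsum_cong2) auto
  also have "\<dots> = u"
    using assms by (intro finsum_singleton) auto
  finally show ?thesis .
qed

lemma linear_extension:
  assumes "finite U" "basis U" "module K W" "\<And>u. u \<in> U \<Longrightarrow> r u \<in> carrier W"
  obtains s where "s \<in> module_hom K V W" "\<And>u. u \<in> U \<Longrightarrow> s u = r u"
proof -
  interpret W: module K W by fact
  obtain co where co: "\<And>v u. v \<in> carrier V \<Longrightarrow> u \<in> U \<Longrightarrow> co v u \<in> carrier K"
    "\<And>v. v \<in> carrier V \<Longrightarrow> lincomb (co v) U = v"
    "\<And>a u. a \<in> U \<rightarrow> carrier K \<Longrightarrow> u \<in> U \<Longrightarrow> co (lincomb a U) u = a u"
    "\<And>v w u. v \<in> carrier V \<Longrightarrow> w \<in> carrier V \<Longrightarrow> u \<in> U \<Longrightarrow> co (v \<oplus>\<^bsub>V\<^esub> w) u = co v u \<oplus>\<^bsub>K\<^esub> co w u"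
    "\<And>r v u. r \<in> carrier K \<Longrightarrow> v \<in> carrier V \<Longrightarrow> u \<in> U \<Longrightarrow> co (r \<odot>\<^bsub>V\<^esub> v) u = r \<otimes>\<^bsub>K\<^esub> co v u"
    by (rule coordinates_exist[OF assms(1,2)], rule that)
  have U: "U \<subseteq> carrier V" using assms(2) by (simp add: basis_def)
  define s where "s v = (\<Oplus>\<^bsub>W\<^esub>u\<in>U. co v u \<odot>\<^bsub>W\<^esub> r u)" for v
  have c: "(\<lambda>u. co v u \<odot>\<^bsub>W\<^esub> r u) \<in> U \<rightarrow> carrier W" if "v \<in> carrier V" for v
    using that co(1) assms(4) by auto
  have "s \<in> module_hom K V W"
  proof (rule module_homI)
    show "s v \<in> carrier W" if "v \<in> carrier V" for v
      unfolding s_def using c[OF that] by (rule W.finsum_closed)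
    show "s (v \<oplus>\<^bsub>V\<^esub> w) = s v \<oplus>\<^bsub>W\<^esub> s w" if "v \<in> carrier V" "w \<in> carrier V" for v w
    proof -
      have "s (v \<oplus>\<^bsub>V\<^esub> w) = (\<Oplus>\<^bsub>W\<^esub>u\<in>U. co v u \<odot>\<^bsub>W\<^esub> r u \<oplus>\<^bsub>W\<^esub> co w u \<odot>\<^bsub>W\<^esub> r u)"
        unfolding s_def using that co(1) assms(4)
        by (intro W.finsum_cong2) (auto simp: co(4) W.smult_l_distr)
      then show ?thesis
        unfolding s_def using c that by (simp add: W.finsum_addf)
    qed
    show "s (a \<odot>\<^bsub>V\<^esub> v) = a \<odot>\<^bsub>W\<^esub> s v" if "a \<in> carrier K" "v \<in> carrier V" for a v
    proof -
      have "s (a \<odot>\<^bsub>V\<^esub> v) = (\<Oplus>\<^bsub>W\<^esub>u\<in>U. a \<odot>\<^bsub>W\<^esub> (co v u \<odot>\<^bsub>W\<^esub> r u))"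
        unfolding s_def using that co(1) assms(4)
        by (intro W.finsum_cong2) (auto simp: co(5) W.smult_assoc1)
      then show ?thesis
        unfolding s_def using c that assms(1) by (simp add: W.finsum_smult)
    qed
  qed
  moreover have "s u = r u" if "u \<in> U" for u
  proof -
    have "co u w = (if w = u then \<one>\<^bsub>K\<^esub> else \<zero>\<^bsub>K\<^esub>)" if "w \<in> U" for w
      using co(3)[of "\<lambda>w. if w = u then \<one>\<^bsub>K\<^esub> else \<zero>\<^bsub>K\<^esub>", OF _ that]
        lincomb_indicator[OF assms(1) U \<open>u \<in> U\<close>] by simp
    then have "s u = (\<Oplus>\<^bsub>W\<^esub>w\<in>U. if u = w then r w else \<zero>\<^bsub>W\<^esub>)"
      unfolding s_def using assms(4) by (intro W.finsum_cong2) auto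
    also have "\<dots> = r u"
      using assms(1,4) that by (intro W.finsum_singleton) auto
    finally show ?thesis .
  qed
  ultimately show thesis by (rule that)
qed

text \<open>Independent sets have at most \<open>dim\<close> elements, so a maximal one between
  \<open>S\<close> and \<open>N\<close> exists, and a vector of \<open>N\<close> outside its span
  could still be added. With \<open>S = {}\<close> and \<open>N\<close> a subspace this gives a
  basis of the subspace; with \<open>N\<close> the whole carrier it completes \<open>S\<close> to a
  basis.\<close>

lemma exists_maximal_lin_indpt:
  assumes "fin_dim" "S \<subseteq> N" "N \<subseteq> carrier V" "lin_indpt S"
  obtains T where "S \<subseteq> T" "T \<subseteq> N" "finite T" "lin_indpt T" "N \<subseteq> span T"
proof -
  let ?P = "\<lambda>T. S \<subseteq> T \<and> T \<subseteq> N \<and> lin_indpt T"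
  have "\<exists>T. finite T \<and> maximal T ?P"
    using assms li_le_dim by (intro maximal_exists[where N = dim and B = S]) auto
  then obtain T where T: "finite T" "S \<subseteq> T" "T \<subseteq> N" "lin_indpt T"
    and max: "\<And>B. T \<subseteq> B \<Longrightarrow> B \<subseteq> N \<Longrightarrow> lin_indpt B \<Longrightarrow> B = T"
    unfolding maximal_def by (metis (no_types, lifting) order_trans)
  have "v \<in> span T" if "v \<in> N" for v
  proof (cases "v \<in> T")
    case True
    then show ?thesis using in_own_span[of T] T assms by auto
  next
    case False
    then have "lin_dep (T \<union> {v})"
      using max[of "T \<union> {v}"] T that by auto
    then show ?thesis
      using lin_dep_iff_in_span[of T v] False T that assms by auto
  qed
  with T that show thesis by blast
qed

text \<open>The vectors on which \<open>f\<close> and \<open>g\<close> agree form a submodule, which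
  contains the span as soon as it contains \<open>S\<close>.\<close>

lemma linear_eq_on_span:
  assumes "module K W" "f \<in> module_hom K V W" "g \<in> module_hom K V W"
    and "S \<subseteq> carrier V" "\<And>u. u \<in> S \<Longrightarrow> f u = g u" "v \<in> span S"
  shows "f v = g v"
proof -
  interpret W: module K W by fact
  have V: "module K V" by unfold_locales
  have "submodule K {v \<in> carrier V. f v = g v} V"
    unfolding submodule_def
    using assms(2,3) V module_hom_zero[OF V assms(1,2)] module_hom_zero[OF V assms(1,3)]
    by (auto simp: module_hom_def)
  with assms(4-) show ?thesis using span_is_subset[of S "{v \<in> carrier V. f v = g v}"] by auto
qed

end

text \<open>One statement with two uses: for injective \<open>f\<close> the map \<open>s\<close> is
  a retraction, and in general it is a linear section of \<open>f\<close> over the image, defined on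
  all of \<open>W\<close>.\<close>

lemma generalized_inverse_exists:
  assumes "vectorspace K V" "vectorspace K W" "vectorspace.fin_dim K W" "f \<in> module_hom K V W"
  obtains s where "s \<in> module_hom K W V" "\<And>v. v \<in> carrier V \<Longrightarrow> f (s (f v)) = f v"
proof -
  interpret V: vectorspace K V by fact
  interpret W: vectorspace K W by fact
  have im: "f ` carrier V \<subseteq> carrier W" using module_hom_carrier[OF assms(4)] by auto
  have li: "W.lin_indpt {}" by (simp add: W.lin_dep_def)
  obtain S where S: "S \<subseteq> f ` carrier V" "finite S" "W.lin_indpt S" "f ` carrier V \<subseteq> W.span S"
    by (rule W.exists_maximal_lin_indpt[OF assms(3) empty_subsetI im li], rule that)
  obtain U where U: "S \<subseteq> U" "U \<subseteq> carrier W" "finite U" "W.lin_indpt U" "carrier W \<subseteq> W.span U"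
    by (rule W.exists_maximal_lin_indpt[OF assms(3) subset_trans[OF S(1) im] subset_refl S(3)], rule that)
  then have basis: "W.basis U"
    using W.span_is_subset2[of U] by (auto simp: W.basis_def)
  \<comment> \<open>A basis of the image goes to chosen preimages, the remaining basis vectors go to
    zero. Hence \<open>f\<close> after \<open>s\<close> fixes the span of \<open>S\<close>, which
    contains the image.\<close>
  define r where "r u = (if u \<in> S then SOME v. v \<in> carrier V \<and> f v = u else \<zero>\<^bsub>V\<^esub>)" for u
  have r: "r u \<in> carrier V \<and> f (r u) = u" if "u \<in> S" for u
  proof -
    have "\<exists>v. v \<in> carrier V \<and> f v = u" using S(1) that by auto
    from someI_ex[OF this] that show ?thesis by (simp add: r_def)
  qed
  have "r u \<in> carrier V" for u using r[of u] by (cases "u \<in> S") (auto simp: r_def)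
  then obtain s where s: "s \<in> module_hom K W V" "\<And>u. u \<in> U \<Longrightarrow> s u = r u"
    using W.linear_extension[OF U(3) basis V.module_axioms] by metis
  have "f (s w) = w" if "w \<in> W.span S" for w
  proof (rule W.linear_eq_on_span[OF W.module_axioms module_hom_compose[OF s(1) assms(4)]
        module_hom_ident _ _ that])
    show "S \<subseteq> carrier W" using U(1,2) by blast
    show "f (s u) = u" if "u \<in> S" for u
    proof -
      from that U(1) have "u \<in> U" by blast
      then show ?thesis using s(2) r[OF that] by simp
    qed
  qed
  with S(4) have "f (s (f v)) = f v" if "v \<in> carrier V" for v
    using that by blast
  with s(1) show thesis by (rule that)
qed

text \<open>Characterised by equations between four maps, since elements of \<open>'m\<close> cannot
  be paired: any space of the right dimension can carry the structure.\<close>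

definition biproduct :: "('k, 'r) ring_scheme \<Rightarrow> ('k, 'm) module \<Rightarrow> ('k, 'm) module \<Rightarrow> ('k, 'm) module
    \<Rightarrow> ('m \<Rightarrow> 'm) \<Rightarrow> ('m \<Rightarrow> 'm) \<Rightarrow> ('m \<Rightarrow> 'm) \<Rightarrow> ('m \<Rightarrow> 'm) \<Rightarrow> bool" where
  "biproduct K V1 V2 W i1 i2 p1 p2 \<longleftrightarrow>
    vectorspace K W \<and> vectorspace.fin_dim K W \<and>
    i1 \<in> module_hom K V1 W \<and> i2 \<in> module_hom K V2 W \<and>
    p1 \<in> module_hom K W V1 \<and> p2 \<in> module_hom K W V2 \<and>
    (\<forall>v\<in>carrier V1. p1 (i1 v) = v \<and> p2 (i1 v) = \<zero>\<^bsub>V2\<^esub>) \<and>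
    (\<forall>v\<in>carrier V2. p1 (i2 v) = \<zero>\<^bsub>V1\<^esub> \<and> p2 (i2 v) = v) \<and>
    (\<forall>w\<in>carrier W. i1 (p1 w) \<oplus>\<^bsub>W\<^esub> i2 (p2 w) = w)"

text \<open>A bijection \<open>e\<close> from the disjoint union of a basis of \<open>V1\<close> and
  a basis of \<open>V2\<close> onto a basis of a space of the summed dimension prescribes all four
  maps; their equations need checking on bases only.\<close>

lemma biproduct_exists:
  fixes V1 V2 :: "('k, 'm) module"
  assumes "vectorspace K V1" "vectorspace.fin_dim K V1"
    and "vectorspace K V2" "vectorspace.fin_dim K V2"
    and universe: "\<And>n :: nat. \<exists>V :: ('k, 'm) module.
      vectorspace K V \<and> vectorspace.fin_dim K V \<and> vectorspace.dim K V = n"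
  shows "\<exists>W i1 i2 p1 p2. biproduct K V1 V2 W i1 i2 p1 p2"
proof -
  interpret V1: vectorspace K V1 by fact
  interpret V2: vectorspace K V2 by fact
  obtain U1 where U1: "finite U1" "V1.basis U1" using V1.finite_basis_exists[OF assms(2)] by blast
  obtain U2 where U2: "finite U2" "V2.basis U2" using V2.finite_basis_exists[OF assms(4)] by blast
  obtain W :: "('k, 'm) module" where W: "vectorspace K W" "vectorspace.fin_dim K W"
    "vectorspace.dim K W = card U1 + card U2" using universe by blast
  interpret W: vectorspace K W by fact
  obtain U where U: "finite U" "W.basis U" using W.finite_basis_exists[OF W(2)] by blast
  have "card (U1 <+> U2) = card U"
    using W.dim_basis[OF U] W(3) U1(1) U2(1) by (simp add: card_Plus)
  then obtain e where e: "bij_betw e (U1 <+> U2) U"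
    using finite_same_card_bij[of "U1 <+> U2" U] U1 U2 U by auto
  define e' where "e' = inv_into (U1 <+> U2) e"
  have e': "e' (e x) = x" if "x \<in> U1 <+> U2" for x
    unfolding e'_def using e that by (simp add: bij_betw_inv_into_left)
  have eU: "e x \<in> U" if "x \<in> U1 <+> U2" for x using e that by (auto simp: bij_betw_def)
  have Ue: "U = e ` (U1 <+> U2)" using e by (simp add: bij_betw_def)
  have c: "U1 \<subseteq> carrier V1" "U2 \<subseteq> carrier V2" "U \<subseteq> carrier W"
    and s: "V1.span U1 = carrier V1" "V2.span U2 = carrier V2" "W.span U = carrier W"
    using U1 U2 U by (auto simp: V1.basis_def V2.basis_def W.basis_def)
  obtain i1 where i1: "i1 \<in> module_hom K V1 W" "\<And>u. u \<in> U1 \<Longrightarrow> i1 u = e (Inl u)"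
    using V1.linear_extension[OF U1 W.module_axioms, of "\<lambda>u. e (Inl u)"] eU c by blast
  obtain i2 where i2: "i2 \<in> module_hom K V2 W" "\<And>u. u \<in> U2 \<Longrightarrow> i2 u = e (Inr u)"
    using V2.linear_extension[OF U2 W.module_axioms, of "\<lambda>u. e (Inr u)"] eU c by blast
  have [simp]: "e' (e (Inl u)) = Inl u" if "u \<in> U1" for u
    using that by (intro e') auto
  have [simp]: "e' (e (Inr u)) = Inr u" if "u \<in> U2" for u
    using that by (intro e') auto
  have "(case e' u of Inl v \<Rightarrow> v | Inr _ \<Rightarrow> \<zero>\<^bsub>V1\<^esub>) \<in> carrier V1"
    and "(case e' u of Inl _ \<Rightarrow> \<zero>\<^bsub>V2\<^esub> | Inr v \<Rightarrow> v) \<in> carrier V2" if "u \<in> U" for u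
    using that c unfolding Ue by auto
  note r = this
  obtain p1 where p1: "p1 \<in> module_hom K W V1"
    "\<And>u. u \<in> U \<Longrightarrow> p1 u = (case e' u of Inl v \<Rightarrow> v | Inr _ \<Rightarrow> \<zero>\<^bsub>V1\<^esub>)"
    using W.linear_extension[OF U V1.module_axioms, of "\<lambda>u. case e' u of Inl v \<Rightarrow> v | Inr _ \<Rightarrow> \<zero>\<^bsub>V1\<^esub>"]
      r(1) by blast
  obtain p2 where p2: "p2 \<in> module_hom K W V2"
    "\<And>u. u \<in> U \<Longrightarrow> p2 u = (case e' u of Inl _ \<Rightarrow> \<zero>\<^bsub>V2\<^esub> | Inr v \<Rightarrow> v)"
    using W.linear_extension[OF U V2.module_axioms, of "\<lambda>u. case e' u of Inl _ \<Rightarrow> \<zero>\<^bsub>V2\<^esub> | Inr v \<Rightarrow> v"]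
      r(2) by blast
  have pe: "p1 (e (Inl u)) = u" "p2 (e (Inl u)) = \<zero>\<^bsub>V2\<^esub>" if "u \<in> U1" for u
    using that eU[OF InlI[OF that]] by (simp_all add: p1(2) p2(2))
  have pe': "p1 (e (Inr u)) = \<zero>\<^bsub>V1\<^esub>" "p2 (e (Inr u)) = u" if "u \<in> U2" for u
    using that eU[OF InrI[OF that]] by (simp_all add: p1(2) p2(2))
  have 1: "p1 (i1 v) = v" "p2 (i1 v) = \<zero>\<^bsub>V2\<^esub>" if "v \<in> carrier V1" for v
    using that c(1) s(1) V1.linear_eq_on_span[OF V1.module_axioms module_hom_compose[OF i1(1) p1(1)] module_hom_ident, of U1 v]
      V1.linear_eq_on_span[OF V2.module_axioms module_hom_compose[OF i1(1) p2(1)]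
        module_hom_const_zero[OF V2.module_axioms], of U1 v]
    by (auto simp: i1(2) pe)
  have 2: "p1 (i2 v) = \<zero>\<^bsub>V1\<^esub>" "p2 (i2 v) = v" if "v \<in> carrier V2" for v
    using that c(2) s(2) V2.linear_eq_on_span[OF V2.module_axioms module_hom_compose[OF i2(1) p2(1)] module_hom_ident, of U2 v]
      V2.linear_eq_on_span[OF V1.module_axioms module_hom_compose[OF i2(1) p1(1)]
        module_hom_const_zero[OF V1.module_axioms], of U2 v]
    by (auto simp: i2(2) pe')
  have "i1 (p1 w) \<oplus>\<^bsub>W\<^esub> i2 (p2 w) = w" if "w \<in> carrier W" for w
  proof (rule W.linear_eq_on_span[OF W.module_axioms
        module_hom_plus[OF W.module_axioms module_hom_compose[OF p1(1) i1(1)] module_hom_compose[OF p2(1) i2(1)]]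
        module_hom_ident c(3)])
    show "w \<in> W.span U" using that s by simp
    fix u assume "u \<in> U"
    then consider x where "x \<in> U1" "u = e (Inl x)" | x where "x \<in> U2" "u = e (Inr x)"
      unfolding Ue by auto
    then show "i1 (p1 u) \<oplus>\<^bsub>W\<^esub> i2 (p2 u) = u"
    proof cases
      case 1
      moreover have "i2 \<zero>\<^bsub>V2\<^esub> = \<zero>\<^bsub>W\<^esub>"
        by (rule module_hom_zero[OF V2.module_axioms W.module_axioms i2(1)])
      ultimately show ?thesis using \<open>u \<in> U\<close> c(3) by (auto simp: pe i1(2))
    next
      case 2
      moreover have "i1 \<zero>\<^bsub>V1\<^esub> = \<zero>\<^bsub>W\<^esub>"
        by (rule module_hom_zero[OF V1.module_axioms W.module_axioms i1(1)])
      ultimately show ?thesis using \<open>u \<in> U\<close> c(3) by (auto simp: pe' i2(2))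
    qed
  qed
  with W i1 i2 p1 p2 1 2 show ?thesis
    unfolding biproduct_def by blast
qed

section \<open>Compactness of affine systems\<close>

lemma (in abelian_group) minus_eq_zero_iff:
  "x \<in> carrier G \<Longrightarrow> y \<in> carrier G \<Longrightarrow> x \<ominus>\<^bsub>G\<^esub> y = \<zero>\<^bsub>G\<^esub> \<longleftrightarrow> x = y"
  by (metis a_inv_closed add.inv_solve_right' l_zero minus_eq r_neg zero_closed)

text \<open>
  Maximal partial assignments that are compatible with every finite subsystem are total: the
  values which a finite subsystem admits for one further unknown form an affine subspace of the
  one-dimensional space \<open>K\<close>, so either some subsystem determines the value, or none restricts it.
\<close>

lemma affine_compactness:
  fixes K :: "('k, 'r) ring_scheme" and Q :: "'e \<Rightarrow> ('i \<Rightarrow> 'k) \<Rightarrow> bool"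
  assumes "field K"
    and fin: "\<And>e. e \<in> E \<Longrightarrow> finite (supp e)"
    and cong: "\<And>e f g. e \<in> E \<Longrightarrow> range f \<subseteq> carrier K \<Longrightarrow> range g \<subseteq> carrier K \<Longrightarrow>
      (\<And>i. i \<in> supp e \<Longrightarrow> f i = g i) \<Longrightarrow> Q e f \<Longrightarrow> Q e g"
    and affine: "\<And>e f g t. e \<in> E \<Longrightarrow> range f \<subseteq> carrier K \<Longrightarrow> range g \<subseteq> carrier K \<Longrightarrow> Q e f \<Longrightarrow> Q e g
      \<Longrightarrow> t \<in> carrier K \<Longrightarrow> Q e (\<lambda>i. f i \<oplus>\<^bsub>K\<^esub> t \<otimes>\<^bsub>K\<^esub> (g i \<ominus>\<^bsub>K\<^esub> f i))"
    and solvable: "\<And>F. finite F \<Longrightarrow> F \<subseteq> E \<Longrightarrow> \<exists>f. range f \<subseteq> carrier K \<and> (\<forall>e\<in>F. Q e f)"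
  shows "\<exists>f. range f \<subseteq> carrier K \<and> (\<forall>e\<in>E. Q e f)"
proof -
  interpret field K by fact
  define sol where "sol G F f \<longleftrightarrow> range f \<subseteq> carrier K \<and> (\<forall>e\<in>F. Q e f) \<and> (\<forall>(i, k)\<in>G. f i = k)"
    for G :: "('i \<times> 'k) set" and F f
  \<comment> \<open>A relation \<open>G\<close> stands for a partial assignment. The case
    \<open>F = {}\<close> forces the members of this family to be single-valued with values in
    \<open>K\<close>.\<close>
  define \<A> where "\<A> = {G. \<forall>F. finite F \<longrightarrow> F \<subseteq> E \<longrightarrow> (\<exists>f. sol G F f)}"
  have "{} \<in> \<A>" using solvable by (simp add: \<A>_def sol_def)
  then have ne: "\<A> \<noteq> {}" by auto
  have chain: "\<Union>\<C> \<in> \<A>" if \<C>: "\<C> \<noteq> {}" "subset.chain \<A> \<C>" for \<C>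
  proof -
    let ?H = "\<Union>\<C>"
    have single: "\<exists>f. range f \<subseteq> carrier K \<and> (\<forall>(i, k)\<in>S. f i = k)" if S: "finite S" "S \<subseteq> ?H" for S
    proof -
      obtain G where "G \<in> \<C>" "S \<subseteq> G"
        using finite_subset_Union_chain[OF S \<C>] by blast
      moreover from this have "\<exists>f. sol G {} f"
        using \<C>(2) by (auto simp: \<A>_def subset_chain_def)
      ultimately show ?thesis unfolding sol_def by (metis subsetD)
    qed
    have uniq: "k = k'" if "(i, k) \<in> ?H" "(i, k') \<in> ?H" for i k k'
      using single[of "{(i, k), (i, k')}"] that by auto
    have inK: "k \<in> carrier K" if "(i, k) \<in> ?H" for i k
      using single[of "{(i, k)}"] that by auto
    have "\<exists>f. sol ?H F f" if F: "finite F" "F \<subseteq> E" for F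
    proof -
      \<comment> \<open>Only the unknowns in \<open>?W\<close> matter for \<open>F\<close>. The
        union prescribes finitely many values on them, and these already lie in a single member of
        the chain.\<close>
      let ?W = "\<Union>e\<in>F. supp e"
      let ?S = "{p \<in> ?H. fst p \<in> ?W}"
      have "inj_on fst ?S" using uniq by (auto simp: inj_on_def)
      moreover have "finite (fst ` ?S)"
        using F fin by (intro finite_subset[of "fst ` ?S" ?W]) auto
      ultimately have "finite ?S" by (simp add: finite_image_iff)
      then obtain G where G: "G \<in> \<C>" "?S \<subseteq> G"
        using finite_subset_Union_chain[of ?S \<C>] \<C> by blast
      then have "G \<in> \<A>" using \<C>(2) by (auto simp: subset_chain_def)
      then obtain f where f: "sol G F f" using F unfolding \<A>_def by blast
      \<comment> \<open>Inside \<open>?W\<close> this is a solution for that member, outside it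
        follows the union; \<open>cong\<close> keeps the equations of \<open>F\<close>
        valid.\<close>
      define g where "g i = (if i \<in> ?W then f i else if \<exists>k. (i, k) \<in> ?H then THE k. (i, k) \<in> ?H else \<zero>\<^bsub>K\<^esub>)" for i
      have the: "(THE k. (i, k) \<in> ?H) = k" if "(i, k) \<in> ?H" for i k
        using that uniq by (intro the_equality) auto
      have val: "g i = k" if "(i, k) \<in> ?H" for i k
      proof (cases "i \<in> ?W")
        case True
        then have "(i, k) \<in> ?S" using that by simp
        then have "(i, k) \<in> G" using G(2) by blast
        then show ?thesis using f True by (auto simp: g_def sol_def)
      next
        case False
        then show ?thesis using that the[OF that] by (auto simp: g_def)
      qed
      have gK: "g i \<in> carrier K" for i
      proof (cases "i \<in> ?W")
        case True
        then show ?thesis using f by (auto simp: g_def sol_def)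
      next
        case False
        show ?thesis
        proof (cases "\<exists>k. (i, k) \<in> ?H")
          case True
          then show ?thesis using val inK by blast
        next
          case False
          then show ?thesis using \<open>i \<notin> ?W\<close> by (simp add: g_def)
        qed
      qed
      have "Q e g" if "e \<in> F" for e
      proof (rule cong[of e f g])
        show "range g \<subseteq> carrier K" using gK by blast
        show "f i = g i" if "i \<in> supp e" for i
          using that \<open>e \<in> F\<close> by (auto simp: g_def)
      qed (use f that F(2) in \<open>auto simp: sol_def\<close>)
      with gK val have "sol ?H F g" unfolding sol_def by blast
      then show ?thesis by blast
    qed
    then show ?thesis by (simp add: \<A>_def)
  qed
  obtain M where M: "M \<in> \<A>" and max: "\<And>G. G \<in> \<A> \<Longrightarrow> M \<subseteq> G \<Longrightarrow> G = M"
    using subset_Zorn_nonempty[OF ne chain] by blast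
  have sol_mono: "sol M F f" if "sol M F' f" "F \<subseteq> F'" for F F' f
    using that by (auto simp: sol_def)
  have total: "\<exists>k. (i, k) \<in> M" for i
  proof -
    \<comment> \<open>Zero is taken if every finite subsystem admits it. If some \<open>F0\<close>
      excludes it, two solutions of \<open>F0\<close> compatible with \<open>M\<close> cannot differ
      at \<open>i\<close>, and their common value serves every \<open>F\<close>.\<close>
    have "\<exists>k. \<forall>F. finite F \<longrightarrow> F \<subseteq> E \<longrightarrow> (\<exists>f. sol M F f \<and> f i = k)"
    proof (cases "\<forall>F. finite F \<longrightarrow> F \<subseteq> E \<longrightarrow> (\<exists>f. sol M F f \<and> f i = \<zero>\<^bsub>K\<^esub>)")
      case False
      then obtain F0 where F0: "finite F0" "F0 \<subseteq> E" "\<And>f. sol M F0 f \<Longrightarrow> f i \<noteq> \<zero>\<^bsub>K\<^esub>"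
        by blast
      obtain f0 where f0: "sol M F0 f0" using M F0 by (auto simp: \<A>_def)
      have "\<exists>f. sol M F f \<and> f i = f0 i" if F: "finite F" "F \<subseteq> E" for F
      proof -
        obtain f where f: "sol M (F \<union> F0) f" using M F0 F by (auto simp: \<A>_def)
        have K: "f0 j \<in> carrier K" "f j \<in> carrier K" for j
          using f0 f by (auto simp: sol_def)
        have "f i = f0 i"
        proof (rule ccontr)
          assume neq: "f i \<noteq> f0 i"
          \<comment> \<open>The parameter at which the affine line through \<open>f0\<close> and
            \<open>f\<close> takes the value zero at \<open>i\<close>; the point reached is a
            solution of \<open>F0\<close>, against the choice of \<open>F0\<close>.\<close>
          define t where "t = (\<ominus>\<^bsub>K\<^esub> f0 i) \<otimes>\<^bsub>K\<^esub> inv\<^bsub>K\<^esub> (f i \<ominus>\<^bsub>K\<^esub> f0 i)"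
          have "f i \<ominus>\<^bsub>K\<^esub> f0 i \<noteq> \<zero>\<^bsub>K\<^esub>"
            using neq K by (simp add: minus_eq_zero_iff)
          then have u: "f i \<ominus>\<^bsub>K\<^esub> f0 i \<in> Units K"
            using K by (simp add: field_Units)
          then have t: "t \<in> carrier K" using K by (simp add: t_def)
          define g where "g j = f0 j \<oplus>\<^bsub>K\<^esub> t \<otimes>\<^bsub>K\<^esub> (f j \<ominus>\<^bsub>K\<^esub> f0 j)" for j
          have "f j = k" "f0 j = k" if "(j, k) \<in> M" for j k
            using f f0 that by (auto simp: sol_def)
          then have "g j = k" if "(j, k) \<in> M" for j k
            using that K[of j] t by (auto simp: g_def minus_eq r_neg)
          moreover have "Q e g" if "e \<in> F0" for e
            unfolding g_def using f0 f that F0(2) t K by (intro affine) (auto simp: sol_def)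
          moreover have "range g \<subseteq> carrier K"
            using K t by (auto simp: g_def)
          ultimately have "sol M F0 g" by (auto simp: sol_def)
          moreover have "g i = \<zero>\<^bsub>K\<^esub>"
            using u K[of i] by (simp add: g_def t_def m_assoc r_neg)
          ultimately show False using F0(3) by blast
        qed
        then show ?thesis using sol_mono[OF f, of F] by auto
      qed
      then show ?thesis by blast
    qed blast
    then obtain k where k: "\<And>F. finite F \<Longrightarrow> F \<subseteq> E \<Longrightarrow> \<exists>f. sol M F f \<and> f i = k" by blast
    have "\<exists>f. sol (insert (i, k) M) F f" if F: "finite F" "F \<subseteq> E" for F
    proof -
      obtain f where "sol M F f" "f i = k" using k[OF F] by blast
      then have "sol (insert (i, k) M) F f" by (simp add: sol_def)
      then show ?thesis by blast
    qed
    then have "insert (i, k) M \<in> \<A>" by (simp add: \<A>_def)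
    then show ?thesis using max by blast
  qed
  then obtain h where h: "\<And>i. (i, h i) \<in> M" by metis
  \<comment> \<open>\<open>M\<close> prescribes every unknown, so any solution compatible with it is
    \<open>h\<close>, whichever finite subsystem it solves.\<close>
  have eq: "f = h" if "sol M F f" for F f
    using h that by (force simp: sol_def fun_eq_iff)
  have sol_h: "sol M F h" if "finite F" "F \<subseteq> E" for F
    using M that eq by (auto simp: \<A>_def)
  have "Q e h" if "e \<in> E" for e
    using sol_h[of "{e}"] that by (simp add: sol_def)
  then show ?thesis using sol_h[of "{}"] by (auto simp: sol_def)
qed

text \<open>The unknown vector \<open>f i\<close> is replaced by its scalar coordinates over a
  finite basis \<open>U i\<close>, which \<open>dec\<close> turns back into a vector. Finiteness of
  the bases keeps the supports finite, and linearity of \<open>dec\<close> keeps the conditions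
  affine.\<close>

lemma affine_compactness_fin_dim:
  fixes K :: "('k, 'r) ring_scheme" and V :: "'i \<Rightarrow> ('k, 'm) module"
    and Q :: "'e \<Rightarrow> ('i \<Rightarrow> 'm) \<Rightarrow> bool"
  assumes V: "\<And>i. vectorspace K (V i)" "\<And>i. vectorspace.fin_dim K (V i)"
    and fin: "\<And>e. e \<in> E \<Longrightarrow> finite (supp e)"
    and cong: "\<And>e f g. e \<in> E \<Longrightarrow> (\<And>i. f i \<in> carrier (V i)) \<Longrightarrow> (\<And>i. g i \<in> carrier (V i)) \<Longrightarrow>
      (\<And>i. i \<in> supp e \<Longrightarrow> f i = g i) \<Longrightarrow> Q e f \<Longrightarrow> Q e g"
    and affine: "\<And>e f g t. e \<in> E \<Longrightarrow> (\<And>i. f i \<in> carrier (V i)) \<Longrightarrow> (\<And>i. g i \<in> carrier (V i)) \<Longrightarrow>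
      Q e f \<Longrightarrow> Q e g \<Longrightarrow> t \<in> carrier K \<Longrightarrow>
      Q e (\<lambda>i. f i \<oplus>\<^bsub>V i\<^esub> t \<odot>\<^bsub>V i\<^esub> (g i \<ominus>\<^bsub>V i\<^esub> f i))"
    and solvable: "\<And>F. finite F \<Longrightarrow> F \<subseteq> E \<Longrightarrow> \<exists>f. (\<forall>i. f i \<in> carrier (V i)) \<and> (\<forall>e\<in>F. Q e f)"
  shows "\<exists>f. (\<forall>i. f i \<in> carrier (V i)) \<and> (\<forall>e\<in>E. Q e f)"
proof -
  have "\<exists>U. finite U \<and> vectorspace.basis K (V i) U" for i
    using vectorspace.finite_basis_exists[OF V] .
  then obtain U where U: "\<And>i. finite (U i)" "\<And>i. vectorspace.basis K (V i) (U i)" by metis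
  have Uc: "U i \<subseteq> carrier (V i)" for i
    using U(2)[of i] vectorspace.basis_def[OF V(1)] by blast
  interpret V: vectorspace K "V i" for i by (rule V)
  define dec where "dec \<tau> i = module.lincomb (V i) (\<lambda>u. \<tau> (i, u)) (U i)" for \<tau> i
  have decc: "dec \<tau> i \<in> carrier (V i)" if "range \<tau> \<subseteq> carrier K" for \<tau> i
    unfolding dec_def using that Uc by (intro V.lincomb_closed) auto
  have "\<exists>\<tau>. range \<tau> \<subseteq> carrier K \<and> (\<forall>e\<in>E. Q e (dec \<tau>))"
  proof (rule affine_compactness[where supp = "\<lambda>e. Sigma (supp e) U"])
    show "field K" using V(1) by (simp add: vectorspace_def)
    show "finite (Sigma (supp e) U)" if "e \<in> E" for e
      using fin[OF that] U(1) by auto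
    show "Q e (dec \<tau>)"
      if e: "e \<in> E" and \<sigma>: "range \<sigma> \<subseteq> carrier K" and \<tau>: "range \<tau> \<subseteq> carrier K"
        and eq: "\<And>p. p \<in> Sigma (supp e) U \<Longrightarrow> \<sigma> p = \<tau> p" and Q: "Q e (dec \<sigma>)" for e \<sigma> \<tau>
    proof (rule cong[OF e decc[OF \<sigma>] decc[OF \<tau>] _ Q])
      fix i assume "i \<in> supp e"
      then show "dec \<sigma> i = dec \<tau> i"
        unfolding dec_def using Uc \<tau> by (intro V.lincomb_cong) (auto intro: eq)
    qed
    show "Q e (dec (\<lambda>p. \<sigma> p \<oplus>\<^bsub>K\<^esub> t \<otimes>\<^bsub>K\<^esub> (\<tau> p \<ominus>\<^bsub>K\<^esub> \<sigma> p)))"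
      if "e \<in> E" and \<sigma>: "range \<sigma> \<subseteq> carrier K" and \<tau>: "range \<tau> \<subseteq> carrier K"
        and "Q e (dec \<sigma>)" "Q e (dec \<tau>)" and t: "t \<in> carrier K" for e \<sigma> \<tau> t
    proof -
      have "dec (\<lambda>p. \<sigma> p \<oplus>\<^bsub>K\<^esub> t \<otimes>\<^bsub>K\<^esub> (\<tau> p \<ominus>\<^bsub>K\<^esub> \<sigma> p)) =
        (\<lambda>i. dec \<sigma> i \<oplus>\<^bsub>V i\<^esub> t \<odot>\<^bsub>V i\<^esub> (dec \<tau> i \<ominus>\<^bsub>V i\<^esub> dec \<sigma> i))"
      proof
        fix i
        have \<sigma>': "(\<lambda>u. \<sigma> (i, u)) \<in> U i \<rightarrow> carrier K" and \<tau>': "(\<lambda>u. \<tau> (i, u)) \<in> U i \<rightarrow> carrier K"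
          using \<sigma> \<tau> by auto
        then have d: "(\<lambda>u. \<tau> (i, u) \<ominus>\<^bsub>K\<^esub> \<sigma> (i, u)) \<in> U i \<rightarrow> carrier K" by (auto simp: Pi_iff)
        then have td: "(\<lambda>u. t \<otimes>\<^bsub>K\<^esub> (\<tau> (i, u) \<ominus>\<^bsub>K\<^esub> \<sigma> (i, u))) \<in> U i \<rightarrow> carrier K"
          using t by (auto simp: Pi_iff)
        show "dec (\<lambda>p. \<sigma> p \<oplus>\<^bsub>K\<^esub> t \<otimes>\<^bsub>K\<^esub> (\<tau> p \<ominus>\<^bsub>K\<^esub> \<sigma> p)) i =
          dec \<sigma> i \<oplus>\<^bsub>V i\<^esub> t \<odot>\<^bsub>V i\<^esub> (dec \<tau> i \<ominus>\<^bsub>V i\<^esub> dec \<sigma> i)"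
          unfolding dec_def
          by (simp add: V.lincomb_sum[OF U(1) Uc \<sigma>' td] V.lincomb_smult[OF Uc d t]
              V.lincomb_diff[OF U(1) Uc \<tau>' \<sigma>'])
      qed
      then show ?thesis using affine[OF \<open>e \<in> E\<close> decc[OF \<sigma>] decc[OF \<tau>] that(4,5) t] by simp
    qed
    show "\<exists>\<tau>. range \<tau> \<subseteq> carrier K \<and> (\<forall>e\<in>F. Q e (dec \<tau>))" if F: "finite F" "F \<subseteq> E" for F
    proof -
      obtain f where f: "\<And>i. f i \<in> carrier (V i)" "\<And>e. e \<in> F \<Longrightarrow> Q e f"
        using solvable[OF F] by blast
      have "\<exists>a. a \<in> U i \<rightarrow> carrier K \<and> module.lincomb (V i) a (U i) = f i" for i
        using V.finite_in_span[OF U(1) Uc, of "f i" i] f(1)[of i] U(2)[of i]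
        by (auto simp: V.basis_def)
      then obtain a where a: "\<And>i. a i \<in> U i \<rightarrow> carrier K"
        "\<And>i. module.lincomb (V i) (a i) (U i) = f i" by metis
      \<comment> \<open>Zero away from the bases, so that the scalar assignment is total with values
        in \<open>K\<close>.\<close>
      define \<tau> where "\<tau> = (\<lambda>(i, u). if u \<in> U i then a i u else \<zero>\<^bsub>K\<^esub>)"
      have "range \<tau> \<subseteq> carrier K" using a(1) by (auto simp: \<tau>_def Pi_iff)
      moreover have "dec \<tau> = f"
      proof
        fix i
        have "dec \<tau> i = module.lincomb (V i) (a i) (U i)"
          unfolding dec_def using a(1)[of i] Uc by (intro V.lincomb_cong) (auto simp: \<tau>_def)
        then show "dec \<tau> i = f i" by (simp add: a(2))
      qed
      ultimately show ?thesis using f(2) by blast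
    qed
  qed
  then show ?thesis using decc by blast
qed

section \<open>Extension of cocycles on linear orders\<close>

lemma finite_total_maximum:
  assumes "finite S" "S \<noteq> {}"
    and total: "\<And>a b. a \<in> S \<Longrightarrow> b \<in> S \<Longrightarrow> leq a b \<or> leq b a"
    and trans: "\<And>a b c. a \<in> S \<Longrightarrow> b \<in> S \<Longrightarrow> c \<in> S \<Longrightarrow> leq a b \<Longrightarrow> leq b c \<Longrightarrow> leq a c"
  shows "\<exists>m\<in>S. \<forall>a\<in>S. leq a m"
  using assms
proof (induction S rule: finite_ne_induct)
  case (singleton x)
  show ?case using singleton.prems(1)[of x x] by simp
next
  case (insert x S)
  have "\<exists>m\<in>S. \<forall>a\<in>S. leq a m"
  proof (rule insert.IH)
    show "leq a b \<or> leq b a" if "a \<in> S" "b \<in> S" for a b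
      using insert.prems(1) that by auto
    show "leq a c" if "a \<in> S" "b \<in> S" "c \<in> S" "leq a b" "leq b c" for a b c
      using insert.prems(2)[of a b c] that by auto
  qed
  then obtain m where m: "m \<in> S" "\<forall>a\<in>S. leq a m" by blast
  show ?case
  proof (cases "leq x m")
    case True
    then show ?thesis using m by auto
  next
    case False
    then have xm: "leq m x" using insert.prems(1)[of x m] m(1) by auto
    have "leq x x" using insert.prems(1)[of x x] by auto
    moreover have "leq a x" if "a \<in> S" for a
      using insert.prems(2)[of a m x] m that xm by auto
    ultimately show ?thesis by auto
  qed
qed

text \<open>The point with parameter \<open>t\<close> on the line through \<open>x\<close> and
  \<open>y\<close>. Naming it reduces affineness of the cocycle equations to four rules: it commutes
  with sums, scalars and homomorphisms, and it fixes constants.\<close>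

definition affine_comb :: "('k, 'm) module \<Rightarrow> 'k \<Rightarrow> 'm \<Rightarrow> 'm \<Rightarrow> 'm" where
  "affine_comb V t x y = x \<oplus>\<^bsub>V\<^esub> t \<odot>\<^bsub>V\<^esub> (y \<ominus>\<^bsub>V\<^esub> x)"

lemma affine_comb_plus:
  assumes "module K V" "t \<in> carrier K"
    and "x \<in> carrier V" "y \<in> carrier V" "x' \<in> carrier V" "y' \<in> carrier V"
  shows "affine_comb V t (x \<oplus>\<^bsub>V\<^esub> x') (y \<oplus>\<^bsub>V\<^esub> y') = affine_comb V t x y \<oplus>\<^bsub>V\<^esub> affine_comb V t x' y'"
proof -
  interpret module K V by fact
  show ?thesis using assms(2-)
    by (simp add: affine_comb_def minus_eq minus_add smult_r_distr smult_r_minus a_ac)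
qed

lemma affine_comb_smult:
  assumes "module K V" "t \<in> carrier K" "r \<in> carrier K" "x \<in> carrier V" "y \<in> carrier V"
  shows "affine_comb V t (r \<odot>\<^bsub>V\<^esub> x) (r \<odot>\<^bsub>V\<^esub> y) = r \<odot>\<^bsub>V\<^esub> affine_comb V t x y"
proof -
  interpret module K V by fact
  have "t \<odot>\<^bsub>V\<^esub> (r \<odot>\<^bsub>V\<^esub> w) = r \<odot>\<^bsub>V\<^esub> (t \<odot>\<^bsub>V\<^esub> w)" if "w \<in> carrier V" for w
    using that assms by (simp add: R.m_comm flip: smult_assoc1)
  with assms(2-) show ?thesis
    by (simp add: affine_comb_def minus_eq smult_r_distr smult_r_minus)
qed

lemma affine_comb_same:
  assumes "module K V" "t \<in> carrier K" "x \<in> carrier V"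
  shows "affine_comb V t x x = x"
proof -
  interpret module K V by fact
  show ?thesis using assms(2-) by (simp add: affine_comb_def minus_eq r_neg)
qed

lemma affine_comb_hom:
  assumes "module K V" "module K W" "f \<in> module_hom K V W" "t \<in> carrier K" "x \<in> carrier V" "y \<in> carrier V"
  shows "f (affine_comb V t x y) = affine_comb W t (f x) (f y)"
proof -
  interpret module K V by fact
  show ?thesis using assms
    by (simp add: affine_comb_def module_hom_add module_hom_smult module_hom_minus[OF assms(1-3)])
qed

text \<open>
  A cocycle \<open>c\<close> between representations \<open>B\<close> and \<open>Z\<close> of a linear order is what makes the
  triangular transition maps \<open>(z, b) \<mapsto> (\<zeta> z + c b, \<beta> b)\<close> on the spaces \<open>Z \<oplus> B\<close>
  compatible with composition.
\<close>

locale linear_order_reps =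
  fixes K :: "('k, 'r) ring_scheme" and X :: "'x set" and leq :: "'x \<Rightarrow> 'x \<Rightarrow> bool"
    and B Z :: "'x \<Rightarrow> ('k, 'm) module" and \<beta> \<zeta> :: "'x \<Rightarrow> 'x \<Rightarrow> 'm \<Rightarrow> 'm"
  assumes field_K: "field K"
    and leq_refl: "a \<in> X \<Longrightarrow> leq a a"
    and leq_trans: "a \<in> X \<Longrightarrow> b \<in> X \<Longrightarrow> c \<in> X \<Longrightarrow> leq a b \<Longrightarrow> leq b c \<Longrightarrow> leq a c"
    and leq_antisym: "a \<in> X \<Longrightarrow> b \<in> X \<Longrightarrow> leq a b \<Longrightarrow> leq b a \<Longrightarrow> a = b"
    and leq_total: "a \<in> X \<Longrightarrow> b \<in> X \<Longrightarrow> leq a b \<or> leq b a"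
    and B: "a \<in> X \<Longrightarrow> module K (B a)"
    and Z: "a \<in> X \<Longrightarrow> vectorspace K (Z a)" "a \<in> X \<Longrightarrow> vectorspace.fin_dim K (Z a)"
    and \<beta>_hom: "a \<in> X \<Longrightarrow> b \<in> X \<Longrightarrow> leq a b \<Longrightarrow> \<beta> a b \<in> module_hom K (B a) (B b)"
    and \<zeta>_hom: "a \<in> X \<Longrightarrow> b \<in> X \<Longrightarrow> leq a b \<Longrightarrow> \<zeta> a b \<in> module_hom K (Z a) (Z b)"
    and \<beta>_id: "a \<in> X \<Longrightarrow> u \<in> carrier (B a) \<Longrightarrow> \<beta> a a u = u"
    and \<zeta>_id: "a \<in> X \<Longrightarrow> v \<in> carrier (Z a) \<Longrightarrow> \<zeta> a a v = v"
    and \<beta>_comp: "a \<in> X \<Longrightarrow> b \<in> X \<Longrightarrow> c \<in> X \<Longrightarrow> leq a b \<Longrightarrow> leq b c \<Longrightarrow> u \<in> carrier (B a) \<Longrightarrow>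
      \<beta> b c (\<beta> a b u) = \<beta> a c u"
    and \<zeta>_comp: "a \<in> X \<Longrightarrow> b \<in> X \<Longrightarrow> c \<in> X \<Longrightarrow> leq a b \<Longrightarrow> leq b c \<Longrightarrow> v \<in> carrier (Z a) \<Longrightarrow>
      \<zeta> b c (\<zeta> a b v) = \<zeta> a c v"
begin

text \<open>The set \<open>I a\<close> bounds the arguments for which the identity is demanded: an
  image subspace for the given family, the whole carrier for its extension. In both cases the maps
  are linear on all of \<open>B a\<close>, as \<open>linear_family\<close> records.\<close>

definition cocycle :: "'x set \<Rightarrow> ('x \<Rightarrow> 'm set) \<Rightarrow> ('x \<Rightarrow> 'x \<Rightarrow> 'm \<Rightarrow> 'm) \<Rightarrow> bool" where
  "cocycle S I c \<longleftrightarrow>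
    (\<forall>a\<in>S. \<forall>b\<in>S. \<forall>d\<in>S. \<forall>u\<in>I a. leq a b \<longrightarrow> leq b d \<longrightarrow>
      c a d u = \<zeta> b d (c a b u) \<oplus>\<^bsub>Z d\<^esub> c b d (\<beta> a b u))"

definition linear_family :: "'x set \<Rightarrow> ('x \<Rightarrow> 'x \<Rightarrow> 'm \<Rightarrow> 'm) \<Rightarrow> bool" where
  "linear_family S c \<longleftrightarrow>
    (\<forall>a\<in>S. \<forall>b\<in>S. leq a b \<longrightarrow> c a b \<in> module_hom K (B a) (Z b))"

lemma Z_module: "a \<in> X \<Longrightarrow> module K (Z a)"
  using Z(1) by (simp add: vectorspace_def)

text \<open>The identity at \<open>a\<close>, \<open>a\<close>, \<open>a\<close> reads
  \<open>c a a u = c a a u + c a a u\<close>.\<close>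

lemma cocycle_refl:
  assumes "cocycle S I c" "linear_family S c" "S \<subseteq> X" "a \<in> S" "u \<in> I a" "u \<in> carrier (B a)"
  shows "c a a u = \<zero>\<^bsub>Z a\<^esub>"
proof -
  have a: "a \<in> X" "leq a a" using assms(3,4) leq_refl by auto
  interpret Za: module K "Z a" by (rule Z_module[OF a(1)])
  have "c a a \<in> module_hom K (B a) (Z a)" using assms(2,4) a(2) by (simp add: linear_family_def)
  then have c: "c a a u \<in> carrier (Z a)" using assms(6) by (rule module_hom_carrier)
  have "c a a u = \<zeta> a a (c a a u) \<oplus>\<^bsub>Z a\<^esub> c a a (\<beta> a a u)"
    using assms(1,4,5) a(2) unfolding cocycle_def by blast
  then have "c a a u = c a a u \<oplus>\<^bsub>Z a\<^esub> c a a u"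
    using \<zeta>_id[OF a(1) c] \<beta>_id[OF a(1) assms(6)] by simp
  then show ?thesis using c by (metis Za.add.r_cancel_one' Za.zero_closed)
qed

context
  fixes I :: "'x \<Rightarrow> 'm set" and c0 :: "'x \<Rightarrow> 'x \<Rightarrow> 'm \<Rightarrow> 'm"
  assumes I: "\<And>a. a \<in> X \<Longrightarrow> I a \<subseteq> carrier (B a)"
    and \<beta>_I: "\<And>a b u. a \<in> X \<Longrightarrow> b \<in> X \<Longrightarrow> leq a b \<Longrightarrow> u \<in> I a \<Longrightarrow> \<beta> a b u \<in> I b"
    and c0: "linear_family X c0" "cocycle X I c0"
begin

definition extends_c0 :: "'x set \<Rightarrow> ('x \<Rightarrow> 'x \<Rightarrow> 'm \<Rightarrow> 'm) \<Rightarrow> bool" where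
  "extends_c0 S c \<longleftrightarrow> (\<forall>a\<in>S. \<forall>b\<in>S. \<forall>u\<in>I a. leq a b \<longrightarrow> c a b u = c0 a b u)"

lemma c0_refl: "a \<in> X \<Longrightarrow> u \<in> I a \<Longrightarrow> c0 a a u = \<zero>\<^bsub>Z a\<^esub>"
  using cocycle_refl[OF c0(2,1), of a u] I by auto

text \<open>
  On a finite chain a cocycle is freely determined by its values on consecutive elements: a new
  maximum \<open>m\<close> with predecessor \<open>p\<close> is added by prescribing \<open>c p m\<close> to be \<open>c0 p m\<close>.
\<close>

lemma finite_extension:
  assumes "finite S" "S \<subseteq> X"
  shows "\<exists>c. linear_family S c \<and> cocycle S (\<lambda>a. carrier (B a)) c \<and> extends_c0 S c"
  using assms
proof (induction "card S" arbitrary: S)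
  case 0
  then show ?case by (auto simp: linear_family_def cocycle_def extends_c0_def)
next
  case (Suc n)
  have max_ex: "\<exists>m\<in>T. \<forall>a\<in>T. leq a m" if "T \<subseteq> S" "T \<noteq> {}" for T
  proof (rule finite_total_maximum)
    have TX: "T \<subseteq> X" using that(1) Suc.prems(2) by simp
    show "finite T" "T \<noteq> {}" using that Suc.prems(1) finite_subset by auto
    show "leq a b \<or> leq b a" if "a \<in> T" "b \<in> T" for a b
      using leq_total TX that by blast
    show "leq a c" if "a \<in> T" "b \<in> T" "c \<in> T" "leq a b" "leq b c" for a b c
      using leq_trans[of a b c] TX that by blast
  qed
  obtain m where m: "m \<in> S" "\<And>a. a \<in> S \<Longrightarrow> leq a m"
  proof -
    have "S \<noteq> {}" using Suc.hyps(2) by auto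
    then show thesis using max_ex[of S] that by blast
  qed
  have mX: "m \<in> X" using m Suc.prems by auto
  interpret Zm: module K "Z m" by (rule Z_module[OF mX])
  define T where "T = S - {m}"
  have S: "S = insert m T" "m \<notin> T" and T: "finite T" "T \<subseteq> X" "n = card T"
    using m(1) Suc.prems Suc.hyps(2) by (auto simp: T_def)
  have not_le: "\<not> leq m a" if "a \<in> T" for a
    using leq_antisym[of m a] m that S T mX by auto
  obtain c where c: "linear_family T c" "cocycle T (\<lambda>a. carrier (B a)) c" "extends_c0 T c"
    using Suc.hyps(1)[OF T(3,1,2)] by blast
  show ?case
  proof (cases "T = {}")
    case True
    \<comment> \<open>A one-element chain leaves only the pair \<open>(m, m)\<close>, where every
      cocycle vanishes; \<open>c0\<close> does so on \<open>I m\<close> by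
      \<open>c0_refl\<close>.\<close>
    define d :: "'x \<Rightarrow> 'x \<Rightarrow> 'm \<Rightarrow> 'm" where "d = (\<lambda>_ _ _. \<zero>\<^bsub>Z m\<^esub>)"
    have "linear_family S d" "cocycle S (\<lambda>a. carrier (B a)) d" "extends_c0 S d"
      using S(1) True mX \<zeta>_id[of m "\<zero>\<^bsub>Z m\<^esub>"] c0_refl[of m]
      by (auto simp: linear_family_def cocycle_def extends_c0_def d_def
          intro!: module_hom_const_zero Z_module)
    then show ?thesis by blast
  next
    case False
    then obtain p where p: "p \<in> T" "\<And>a. a \<in> T \<Longrightarrow> leq a p"
      using max_ex[of T] S(1) by blast
    have pX: "p \<in> X" and pm: "leq p m" using p T m S by auto
    have c0pm: "c0 p m \<in> module_hom K (B p) (Z m)"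
      using c0(1) pX mX pm by (simp add: linear_family_def)
    have chom: "c a b \<in> module_hom K (B a) (Z b)" if "a \<in> T" "b \<in> T" "leq a b" for a b
      using c(1) that by (simp add: linear_family_def)
    \<comment> \<open>This is forced by the cocycle identity at \<open>a\<close>, \<open>p\<close>,
      \<open>m\<close> once \<open>c p m\<close> is set to \<open>c0 p m\<close>. That choice is
      linear on all of \<open>B p\<close>, because only the identity for \<open>c0\<close>, not its
      linearity, is confined to \<open>I\<close>.\<close>
    define g where "g a u = \<zeta> p m (c a p u) \<oplus>\<^bsub>Z m\<^esub> c0 p m (\<beta> a p u)" for a u
    define d where "d = (\<lambda>a b u. if b \<noteq> m then c a b u else if a = m then \<zero>\<^bsub>Z m\<^esub> else g a u)"
    have d: "b \<in> T \<Longrightarrow> d a b = c a b" "a \<in> T \<Longrightarrow> d a m = g a" "d m m = (\<lambda>_. \<zero>\<^bsub>Z m\<^esub>)" for a b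
      using S(2) by (auto simp: d_def fun_eq_iff)
    have ghom: "g a \<in> module_hom K (B a) (Z m)" if "a \<in> T" for a
    proof -
      have a: "a \<in> X" "leq a p" using that T p by auto
      show ?thesis unfolding g_def
        using module_hom_plus[OF Zm.module_axioms
            module_hom_compose[OF chom[OF that p(1) a(2)] \<zeta>_hom[OF pX mX pm]]
            module_hom_compose[OF \<beta>_hom[OF a(1) pX a(2)] c0pm]] .
    qed
    have "linear_family S d"
      unfolding linear_family_def
    proof (intro ballI impI)
      fix a b assume ab: "a \<in> S" "b \<in> S" "leq a b"
      consider "a \<in> T" "b \<in> T" | "a \<in> T" "b = m" | "a = m" "b = m"
        using ab not_le S by auto
      then show "d a b \<in> module_hom K (B a) (Z b)"
        by cases (use ab(3) chom ghom d module_hom_const_zero[OF Zm.module_axioms] in auto)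
    qed
    moreover have "cocycle S (\<lambda>a. carrier (B a)) d"
      unfolding cocycle_def
    proof (intro ballI impI)
      fix a b e u assume abe: "a \<in> S" "b \<in> S" "e \<in> S" "leq a b" "leq b e" and u: "u \<in> carrier (B a)"
      have X: "a \<in> X" "b \<in> X" "e \<in> X" "leq a e"
        using abe Suc.prems(2) leq_trans[of a b e] by auto
      consider "a \<in> T" "b \<in> T" "e \<in> T" | "a \<in> T" "b \<in> T" "e = m" | "a \<in> T" "b = m" "e = m"
        | "a = m" "b = m" "e = m"
        using abe X(4) not_le S by auto
      then show "d a e u = \<zeta> b e (d a b u) \<oplus>\<^bsub>Z e\<^esub> d b e (\<beta> a b u)"
      proof cases
        case 1
        then show ?thesis using c(2) abe(4,5) u by (simp add: cocycle_def d)
      next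
        case 2
        \<comment> \<open>Every map into \<open>m\<close> passes through \<open>p\<close>, so the
          identity of \<open>c\<close> at \<open>a\<close>, \<open>b\<close>, \<open>p\<close> is
          pushed forward by \<open>\<zeta> p m\<close>.\<close>
        have ap: "leq a p" and bp: "leq b p" using p 2 by auto
        have cab: "c a b u \<in> carrier (Z b)" using module_hom_carrier[OF chom[OF 2(1,2) abe(4)] u] .
        have bu: "\<beta> a b u \<in> carrier (B b)" using module_hom_carrier[OF \<beta>_hom[OF X(1,2) abe(4)] u] .
        have v1: "\<zeta> b p (c a b u) \<in> carrier (Z p)"
          using module_hom_carrier[OF \<zeta>_hom[OF X(2) pX bp] cab] .
        have v2: "c b p (\<beta> a b u) \<in> carrier (Z p)"
          using module_hom_carrier[OF chom[OF 2(2) p(1) bp] bu] .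
        have v3: "c0 p m (\<beta> a p u) \<in> carrier (Z m)"
          using module_hom_carrier[OF c0pm module_hom_carrier[OF \<beta>_hom[OF X(1) pX ap] u]] .
        have "c a p u = \<zeta> b p (c a b u) \<oplus>\<^bsub>Z p\<^esub> c b p (\<beta> a b u)"
          using c(2) 2(1,2) p(1) abe(4) bp u unfolding cocycle_def by blast
        then have "g a u = (\<zeta> p m (\<zeta> b p (c a b u)) \<oplus>\<^bsub>Z m\<^esub> \<zeta> p m (c b p (\<beta> a b u))) \<oplus>\<^bsub>Z m\<^esub> c0 p m (\<beta> a p u)"
          using module_hom_add[OF \<zeta>_hom[OF pX mX pm] v1 v2] by (simp add: g_def)
        also have "\<dots> = \<zeta> b m (c a b u) \<oplus>\<^bsub>Z m\<^esub> g b (\<beta> a b u)"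
          using module_hom_carrier[OF \<zeta>_hom[OF pX mX pm] v1] module_hom_carrier[OF \<zeta>_hom[OF pX mX pm] v2] v3
          by (simp add: g_def Zm.a_assoc \<zeta>_comp[OF X(2) pX mX bp pm cab] \<beta>_comp[OF X(1,2) pX abe(4) bp u])
        finally show ?thesis using 2 by (simp add: d)
      next
        case 3
        have "g a u \<in> carrier (Z m)" using module_hom_carrier[OF ghom[OF 3(1)] u] .
        then show ?thesis using 3 mX by (simp add: d \<zeta>_id)
      next
        case 4
        then show ?thesis using mX by (simp add: d \<zeta>_id)
      qed
    qed
    moreover have "extends_c0 S d"
      unfolding extends_c0_def
    proof (intro ballI impI)
      fix a b u assume ab: "a \<in> S" "b \<in> S" and u: "u \<in> I a" and leq: "leq a b"
      consider "a \<in> T" "b \<in> T" | "a \<in> T" "b = m" | "a = m" "b = m"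
        using ab leq not_le S by auto
      then show "d a b u = c0 a b u"
      proof cases
        case 1
        then show ?thesis using c(3) u leq by (simp add: d extends_c0_def)
      next
        case 2
        have ap: "a \<in> X" "leq a p" using 2 p T by auto
        \<comment> \<open>For \<open>u\<close> in \<open>I a\<close> the formula for
          \<open>g\<close> turns into the cocycle identity of \<open>c0\<close> at \<open>a\<close>,
          \<open>p\<close>, \<open>m\<close>.\<close>
        have "c a p u = c0 a p u"
          using c(3) 2 p(1) ap(2) u unfolding extends_c0_def by blast
        moreover have "c0 a m u = \<zeta> p m (c0 a p u) \<oplus>\<^bsub>Z m\<^esub> c0 p m (\<beta> a p u)"
          using c0(2) ap pX mX pm u unfolding cocycle_def by blast
        ultimately show ?thesis using 2 by (simp add: d g_def)
      next
        case 3
        then show ?thesis using c0_refl[OF mX] u by (simp add: d)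
      qed
    qed
    ultimately show ?thesis by blast
  qed
qed

text \<open>The value of \<open>c a b\<close> at each single vector \<open>u\<close> is an unknown
  in \<open>Z b\<close>. Additivity, homogeneity, the cocycle identity and agreement with
  \<open>c0\<close> are then affine conditions on finitely many unknowns each, and finitely many of
  them mention only a finite chain, where \<open>finite_extension\<close> solves them.\<close>

theorem cocycle_extension:
  "\<exists>c. linear_family X c \<and> cocycle X (\<lambda>a. carrier (B a)) c \<and> extends_c0 X c"
proof -
  \<comment> \<open>The compactness statement wants a vector space for every index; indices with
    \<open>b\<close> outside \<open>X\<close> get the zero space.\<close>
  define V where "V = (\<lambda>(a :: 'x, b, u :: 'm). if b \<in> X then Z b else zero_space)"
  have V: "vectorspace K (V i)" "vectorspace.fin_dim K (V i)" for i
    using Z vectorspace_zero_space[OF field_K] by (auto simp: V_def split: prod.splits)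
  have VZ: "V (a, b, u) = Z b" if "b \<in> X" for a b u using that by (simp add: V_def)
  define E where "E = {(a, b, d, u, v, r). a \<in> X \<and> b \<in> X \<and> d \<in> X \<and> leq a b \<and> leq b d \<and>
    u \<in> carrier (B a) \<and> v \<in> carrier (B a) \<and> r \<in> carrier K}"
  define Q where "Q = (\<lambda>(a, b, d, u, v, r) f.
    f (a, b, u \<oplus>\<^bsub>B a\<^esub> v) = f (a, b, u) \<oplus>\<^bsub>Z b\<^esub> f (a, b, v) \<and>
    f (a, b, r \<odot>\<^bsub>B a\<^esub> u) = r \<odot>\<^bsub>Z b\<^esub> f (a, b, u) \<and>
    f (a, d, u) = \<zeta> b d (f (a, b, u)) \<oplus>\<^bsub>Z d\<^esub> f (b, d, \<beta> a b u) \<and>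
    (u \<in> I a \<longrightarrow> f (a, b, u) = c0 a b u))"
  define supp where "supp = (\<lambda>(a, b, d, u, v, r).
    {(a, b, u \<oplus>\<^bsub>B a\<^esub> v), (a, b, u), (a, b, v), (a, b, r \<odot>\<^bsub>B a\<^esub> u), (a, d, u), (b, d, \<beta> a b u)})"
  have "\<exists>f. (\<forall>i. f i \<in> carrier (V i)) \<and> (\<forall>e\<in>E. Q e f)"
  proof (rule affine_compactness_fin_dim[OF V, where supp = supp])
    show "finite (supp e)" for e by (simp add: supp_def split: prod.splits)
    show "Q e g" if "\<And>i. i \<in> supp e \<Longrightarrow> f i = g i" "Q e f" for e and f g :: "'x \<times> 'x \<times> 'm \<Rightarrow> 'm"
      using that by (auto simp: supp_def Q_def split: prod.splits)
    show "Q e (\<lambda>i. f i \<oplus>\<^bsub>V i\<^esub> t \<odot>\<^bsub>V i\<^esub> (g i \<ominus>\<^bsub>V i\<^esub> f i))"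
      if e: "e \<in> E" and f: "\<And>i. f i \<in> carrier (V i)" and g: "\<And>i. g i \<in> carrier (V i)"
        and Qf: "Q e f" and Qg: "Q e g" and t: "t \<in> carrier K" for e f g t
    proof -
      obtain a b d u v r where e_eq: "e = (a, b, d, u, v, r)" by (metis prod.exhaust)
      with e have X: "a \<in> X" "b \<in> X" "d \<in> X" "leq a b" "leq b d" and r: "r \<in> carrier K"
        by (auto simp: E_def)
      note Vb = VZ[OF X(2)] and Vd = VZ[OF X(3)]
      have fb: "f (x, b, w) \<in> carrier (Z b)" "g (x, b, w) \<in> carrier (Z b)" for x w
        using f[of "(x, b, w)"] g[of "(x, b, w)"] by (simp_all add: Vb)
      have fd: "f (x, d, w) \<in> carrier (Z d)" "g (x, d, w) \<in> carrier (Z d)" for x w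
        using f[of "(x, d, w)"] g[of "(x, d, w)"] by (simp_all add: Vd)
      note mb = Z_module[OF X(2)] and md = Z_module[OF X(3)]
      note hom = \<zeta>_hom[OF X(2,3,5)]
      have c0u: "u \<in> I a \<Longrightarrow> c0 a b u \<in> carrier (Z b)"
        using c0(1) X(1,2,4) e by (auto simp: linear_family_def E_def e_eq intro: module_hom_carrier)
      \<comment> \<open>Written with \<open>affine_comb\<close>, both sides of each of the four
        conditions commute with the combination; the value of \<open>c0\<close> is a
        constant.\<close>
      show ?thesis
        using Qf Qg unfolding e_eq Q_def
        by (simp add: Vb Vd flip: affine_comb_def)
          (simp add: affine_comb_plus[OF mb] affine_comb_plus[OF md] affine_comb_smult[OF mb]
            affine_comb_same[OF mb] affine_comb_hom[OF mb md hom] fb fd t r c0u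
            module_hom_carrier[OF hom])
    qed
    show "\<exists>f. (\<forall>i. f i \<in> carrier (V i)) \<and> (\<forall>e\<in>F. Q e f)" if F: "finite F" "F \<subseteq> E" for F
    proof -
      define S where "S = (\<Union>(a, b, d, u, v, r)\<in>F. {a, b, d})"
      have "finite S" using F(1) by (auto simp: S_def)
      moreover have SX: "S \<subseteq> X" using F(2) by (auto simp: S_def E_def)
      ultimately obtain c where c: "linear_family S c" "cocycle S (\<lambda>a. carrier (B a)) c" "extends_c0 S c"
        using finite_extension by blast
      \<comment> \<open>Zero is a mere default: for the equations in \<open>F\<close> all chain
        elements lie in \<open>S\<close>, all pairs are comparable and all arguments lie in the
        carriers.\<close>
      define f where "f = (\<lambda>(a, b, u). if a \<in> S \<and> b \<in> S \<and> leq a b \<and> u \<in> carrier (B a) then c a b u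
        else \<zero>\<^bsub>V (a, b, u)\<^esub>)"
      have chom: "c a b \<in> module_hom K (B a) (Z b)" if "a \<in> S" "b \<in> S" "leq a b" for a b
        using c(1) that by (simp add: linear_family_def)
      have "f i \<in> carrier (V i)" for i
      proof -
        obtain a b u where i: "i = (a, b, u)" by (metis prod.exhaust)
        interpret Vi: vectorspace K "V (a, b, u)" by (rule V)
        show ?thesis
        proof (cases "a \<in> S \<and> b \<in> S \<and> leq a b \<and> u \<in> carrier (B a)")
          case True
          then have "b \<in> X" using SX by blast
          then show ?thesis
            using True module_hom_carrier[OF chom, of a b u] by (simp add: i f_def VZ)
        next
          case False
          then show ?thesis by (auto simp: i f_def)
        qed
      qed
      moreover have "Q e f" if "e \<in> F" for e
      proof -
        obtain a b d u v r where e: "e = (a, b, d, u, v, r)" by (metis prod.exhaust)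
        with that have S: "a \<in> S" "b \<in> S" "d \<in> S" by (auto simp: S_def intro!: bexI[of _ e])
        from that F(2) e have X: "a \<in> X" "b \<in> X" "d \<in> X" "leq a b" "leq b d"
          and u: "u \<in> carrier (B a)" "v \<in> carrier (B a)" "r \<in> carrier K" by (auto simp: E_def)
        have ad: "leq a d" using leq_trans[OF X] .
        interpret Ba: module K "B a" by (rule B[OF X(1)])
        have fc: "f (a, b, w) = c a b w" "f (a, d, w) = c a d w" if "w \<in> carrier (B a)" for w
          using that S X ad by (auto simp: f_def)
        have fc': "f (b, d, \<beta> a b u) = c b d (\<beta> a b u)"
          using S X module_hom_carrier[OF \<beta>_hom[OF X(1,2,4)] u(1)] by (simp add: f_def)
        have "c a d u = \<zeta> b d (c a b u) \<oplus>\<^bsub>Z d\<^esub> c b d (\<beta> a b u)"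
          using c(2) S X(4,5) u(1) unfolding cocycle_def by blast
        moreover have "u \<in> I a \<longrightarrow> c a b u = c0 a b u"
          using c(3) S X(4) unfolding extends_c0_def by blast
        ultimately show ?thesis
          using u chom[OF S(1,2) X(4)]
          by (simp add: e Q_def fc fc' module_hom_add module_hom_smult)
      qed
      ultimately show ?thesis by blast
    qed
  qed
  then obtain f where f: "\<And>i. f i \<in> carrier (V i)" "\<And>e. e \<in> E \<Longrightarrow> Q e f" by blast
  define c where "c a b u = f (a, b, u)" for a b u
  \<comment> \<open>One index carries four conditions at once. The instances below fill the entries
    irrelevant to the wanted condition with \<open>d = b\<close>, a repeated vector or the zero
    scalar.\<close>
  have QE: "Q (a, b, d, u, v, r) f" if "a \<in> X" "b \<in> X" "d \<in> X" "leq a b" "leq b d"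
    "u \<in> carrier (B a)" "v \<in> carrier (B a)" "r \<in> carrier K" for a b d u v r
    using that by (intro f(2)) (simp add: E_def)
  interpret field K by (rule field_K)
  have "linear_family X c"
    unfolding linear_family_def
  proof (intro ballI impI module_homI)
    fix a b assume ab: "a \<in> X" "b \<in> X" "leq a b"
    have bb: "leq b b" using leq_refl ab by simp
    show "c a b u \<in> carrier (Z b)" for u
      using f(1)[of "(a, b, u)"] VZ[OF ab(2)] by (simp add: c_def)
    show "c a b (u \<oplus>\<^bsub>B a\<^esub> v) = c a b u \<oplus>\<^bsub>Z b\<^esub> c a b v" if "u \<in> carrier (B a)" "v \<in> carrier (B a)" for u v
      using QE[OF ab(1,2,2,3) bb that zero_closed] by (simp add: Q_def c_def)
    show "c a b (r \<odot>\<^bsub>B a\<^esub> u) = r \<odot>\<^bsub>Z b\<^esub> c a b u" if "r \<in> carrier K" "u \<in> carrier (B a)" for r u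
      using QE[OF ab(1,2,2,3) bb that(2,2,1)] by (simp add: Q_def c_def)
  qed
  moreover have "cocycle X (\<lambda>a. carrier (B a)) c"
    unfolding cocycle_def c_def
    using QE[OF _ _ _ _ _ _ _ zero_closed] by (auto simp: Q_def)
  moreover have "c a b u = c0 a b u" if "a \<in> X" "b \<in> X" "leq a b" "u \<in> I a" for a b u
  proof -
    have "u \<in> carrier (B a)" using that I by blast
    then show ?thesis
      using QE[OF that(1,2,2,3) leq_refl[OF that(2)] _ _ zero_closed] that(4) by (simp add: Q_def c_def)
  qed
  then have "extends_c0 X c" by (simp add: extends_c0_def)
  ultimately show ?thesis by blast
qed

end

end

section \<open>Representations of thread categories by generators\<close>

definition gen_class :: "('v, 'a) pre_digraph \<Rightarrow> ('a \<Rightarrow> 'p rel) \<Rightarrow> ('a, 'p) gen \<Rightarrow> ('v, 'a, 'p) tpath set" where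
  "gen_class Q P = (\<lambda>(\<alpha>, a, b). path_class Q P (bar_obj Q \<alpha> a, [(\<alpha>, a, b)], bar_obj Q \<alpha> b))"

definition gens :: "('v, 'a) pre_digraph \<Rightarrow> ('a \<Rightarrow> 'p rel) \<Rightarrow> ('a, 'p) gen set" where
  "gens Q P = {(\<alpha>, a, b). \<alpha> \<in> arcs Q \<and> (a, b) \<in> bar_order (P \<alpha>)}"

lemma is_path_append_split:
  "is_path Q P x (us @ vs) z \<Longrightarrow> thread_quiver Q P \<Longrightarrow> \<exists>y. is_path Q P x us y \<and> is_path Q P y vs z"
proof (induction us arbitrary: x)
  case Nil
  then show ?case using is_path_ends[of Q P x vs z] by (auto intro: is_path.Nil)
next
  case (Cons g us)
  from Cons.prems(1) obtain \<alpha> a b where g: "g = (\<alpha>, a, b)" "x = bar_obj Q \<alpha> a" "\<alpha> \<in> arcs Q"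
    "(a, b) \<in> bar_order (P \<alpha>)" "is_path Q P (bar_obj Q \<alpha> b) (us @ vs) z"
    by (auto elim: is_path.cases)
  then show ?case using Cons.IH[OF g(5) Cons.prems(2)] by (auto intro: is_path.Cons)
qed

locale thread_category =
  fixes Q :: "('v, 'a) pre_digraph" and P :: "'a \<Rightarrow> 'p rel" and K :: "('k, 'r) ring_scheme"
  assumes thread_quiver: "thread_quiver Q P" and field_K: "field K"
begin

abbreviation C where "C \<equiv> thread_cat Q P"

section \<open>Generators as morphisms of the thread category\<close>

lemma Ob_C [simp]: "Ob C = tc_objects Q P"
  by (simp add: thread_cat_def)

lemma Hom_C: "f \<in> Hom C x y \<longleftrightarrow> (\<exists>us. f = path_class Q P (x, us, y) \<and> is_path Q P x us y)"
  by (auto simp: thread_cat_def)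

lemma Ident_C: "Ident C x = path_class Q P (x, [], x)"
  by (simp add: thread_cat_def)

lemma bar_obj_in_objects:
  assumes "\<alpha> \<in> arcs Q" "a \<in> bar_carrier (P \<alpha>)"
  shows "bar_obj Q \<alpha> a \<in> tc_objects Q P"
  using assms thread_quiver
  by (auto simp: bar_carrier_def tc_objects_def thread_quiver_def
      wf_digraph.tail_in_verts wf_digraph.head_in_verts)

lemma gens_ends:
  assumes "(\<alpha>, a, b) \<in> gens Q P"
  shows "\<alpha> \<in> arcs Q" "(a, b) \<in> bar_order (P \<alpha>)" "a \<in> bar_carrier (P \<alpha>)" "b \<in> bar_carrier (P \<alpha>)"
    "bar_obj Q \<alpha> a \<in> tc_objects Q P" "bar_obj Q \<alpha> b \<in> tc_objects Q P"
  using assms bar_obj_in_objects by (auto simp: gens_def bar_order_def)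

lemma is_path_gen:
  assumes "(\<alpha>, a, b) \<in> gens Q P"
  shows "is_path Q P (bar_obj Q \<alpha> a) [(\<alpha>, a, b)] (bar_obj Q \<alpha> b)"
  using gens_ends[OF assms] by (intro is_path.Cons is_path.Nil)

lemma gen_class_Hom:
  "(\<alpha>, a, b) \<in> gens Q P \<Longrightarrow> gen_class Q P (\<alpha>, a, b) \<in> Hom C (bar_obj Q \<alpha> a) (bar_obj Q \<alpha> b)"
  using is_path_gen by (auto simp: Hom_C gen_class_def)

lemma gen_class_refl:
  assumes "\<alpha> \<in> arcs Q" "a \<in> bar_carrier (P \<alpha>)" "(a, a) \<in> bar_order (P \<alpha>)"
  shows "gen_class Q P (\<alpha>, a, a) = Ident C (bar_obj Q \<alpha> a)"
proof -
  have "is_path Q P (bar_obj Q \<alpha> a) [(\<alpha>, a, a)] (bar_obj Q \<alpha> a)"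
    using is_path_gen assms by (simp add: gens_def)
  moreover have "is_path Q P (bar_obj Q \<alpha> a) [] (bar_obj Q \<alpha> a)"
    using bar_obj_in_objects assms by (intro is_path.Nil)
  ultimately have "path_rel Q P (bar_obj Q \<alpha> a, [(\<alpha>, a, a)], bar_obj Q \<alpha> a)
    (bar_obj Q \<alpha> a, [], bar_obj Q \<alpha> a)"
    using elem_rel.ident[of "[]" \<alpha> a "[]"] by (intro path_rel.intros) auto
  then show ?thesis
    unfolding gen_class_def Ident_C by (simp add: path_class_eqI r_into_equivclp)
qed

lemma bar_order_trans:
  assumes "\<alpha> \<in> arcs Q" "(a, b) \<in> bar_order (P \<alpha>)" "(b, d) \<in> bar_order (P \<alpha>)"
  shows "(a, d) \<in> bar_order (P \<alpha>)"
proof -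
  have "trans (P \<alpha>)"
    using thread_quiver assms(1)
    by (auto simp: thread_quiver_def linear_order_on_def partial_order_on_def preorder_on_def)
  with assms(2,3) show ?thesis
    unfolding bar_order_def by (auto dest: transD)
qed

lemma bar_order_linear:
  assumes "\<alpha> \<in> arcs Q" "a \<in> bar_carrier (P \<alpha>)" "b \<in> bar_carrier (P \<alpha>)"
  shows "(a, a) \<in> bar_order (P \<alpha>)" "(a, b) \<in> bar_order (P \<alpha>) \<or> (b, a) \<in> bar_order (P \<alpha>)"
    "(a, b) \<in> bar_order (P \<alpha>) \<Longrightarrow> (b, a) \<in> bar_order (P \<alpha>) \<Longrightarrow> a = b"
proof -
  have "total_on (Field (P \<alpha>)) (P \<alpha>)" "antisym (P \<alpha>)" "refl_on (Field (P \<alpha>)) (P \<alpha>)"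
    using thread_quiver assms(1)
    by (auto simp: thread_quiver_def linear_order_on_def partial_order_on_def preorder_on_def)
  note * = refl_onD[OF this(3)] this(1)[unfolded total_on_def, rule_format] antisymD[OF this(2)]
  show "(a, a) \<in> bar_order (P \<alpha>)"
    using assms(2) *(1) by (auto simp: bar_order_def bar_carrier_def)
  show "(a, b) \<in> bar_order (P \<alpha>) \<or> (b, a) \<in> bar_order (P \<alpha>)"
    using assms(2,3) *(1,2) by (fastforce simp: bar_order_def bar_carrier_def)
  show "(a, b) \<in> bar_order (P \<alpha>) \<Longrightarrow> (b, a) \<in> bar_order (P \<alpha>) \<Longrightarrow> a = b"
    using *(3) by (auto simp: bar_order_def)
qed

lemma gen_class_comp:
  assumes "\<alpha> \<in> arcs Q" "(a, b) \<in> bar_order (P \<alpha>)" "(b, d) \<in> bar_order (P \<alpha>)"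
  shows "Cmp C (gen_class Q P (\<alpha>, b, d)) (gen_class Q P (\<alpha>, a, b)) = gen_class Q P (\<alpha>, a, d)"
proof -
  have ab: "is_path Q P (bar_obj Q \<alpha> a) [(\<alpha>, a, b)] (bar_obj Q \<alpha> b)"
    and bd: "is_path Q P (bar_obj Q \<alpha> b) [(\<alpha>, b, d)] (bar_obj Q \<alpha> d)"
    and ad: "is_path Q P (bar_obj Q \<alpha> a) [(\<alpha>, a, d)] (bar_obj Q \<alpha> d)"
    using assms bar_order_trans[OF assms] by (simp_all add: gens_def is_path_gen)
  have "path_rel Q P (bar_obj Q \<alpha> a, [(\<alpha>, a, b)] @ [(\<alpha>, b, d)], bar_obj Q \<alpha> d)
      (bar_obj Q \<alpha> a, [(\<alpha>, a, d)], bar_obj Q \<alpha> d)"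
    using is_path_append[OF ab bd] ad elem_rel.comp[of "[]" \<alpha> a b d "[]"]
    by (intro path_rel.intros) auto
  then show ?thesis
    unfolding gen_class_def prod.case thread_cat_Cmp[OF ab bd]
    by (intro path_class_eqI r_into_equivclp)
qed

text \<open>By the presentation of \<open>C\<close> such a family amounts to a functor:
  \<open>thread_rep\<close> and \<open>act\<close> are the two directions. No condition relates
  different arcs, which is why cocycles can later be extended one thread at a time.\<close>

definition thread_action :: "(('v, 'a, 'p) tobj \<Rightarrow> ('k, 'm) module) \<Rightarrow> (('a, 'p) gen \<Rightarrow> 'm \<Rightarrow> 'm) \<Rightarrow> bool" where
  "thread_action S t \<longleftrightarrow>
    (\<forall>(\<alpha>, a, b)\<in>gens Q P. t (\<alpha>, a, b) \<in> module_hom K (S (bar_obj Q \<alpha> a)) (S (bar_obj Q \<alpha> b))) \<and>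
    (\<forall>\<alpha>\<in>arcs Q. \<forall>a\<in>bar_carrier (P \<alpha>). \<forall>v\<in>carrier (S (bar_obj Q \<alpha> a)). t (\<alpha>, a, a) v = v) \<and>
    (\<forall>\<alpha> a b d. (\<alpha>, a, b) \<in> gens Q P \<longrightarrow> (\<alpha>, b, d) \<in> gens Q P \<longrightarrow>
      (\<forall>v\<in>carrier (S (bar_obj Q \<alpha> a)). t (\<alpha>, b, d) (t (\<alpha>, a, b) v) = t (\<alpha>, a, d) v))"

lemma thread_actionD:
  assumes "thread_action S t"
  shows "(\<alpha>, a, b) \<in> gens Q P \<Longrightarrow> t (\<alpha>, a, b) \<in> module_hom K (S (bar_obj Q \<alpha> a)) (S (bar_obj Q \<alpha> b))"
    "\<alpha> \<in> arcs Q \<Longrightarrow> a \<in> bar_carrier (P \<alpha>) \<Longrightarrow> v \<in> carrier (S (bar_obj Q \<alpha> a)) \<Longrightarrow> t (\<alpha>, a, a) v = v"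
    "(\<alpha>, a, b) \<in> gens Q P \<Longrightarrow> (\<alpha>, b, d) \<in> gens Q P \<Longrightarrow> v \<in> carrier (S (bar_obj Q \<alpha> a)) \<Longrightarrow>
      t (\<alpha>, b, d) (t (\<alpha>, a, b) v) = t (\<alpha>, a, d) v"
  using assms unfolding thread_action_def by blast+

lemma fold_action_hom:
  assumes "thread_action S t" "is_path Q P x us y"
  shows "fold t us \<in> module_hom K (S x) (S y)"
  using assms(2)
proof (induction rule: is_path.induct)
  case (Nil x)
  show ?case using module_hom_ident by (simp add: id_def)
next
  case (Cons \<alpha> a b gs z)
  then have "t (\<alpha>, a, b) \<in> module_hom K (S (bar_obj Q \<alpha> a)) (S (bar_obj Q \<alpha> b))"
    by (intro thread_actionD[OF assms(1)]) (simp add: gens_def)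
  from module_hom_compose[OF this Cons.IH] show ?case by (simp add: comp_def)
qed

text \<open>An elementary relation alters one place of the path. The prefix carries \<open>v\<close>
  into the space at the object where that place begins, and there the identity or composition law of
  the action applies.\<close>

lemma fold_action_path_rel:
  assumes "thread_action S t" "path_rel Q P (x, us, y) (x, vs, y)" "v \<in> carrier (S x)"
  shows "fold t us v = fold t vs v"
proof -
  from assms(2) have paths: "is_path Q P x us y" "is_path Q P x vs y" and e: "elem_rel us vs"
    by (auto elim: path_rel.cases)
  have mem: "\<exists>z. is_path Q P z ws' y \<and> fold t ws v \<in> carrier (S z)" if "us = ws @ ws'" for ws ws'
    using is_path_append_split[of Q P x ws ws' y] paths(1) that thread_quiver
      module_hom_carrier[OF fold_action_hom[OF assms(1)] assms(3)] by blast
  from e show ?thesis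
  proof cases
    case (ident ws \<alpha> a ws')
    then obtain z where z: "is_path Q P z ((\<alpha>, a, a) # ws') y" "fold t ws v \<in> carrier (S z)"
      using mem[of ws "(\<alpha>, a, a) # ws'"] by auto
    then have "z = bar_obj Q \<alpha> a" "(\<alpha>, a, a) \<in> gens Q P"
      by (auto elim: is_path.cases simp: gens_def)
    then show ?thesis using z(2) gens_ends thread_actionD(2)[OF assms(1)] ident by auto
  next
    case (comp ws \<alpha> a b d ws')
    then obtain z where z: "is_path Q P z ((\<alpha>, a, b) # (\<alpha>, b, d) # ws') y" "fold t ws v \<in> carrier (S z)"
      using mem[of ws "(\<alpha>, a, b) # (\<alpha>, b, d) # ws'"] by auto
    from z(1) have "z = bar_obj Q \<alpha> a" "(\<alpha>, a, b) \<in> gens Q P" "(\<alpha>, b, d) \<in> gens Q P"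
      by (auto elim!: is_path.cases[of Q P z "_ # _"] is_path.cases[of Q P _ "(\<alpha>, b, d) # _"] simp: gens_def)
    then show ?thesis using z(2) thread_actionD(3)[OF assms(1)] comp by auto
  qed
qed

lemma fold_action_class:
  assumes "thread_action S t" "(x', us', y') \<in> path_class Q P (x, us, y)" "v \<in> carrier (S x)"
  shows "x' = x \<and> fold t us' v = fold t us v"
proof -
  \<comment> \<open>The end points are carried through the induction, because
    \<open>fold_action_path_rel\<close> compares paths with common ends; steps in either direction
    preserve the equation.\<close>
  have "equivclp (path_rel Q P) (x, us, y) q \<Longrightarrow> fst q = x \<and> snd (snd q) = y \<and> fold t (fst (snd q)) v = fold t us v" for q
  proof (induction rule: equivclp_induct)
    case (step q r)
    from step(2) obtain us vs where eq: "fst q = x" "snd (snd q) = y" "fst (snd q) = us"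
      "fst r = x" "snd (snd r) = y" "fst (snd r) = vs"
      and "path_rel Q P (x, us, y) (x, vs, y) \<or> path_rel Q P (x, vs, y) (x, us, y)"
      using step(3) by (elim disjE path_rel.cases) (auto intro: path_rel.intros)
    then have "fold t us v = fold t vs v"
      using fold_action_path_rel[OF assms(1) _ assms(3)] by metis
    then show ?case using step(3) eq by simp
  qed auto
  from this[of "(x', us', y')"] show ?thesis using assms(2) by (simp add: path_class_def)
qed

text \<open>A morphism of \<open>C\<close> is a class of paths, and the choice operator takes the
  generator list of any member. For a thread action the choice does not matter on carriers, by
  \<open>fold_action_class\<close>.\<close>

definition thread_rep :: "(('v, 'a, 'p) tobj \<Rightarrow> ('k, 'm) module) \<Rightarrow> (('a, 'p) gen \<Rightarrow> 'm \<Rightarrow> 'm) \<Rightarrow>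
    (('v, 'a, 'p) tobj, ('v, 'a, 'p) tpath set, 'k, 'm) rep" where
  "thread_rep S t = \<lparr>Sp = S, Ar = (\<lambda>f. fold t (SOME us. \<exists>x y. (x, us, y) \<in> f))\<rparr>"

lemma Sp_thread_rep [simp]: "Sp (thread_rep S t) = S"
  by (simp add: thread_rep_def)

lemma Ar_thread_rep:
  assumes "thread_action S t" "v \<in> carrier (S x)"
  shows "Ar (thread_rep S t) (path_class Q P (x, us, y)) v = fold t us v"
proof -
  let ?P = "\<lambda>us'. \<exists>x' y'. (x', us', y') \<in> path_class Q P (x, us, y)"
  have "(x, us, y) \<in> path_class Q P (x, us, y)" by (simp add: path_class_def)
  then have "?P us" by blast
  then have "?P (SOME us'. ?P us')" by (rule someI)
  then show ?thesis
    using fold_action_class[OF assms(1) _ assms(2)] by (auto simp: thread_rep_def)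
qed

lemma is_pwf_rep_thread_rep:
  assumes "thread_action S t"
    and "\<And>x. x \<in> tc_objects Q P \<Longrightarrow> vectorspace K (S x)"
    and "\<And>x. x \<in> tc_objects Q P \<Longrightarrow> vectorspace.fin_dim K (S x)"
  shows "is_pwf_rep C K (thread_rep S t)"
proof -
  \<comment> \<open>\<open>Ar\<close> is known to agree with \<open>fold t us\<close> on the carrier
    only, so linearity is transferred using closure of the carrier under the operations.\<close>
  have "Ar (thread_rep S t) (path_class Q P (x, us, y)) \<in> module_hom K (S x) (S y)"
    if "is_path Q P x us y" for x us y
    using fold_action_hom[OF assms(1) that] Ar_thread_rep[OF assms(1)] assms(2)[of x]
      is_path_ends[OF thread_quiver that]
    by (auto simp: module_hom_def vectorspace_def abelian_monoid.a_closed module.smult_closed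
        Module.module_def abelian_group_def)
  moreover have "Ar (thread_rep S t) (Cmp C g f) v = Ar (thread_rep S t) g (Ar (thread_rep S t) f v)"
    if "f \<in> Hom C x y" "g \<in> Hom C y z" "v \<in> carrier (S x)" for x y z f g v
    using that fold_action_hom[OF assms(1), THEN module_hom_carrier]
    by (auto simp: Hom_C thread_cat_Cmp Ar_thread_rep[OF assms(1)])
  ultimately show ?thesis
    using assms(2,3) unfolding is_pwf_rep_def is_rep_def
    by (auto simp: Hom_C Ident_C Ar_thread_rep[OF assms(1)])
qed

definition act :: "(('v, 'a, 'p) tobj, ('v, 'a, 'p) tpath set, 'k, 'm) rep \<Rightarrow> ('a, 'p) gen \<Rightarrow> 'm \<Rightarrow> 'm" where
  "act M g = Ar M (gen_class Q P g)"

lemma act_thread_rep: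
  assumes "thread_action S t" "(\<alpha>, a, b) \<in> gens Q P" "v \<in> carrier (S (bar_obj Q \<alpha> a))"
  shows "act (thread_rep S t) (\<alpha>, a, b) v = t (\<alpha>, a, b) v"
  using Ar_thread_rep[OF assms(1,3)] by (simp add: act_def gen_class_def)

lemma thread_action_act:
  assumes "is_rep C K M"
  shows "thread_action (Sp M) (act M)"
  unfolding thread_action_def
proof (intro conjI ballI allI impI, safe)
  fix \<alpha> a b assume "(\<alpha>, a, b) \<in> gens Q P"
  then show "act M (\<alpha>, a, b) \<in> module_hom K (Sp M (bar_obj Q \<alpha> a)) (Sp M (bar_obj Q \<alpha> b))"
    using assms gen_class_Hom[of \<alpha> a b] gens_ends[of \<alpha> a b] by (auto simp: act_def is_rep_def)
next
  fix \<alpha> a v assume "\<alpha> \<in> arcs Q" "a \<in> bar_carrier (P \<alpha>)" "v \<in> carrier (Sp M (bar_obj Q \<alpha> a))"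
  then show "act M (\<alpha>, a, a) v = v"
    using assms gen_class_refl bar_order_linear(1)[of \<alpha> a a] bar_obj_in_objects
    by (auto simp: act_def is_rep_def)
next
  fix \<alpha> a b d v
  assume *: "(\<alpha>, a, b) \<in> gens Q P" "(\<alpha>, b, d) \<in> gens Q P" "v \<in> carrier (Sp M (bar_obj Q \<alpha> a))"
  have "Ar M (Cmp C (gen_class Q P (\<alpha>, b, d)) (gen_class Q P (\<alpha>, a, b))) v = act M (\<alpha>, b, d) (act M (\<alpha>, a, b) v)"
    using assms gen_class_Hom[OF *(1)] gen_class_Hom[OF *(2)] gens_ends[OF *(1)] gens_ends[OF *(2)] *(3)
    unfolding is_rep_def act_def Ob_C by blast
  then show "act M (\<alpha>, b, d) (act M (\<alpha>, a, b) v) = act M (\<alpha>, a, d) v"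
    using gens_ends[OF *(1)] gens_ends[OF *(2)] gen_class_comp[of \<alpha> a b d] by (simp add: act_def)
qed

text \<open>Functoriality splits off the first generator of a path; thus \<open>act\<close> retains
  all information about \<open>M\<close>.\<close>

lemma Ar_eq_fold_act:
  assumes "is_rep C K M" "is_path Q P x us y" "v \<in> carrier (Sp M x)"
  shows "Ar M (path_class Q P (x, us, y)) v = fold (act M) us v"
  using assms(2,3)
proof (induction arbitrary: v rule: is_path.induct)
  case (Nil x)
  then show ?case using assms(1) by (auto simp: is_rep_def simp flip: Ident_C)
next
  case (Cons \<alpha> a b gs z)
  have g: "(\<alpha>, a, b) \<in> gens Q P" using Cons by (simp add: gens_def)
  have mem: "act M (\<alpha>, a, b) v \<in> carrier (Sp M (bar_obj Q \<alpha> b))"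
    using thread_actionD(1)[OF thread_action_act[OF assms(1)] g] Cons.prems by (rule module_hom_carrier)
  have "path_class Q P (bar_obj Q \<alpha> a, (\<alpha>, a, b) # gs, z) =
    Cmp C (path_class Q P (bar_obj Q \<alpha> b, gs, z)) (gen_class Q P (\<alpha>, a, b))"
    using thread_cat_Cmp[OF is_path_gen[OF g] Cons.hyps(3)] by (simp add: gen_class_def)
  moreover have "path_class Q P (bar_obj Q \<alpha> b, gs, z) \<in> Hom C (bar_obj Q \<alpha> b) z"
    using Cons.hyps(3) by (auto simp: Hom_C)
  ultimately have "Ar M (path_class Q P (bar_obj Q \<alpha> a, (\<alpha>, a, b) # gs, z)) v =
    Ar M (path_class Q P (bar_obj Q \<alpha> b, gs, z)) (act M (\<alpha>, a, b) v)"
    using assms(1) gen_class_Hom[OF g] gens_ends[OF g] is_path_ends[OF thread_quiver Cons.hyps(3)] Cons.prems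
    unfolding is_rep_def act_def Ob_C by metis
  then show ?case using Cons.IH[OF mem] by simp
qed

text \<open>Naturality squares of consecutive generators paste along a path, so generators
  suffice.\<close>

lemma rep_homI:
  assumes M: "is_rep C K M" and N: "is_rep C K N"
    and hom: "\<And>x. x \<in> tc_objects Q P \<Longrightarrow> \<phi> x \<in> module_hom K (Sp M x) (Sp N x)"
    and comm: "\<And>\<alpha> a b v. (\<alpha>, a, b) \<in> gens Q P \<Longrightarrow> v \<in> carrier (Sp M (bar_obj Q \<alpha> a)) \<Longrightarrow>
      \<phi> (bar_obj Q \<alpha> b) (act M (\<alpha>, a, b) v) = act N (\<alpha>, a, b) (\<phi> (bar_obj Q \<alpha> a) v)"
  shows "\<phi> \<in> rep_hom C K M N"
proof -
  have "\<phi> y (fold (act M) us v) = fold (act N) us (\<phi> x v)"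
    if "is_path Q P x us y" "v \<in> carrier (Sp M x)" for x us y v
    using that
  proof (induction arbitrary: v rule: is_path.induct)
    case (Cons \<alpha> a b gs z)
    have g: "(\<alpha>, a, b) \<in> gens Q P" using Cons by (simp add: gens_def)
    have "act M (\<alpha>, a, b) v \<in> carrier (Sp M (bar_obj Q \<alpha> b))"
      using thread_actionD(1)[OF thread_action_act[OF M] g] Cons.prems by (rule module_hom_carrier)
    then show ?case using Cons.IH comm[OF g Cons.prems] by simp
  qed auto
  then show ?thesis
    unfolding rep_hom_def using hom module_hom_carrier[OF hom]
    by (auto simp: Hom_C Ar_eq_fold_act[OF M] Ar_eq_fold_act[OF N])
qed

lemma rep_hom_act:
  assumes "\<phi> \<in> rep_hom C K M N" "(\<alpha>, a, b) \<in> gens Q P" "v \<in> carrier (Sp M (bar_obj Q \<alpha> a))"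
  shows "\<phi> (bar_obj Q \<alpha> b) (act M (\<alpha>, a, b) v) = act N (\<alpha>, a, b) (\<phi> (bar_obj Q \<alpha> a) v)"
  using assms gen_class_Hom[OF assms(2)] gens_ends[OF assms(2)]
  unfolding rep_hom_def act_def Ob_C by blast

end

section \<open>Extensions of representations\<close>

lemma biproductD:
  assumes "biproduct K V1 V2 W i1 i2 p1 p2"
  shows "vectorspace K W" "vectorspace.fin_dim K W" "i1 \<in> module_hom K V1 W" "i2 \<in> module_hom K V2 W"
    "p1 \<in> module_hom K W V1" "p2 \<in> module_hom K W V2"
    "v \<in> carrier V1 \<Longrightarrow> p1 (i1 v) = v" "v \<in> carrier V1 \<Longrightarrow> p2 (i1 v) = \<zero>\<^bsub>V2\<^esub>"
    "u \<in> carrier V2 \<Longrightarrow> p1 (i2 u) = \<zero>\<^bsub>V1\<^esub>" "u \<in> carrier V2 \<Longrightarrow> p2 (i2 u) = u"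
    "w \<in> carrier W \<Longrightarrow> i1 (p1 w) \<oplus>\<^bsub>W\<^esub> i2 (p2 w) = w"
  using assms unfolding biproduct_def by auto

lemma biproduct_pair:
  assumes bi: "biproduct K V1 V2 W i1 i2 p1 p2" and V: "module K V1" "module K V2"
    and v: "v \<in> carrier V1" "u \<in> carrier V2"
  shows "i1 v \<oplus>\<^bsub>W\<^esub> i2 u \<in> carrier W" "p1 (i1 v \<oplus>\<^bsub>W\<^esub> i2 u) = v" "p2 (i1 v \<oplus>\<^bsub>W\<^esub> i2 u) = u"
proof -
  interpret V1: module K V1 by fact
  interpret V2: module K V2 by fact
  interpret W: vectorspace K W by (rule biproductD[OF bi])
  note b = biproductD[OF bi]
  have i: "i1 v \<in> carrier W" "i2 u \<in> carrier W"
    using module_hom_carrier[OF b(3)] module_hom_carrier[OF b(4)] v by auto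
  then show "i1 v \<oplus>\<^bsub>W\<^esub> i2 u \<in> carrier W" by simp
  show "p1 (i1 v \<oplus>\<^bsub>W\<^esub> i2 u) = v" "p2 (i1 v \<oplus>\<^bsub>W\<^esub> i2 u) = u"
    using i v by (simp_all add: module_hom_add[OF b(5)] module_hom_add[OF b(6)] b)
qed

text \<open>A vector is recovered from its two projections; equations in biproducts are checked
  componentwise below.\<close>

lemma biproduct_ext:
  assumes "biproduct K V1 V2 W i1 i2 p1 p2"
    and "w \<in> carrier W" "w' \<in> carrier W" "p1 w = p1 w'" "p2 w = p2 w'"
  shows "w = w'"
  using biproductD(11)[OF assms(1)] assms(2-) by metis

context thread_category
begin

lemma pwf_repD:
  assumes "is_pwf_rep C K M"
  shows "is_rep C K M" "thread_action (Sp M) (act M)"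
    "x \<in> tc_objects Q P \<Longrightarrow> vectorspace K (Sp M x)"
    "x \<in> tc_objects Q P \<Longrightarrow> vectorspace.fin_dim K (Sp M x)"
    "x \<in> tc_objects Q P \<Longrightarrow> module K (Sp M x)"
  using assms thread_action_act by (auto simp: is_pwf_rep_def is_rep_def vectorspace_def)

lemma act_hom:
  assumes "is_pwf_rep C K M" "(\<alpha>, a, b) \<in> gens Q P"
  shows "act M (\<alpha>, a, b) \<in> module_hom K (Sp M (bar_obj Q \<alpha> a)) (Sp M (bar_obj Q \<alpha> b))"
  using thread_actionD(1)[OF pwf_repD(2)[OF assms(1)] assms(2)] .

lemma act_comp:
  assumes "is_pwf_rep C K M" "(\<alpha>, a, b) \<in> gens Q P" "(\<alpha>, b, d) \<in> gens Q P"
    "v \<in> carrier (Sp M (bar_obj Q \<alpha> a))"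
  shows "act M (\<alpha>, b, d) (act M (\<alpha>, a, b) v) = act M (\<alpha>, a, d) v"
  using thread_actionD(3)[OF pwf_repD(2)[OF assms(1)] assms(2-)] .

text \<open>The upper right entries of an extension of \<open>M\<close> by \<open>N\<close> along
  one arc. The family \<open>c\<close> is indexed by elements of the extended thread, not by
  objects, so that the two ends of a loop stay distinct.\<close>

definition thread_cocycle :: "(('v, 'a, 'p) tobj, ('v, 'a, 'p) tpath set, 'k, 'm) rep \<Rightarrow>
    (('v, 'a, 'p) tobj, ('v, 'a, 'p) tpath set, 'k, 'm) rep \<Rightarrow> 'a \<Rightarrow>
    (('v, 'a, 'p) tobj \<Rightarrow> 'm set) \<Rightarrow> ('p bar \<Rightarrow> 'p bar \<Rightarrow> 'm \<Rightarrow> 'm) \<Rightarrow> bool" where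
  "thread_cocycle N M \<alpha> I c \<longleftrightarrow>
    (\<forall>a b. (\<alpha>, a, b) \<in> gens Q P \<longrightarrow> c a b \<in> module_hom K (Sp M (bar_obj Q \<alpha> a)) (Sp N (bar_obj Q \<alpha> b))) \<and>
    (\<forall>a b d u. (\<alpha>, a, b) \<in> gens Q P \<longrightarrow> (\<alpha>, b, d) \<in> gens Q P \<longrightarrow> u \<in> I (bar_obj Q \<alpha> a) \<longrightarrow>
      c a d u = act N (\<alpha>, b, d) (c a b u) \<oplus>\<^bsub>Sp N (bar_obj Q \<alpha> d)\<^esub> c b d (act M (\<alpha>, a, b) u))"

text \<open>Representations of \<open>C\<close> are pulled back along
  \<open>bar_obj Q \<alpha>\<close> to the extended thread. For a loop this map identifies the two
  ends, but the order is taken on the thread itself and remains antisymmetric.\<close>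

lemma linear_order_reps_thread:
  assumes M: "is_pwf_rep C K M" and N: "is_pwf_rep C K N" and \<alpha>: "\<alpha> \<in> arcs Q"
  shows "linear_order_reps K (bar_carrier (P \<alpha>)) (\<lambda>a b. (a, b) \<in> bar_order (P \<alpha>))
    (\<lambda>a. Sp M (bar_obj Q \<alpha> a)) (\<lambda>a. Sp N (bar_obj Q \<alpha> a))
    (\<lambda>a b. act M (\<alpha>, a, b)) (\<lambda>a b. act N (\<alpha>, a, b))"
proof (rule linear_order_reps.intro)
  have g: "(\<alpha>, a, b) \<in> gens Q P" if "(a, b) \<in> bar_order (P \<alpha>)" for a b
    using \<alpha> that by (simp add: gens_def)
  note o = bar_obj_in_objects[OF \<alpha>]
  show "field K" by (rule field_K)
  fix a b d assume a: "a \<in> bar_carrier (P \<alpha>)"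
  note M' = pwf_repD[OF M] and N' = pwf_repD[OF N]
  show "(a, a) \<in> bar_order (P \<alpha>)" using bar_order_linear(1)[OF \<alpha> a a] .
  show "module K (Sp M (bar_obj Q \<alpha> a))" by (rule M'(5)[OF o[OF a]])
  show "vectorspace K (Sp N (bar_obj Q \<alpha> a))" by (rule N'(3)[OF o[OF a]])
  show "vectorspace.fin_dim K (Sp N (bar_obj Q \<alpha> a))" by (rule N'(4)[OF o[OF a]])
  show "act M (\<alpha>, a, a) v = v" if "v \<in> carrier (Sp M (bar_obj Q \<alpha> a))" for v
    using thread_actionD(2)[OF M'(2) \<alpha> a that] .
  show "act N (\<alpha>, a, a) v = v" if "v \<in> carrier (Sp N (bar_obj Q \<alpha> a))" for v
    using thread_actionD(2)[OF N'(2) \<alpha> a that] .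
  assume b: "b \<in> bar_carrier (P \<alpha>)"
  show "(a, b) \<in> bar_order (P \<alpha>) \<or> (b, a) \<in> bar_order (P \<alpha>)"
    using bar_order_linear(2)[OF \<alpha> a b] .
  show "a = b" if "(a, b) \<in> bar_order (P \<alpha>)" "(b, a) \<in> bar_order (P \<alpha>)"
    using bar_order_linear(3)[OF \<alpha> a b that] .
  show "act M (\<alpha>, a, b) \<in> module_hom K (Sp M (bar_obj Q \<alpha> a)) (Sp M (bar_obj Q \<alpha> b))"
    if "(a, b) \<in> bar_order (P \<alpha>)" using act_hom[OF M g[OF that]] .
  show "act N (\<alpha>, a, b) \<in> module_hom K (Sp N (bar_obj Q \<alpha> a)) (Sp N (bar_obj Q \<alpha> b))"
    if "(a, b) \<in> bar_order (P \<alpha>)" using act_hom[OF N g[OF that]] .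
  assume "d \<in> bar_carrier (P \<alpha>)"
  show "(a, d) \<in> bar_order (P \<alpha>)" if "(a, b) \<in> bar_order (P \<alpha>)" "(b, d) \<in> bar_order (P \<alpha>)"
    using bar_order_trans[OF \<alpha> that] .
  show "act M (\<alpha>, b, d) (act M (\<alpha>, a, b) v) = act M (\<alpha>, a, d) v"
    if "(a, b) \<in> bar_order (P \<alpha>)" "(b, d) \<in> bar_order (P \<alpha>)" "v \<in> carrier (Sp M (bar_obj Q \<alpha> a))" for v
    using act_comp[OF M g[OF that(1)] g[OF that(2)] that(3)] .
  show "act N (\<alpha>, b, d) (act N (\<alpha>, a, b) v) = act N (\<alpha>, a, d) v"
    if "(a, b) \<in> bar_order (P \<alpha>)" "(b, d) \<in> bar_order (P \<alpha>)" "v \<in> carrier (Sp N (bar_obj Q \<alpha> a))" for v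
    using act_comp[OF N g[OF that(1)] g[OF that(2)] that(3)] .
qed

lemma thread_cocycle_extension:
  assumes M: "is_pwf_rep C K M" and N: "is_pwf_rep C K N" and \<alpha>: "\<alpha> \<in> arcs Q"
    and I: "\<And>x. x \<in> tc_objects Q P \<Longrightarrow> I x \<subseteq> carrier (Sp M x)"
    and stable: "\<And>a b u. (\<alpha>, a, b) \<in> gens Q P \<Longrightarrow> u \<in> I (bar_obj Q \<alpha> a) \<Longrightarrow>
      act M (\<alpha>, a, b) u \<in> I (bar_obj Q \<alpha> b)"
    and c0: "thread_cocycle N M \<alpha> I c0"
  shows "\<exists>c. thread_cocycle N M \<alpha> (\<lambda>x. carrier (Sp M x)) c \<and>
    (\<forall>a b. \<forall>u\<in>I (bar_obj Q \<alpha> a). (\<alpha>, a, b) \<in> gens Q P \<longrightarrow> c a b u = c0 a b u)"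
proof -
  interpret L: linear_order_reps K "bar_carrier (P \<alpha>)" "\<lambda>a b. (a, b) \<in> bar_order (P \<alpha>)"
    "\<lambda>a. Sp M (bar_obj Q \<alpha> a)" "\<lambda>a. Sp N (bar_obj Q \<alpha> a)"
    "\<lambda>a b. act M (\<alpha>, a, b)" "\<lambda>a b. act N (\<alpha>, a, b)"
    by (rule linear_order_reps_thread[OF M N \<alpha>])
  have g: "(\<alpha>, a, b) \<in> gens Q P \<longleftrightarrow>
      a \<in> bar_carrier (P \<alpha>) \<and> b \<in> bar_carrier (P \<alpha>) \<and> (a, b) \<in> bar_order (P \<alpha>)" for a b
    using \<alpha> by (auto simp: gens_def bar_order_def)
  have "L.linear_family (bar_carrier (P \<alpha>)) c0"
    using c0 unfolding thread_cocycle_def L.linear_family_def g by blast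
  moreover have "L.cocycle (bar_carrier (P \<alpha>)) (\<lambda>a. I (bar_obj Q \<alpha> a)) c0"
    using c0 unfolding thread_cocycle_def L.cocycle_def g by blast
  ultimately have "\<exists>c. L.linear_family (bar_carrier (P \<alpha>)) c \<and>
      L.cocycle (bar_carrier (P \<alpha>)) (\<lambda>a. carrier (Sp M (bar_obj Q \<alpha> a))) c \<and>
      L.extends_c0 (\<lambda>a. I (bar_obj Q \<alpha> a)) c0 (bar_carrier (P \<alpha>)) c"
    using I bar_obj_in_objects[OF \<alpha>] stable by (intro L.cocycle_extension) (auto simp: g)
  then obtain c where c: "L.linear_family (bar_carrier (P \<alpha>)) c"
    "L.cocycle (bar_carrier (P \<alpha>)) (\<lambda>a. carrier (Sp M (bar_obj Q \<alpha> a))) c"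
    "L.extends_c0 (\<lambda>a. I (bar_obj Q \<alpha> a)) c0 (bar_carrier (P \<alpha>)) c" by blast
  have "thread_cocycle N M \<alpha> (\<lambda>x. carrier (Sp M x)) c"
    using c(1,2) unfolding thread_cocycle_def L.linear_family_def L.cocycle_def g by blast
  moreover have "\<forall>a b. \<forall>u\<in>I (bar_obj Q \<alpha> a). (\<alpha>, a, b) \<in> gens Q P \<longrightarrow> c a b u = c0 a b u"
    using c(3) I bar_obj_in_objects[OF \<alpha>] stable \<open>L.linear_family _ c0\<close> \<open>L.cocycle _ _ c0\<close>
    unfolding g by (subst (asm) L.extends_c0_def) (auto simp: g)
  ultimately show ?thesis by blast
qed

lemma thread_cocycle_refl:
  assumes M: "is_pwf_rep C K M" and N: "is_pwf_rep C K N" and \<alpha>: "\<alpha> \<in> arcs Q"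
    and c: "thread_cocycle N M \<alpha> (\<lambda>x. carrier (Sp M x)) c"
    and a: "a \<in> bar_carrier (P \<alpha>)" and u: "u \<in> carrier (Sp M (bar_obj Q \<alpha> a))"
  shows "c a a u = \<zero>\<^bsub>Sp N (bar_obj Q \<alpha> a)\<^esub>"
proof -
  interpret L: linear_order_reps K "bar_carrier (P \<alpha>)" "\<lambda>a b. (a, b) \<in> bar_order (P \<alpha>)"
    "\<lambda>a. Sp M (bar_obj Q \<alpha> a)" "\<lambda>a. Sp N (bar_obj Q \<alpha> a)"
    "\<lambda>a b. act M (\<alpha>, a, b)" "\<lambda>a b. act N (\<alpha>, a, b)"
    by (rule linear_order_reps_thread[OF M N \<alpha>])
  have g: "(\<alpha>, a, b) \<in> gens Q P \<longleftrightarrow>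
      a \<in> bar_carrier (P \<alpha>) \<and> b \<in> bar_carrier (P \<alpha>) \<and> (a, b) \<in> bar_order (P \<alpha>)" for a b
    using \<alpha> by (auto simp: gens_def bar_order_def)
  have "L.linear_family (bar_carrier (P \<alpha>)) c"
    "L.cocycle (bar_carrier (P \<alpha>)) (\<lambda>a. carrier (Sp M (bar_obj Q \<alpha> a))) c"
    using c unfolding thread_cocycle_def L.linear_family_def L.cocycle_def g by blast+
  then show ?thesis using L.cocycle_refl a u by blast
qed

text \<open>Cocycles on all threads assemble into one extension of \<open>M\<close> by
  \<open>N\<close>, split at every object: vertices shared by several threads impose no
  compatibility on the entries \<open>c\<close>. The action on \<open>E\<close> is stated through
  the projections, which determine it by \<open>biproduct_ext\<close>.\<close>

lemma extension_rep_exists: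
  fixes M N :: "(('v, 'a, 'p) tobj, ('v, 'a, 'p) tpath set, 'k, 'm) rep"
  assumes M: "is_pwf_rep C K M" and N: "is_pwf_rep C K N"
    and universe: "\<And>n :: nat. \<exists>V :: ('k, 'm) module.
      vectorspace K V \<and> vectorspace.fin_dim K V \<and> vectorspace.dim K V = n"
    and c: "\<And>\<alpha>. \<alpha> \<in> arcs Q \<Longrightarrow> thread_cocycle N M \<alpha> (\<lambda>x. carrier (Sp M x)) (c \<alpha>)"
  obtains E i1 i2 p1 p2 where "is_pwf_rep C K E"
    "\<And>x. x \<in> tc_objects Q P \<Longrightarrow> biproduct K (Sp N x) (Sp M x) (Sp E x) (i1 x) (i2 x) (p1 x) (p2 x)"
    "\<And>\<alpha> a b w. (\<alpha>, a, b) \<in> gens Q P \<Longrightarrow> w \<in> carrier (Sp E (bar_obj Q \<alpha> a)) \<Longrightarrow>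
      p1 (bar_obj Q \<alpha> b) (act E (\<alpha>, a, b) w) =
        act N (\<alpha>, a, b) (p1 (bar_obj Q \<alpha> a) w) \<oplus>\<^bsub>Sp N (bar_obj Q \<alpha> b)\<^esub> c \<alpha> a b (p2 (bar_obj Q \<alpha> a) w)"
    "\<And>\<alpha> a b w. (\<alpha>, a, b) \<in> gens Q P \<Longrightarrow> w \<in> carrier (Sp E (bar_obj Q \<alpha> a)) \<Longrightarrow>
      p2 (bar_obj Q \<alpha> b) (act E (\<alpha>, a, b) w) = act M (\<alpha>, a, b) (p2 (bar_obj Q \<alpha> a) w)"
proof -
  have "\<exists>W i1 i2 p1 p2. x \<in> tc_objects Q P \<longrightarrow> biproduct K (Sp N x) (Sp M x) W i1 i2 p1 p2" for x
    using biproduct_exists[OF pwf_repD(3,4)[OF N] pwf_repD(3,4)[OF M] universe] by blast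
  then obtain W i1 i2 p1 p2 where bi: "\<And>x. x \<in> tc_objects Q P \<Longrightarrow>
      biproduct K (Sp N x) (Sp M x) (W x) (i1 x) (i2 x) (p1 x) (p2 x)" by metis
  \<comment> \<open>The upper triangular matrix with diagonal \<open>act N\<close>,
    \<open>act M\<close> and upper right entry \<open>c\<close>.\<close>
  define t where "t = (\<lambda>(\<alpha>, a, b) w.
    i1 (bar_obj Q \<alpha> b) (act N (\<alpha>, a, b) (p1 (bar_obj Q \<alpha> a) w) \<oplus>\<^bsub>Sp N (bar_obj Q \<alpha> b)\<^esub> c \<alpha> a b (p2 (bar_obj Q \<alpha> a) w))
    \<oplus>\<^bsub>W (bar_obj Q \<alpha> b)\<^esub> i2 (bar_obj Q \<alpha> b) (act M (\<alpha>, a, b) (p2 (bar_obj Q \<alpha> a) w)))"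
  have c_hom: "c \<alpha> a b \<in> module_hom K (Sp M (bar_obj Q \<alpha> a)) (Sp N (bar_obj Q \<alpha> b))"
    if "(\<alpha>, a, b) \<in> gens Q P" for \<alpha> a b
    using c[OF gens_ends(1)[OF that]] that by (simp add: thread_cocycle_def)
  have t_hom: "t (\<alpha>, a, b) \<in> module_hom K (W (bar_obj Q \<alpha> a)) (W (bar_obj Q \<alpha> b))"
    and p1_t: "w \<in> carrier (W (bar_obj Q \<alpha> a)) \<Longrightarrow> p1 (bar_obj Q \<alpha> b) (t (\<alpha>, a, b) w) =
        act N (\<alpha>, a, b) (p1 (bar_obj Q \<alpha> a) w) \<oplus>\<^bsub>Sp N (bar_obj Q \<alpha> b)\<^esub> c \<alpha> a b (p2 (bar_obj Q \<alpha> a) w)"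
    and p2_t: "w \<in> carrier (W (bar_obj Q \<alpha> a)) \<Longrightarrow>
      p2 (bar_obj Q \<alpha> b) (t (\<alpha>, a, b) w) = act M (\<alpha>, a, b) (p2 (bar_obj Q \<alpha> a) w)"
    if g: "(\<alpha>, a, b) \<in> gens Q P" for \<alpha> a b w
  proof -
    note x = gens_ends(5)[OF g] and y = gens_ends(6)[OF g]
    note bx = biproductD[OF bi[OF x]] and by_ = biproductD[OF bi[OF y]]
    have Wy: "module K (W (bar_obj Q \<alpha> b))" using by_(1) by (simp add: vectorspace_def)
    have h1: "(\<lambda>w. act N (\<alpha>, a, b) (p1 (bar_obj Q \<alpha> a) w) \<oplus>\<^bsub>Sp N (bar_obj Q \<alpha> b)\<^esub> c \<alpha> a b (p2 (bar_obj Q \<alpha> a) w))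
      \<in> module_hom K (W (bar_obj Q \<alpha> a)) (Sp N (bar_obj Q \<alpha> b))"
      by (intro module_hom_plus pwf_repD(5)[OF N y] module_hom_compose[OF bx(5) act_hom[OF N g]]
          module_hom_compose[OF bx(6) c_hom[OF g]])
    have h2: "(\<lambda>w. act M (\<alpha>, a, b) (p2 (bar_obj Q \<alpha> a) w)) \<in> module_hom K (W (bar_obj Q \<alpha> a)) (Sp M (bar_obj Q \<alpha> b))"
      by (intro module_hom_compose[OF bx(6) act_hom[OF M g]])
    show "t (\<alpha>, a, b) \<in> module_hom K (W (bar_obj Q \<alpha> a)) (W (bar_obj Q \<alpha> b))"
      unfolding t_def prod.case
      by (intro module_hom_plus[OF Wy] module_hom_compose[OF h1 by_(3)] module_hom_compose[OF h2 by_(4)])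
    note pr = biproduct_pair[OF bi[OF y] pwf_repD(5)[OF N y] pwf_repD(5)[OF M y]
        module_hom_carrier[OF h1] module_hom_carrier[OF h2]]
    show "p1 (bar_obj Q \<alpha> b) (t (\<alpha>, a, b) w) =
        act N (\<alpha>, a, b) (p1 (bar_obj Q \<alpha> a) w) \<oplus>\<^bsub>Sp N (bar_obj Q \<alpha> b)\<^esub> c \<alpha> a b (p2 (bar_obj Q \<alpha> a) w)"
      "p2 (bar_obj Q \<alpha> b) (t (\<alpha>, a, b) w) = act M (\<alpha>, a, b) (p2 (bar_obj Q \<alpha> a) w)"
      if "w \<in> carrier (W (bar_obj Q \<alpha> a))"
      using pr(2,3)[OF that that] by (simp_all add: t_def)
  qed
  have action: "thread_action W t"
    unfolding thread_action_def
  proof (intro conjI ballI allI impI, safe)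
    fix \<alpha> a b assume "(\<alpha>, a, b) \<in> gens Q P"
    then show "t (\<alpha>, a, b) \<in> module_hom K (W (bar_obj Q \<alpha> a)) (W (bar_obj Q \<alpha> b))" by (rule t_hom)
  next
    fix \<alpha> a w assume \<alpha>: "\<alpha> \<in> arcs Q" and a: "a \<in> bar_carrier (P \<alpha>)" and w: "w \<in> carrier (W (bar_obj Q \<alpha> a))"
    have g: "(\<alpha>, a, a) \<in> gens Q P" using bar_order_linear(1)[OF \<alpha> a a] \<alpha> by (simp add: gens_def)
    note x = gens_ends(5)[OF g]
    interpret Nx: module K "Sp N (bar_obj Q \<alpha> a)" by (rule pwf_repD(5)[OF N x])
    have p: "p1 (bar_obj Q \<alpha> a) w \<in> carrier (Sp N (bar_obj Q \<alpha> a))"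
      "p2 (bar_obj Q \<alpha> a) w \<in> carrier (Sp M (bar_obj Q \<alpha> a))"
      using biproductD(5,6)[OF bi[OF x]] w by (auto intro: module_hom_carrier)
    have "p1 (bar_obj Q \<alpha> a) (t (\<alpha>, a, a) w) = p1 (bar_obj Q \<alpha> a) w"
      "p2 (bar_obj Q \<alpha> a) (t (\<alpha>, a, a) w) = p2 (bar_obj Q \<alpha> a) w"
      using p thread_cocycle_refl[OF M N \<alpha> c[OF \<alpha>] a p(2)]
        thread_actionD(2)[OF pwf_repD(2)[OF N] \<alpha> a p(1)] thread_actionD(2)[OF pwf_repD(2)[OF M] \<alpha> a p(2)]
      by (simp_all add: p1_t[OF g w] p2_t[OF g w])
    then show "t (\<alpha>, a, a) w = w"
      by (rule biproduct_ext[OF bi[OF x] module_hom_carrier[OF t_hom[OF g] w] w])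
  next
    fix \<alpha> a b d w
    assume ab: "(\<alpha>, a, b) \<in> gens Q P" and bd: "(\<alpha>, b, d) \<in> gens Q P" and w: "w \<in> carrier (W (bar_obj Q \<alpha> a))"
    have ad: "(\<alpha>, a, d) \<in> gens Q P"
      using bar_order_trans[OF gens_ends(1,2)[OF ab] gens_ends(2)[OF bd]] gens_ends(1)[OF ab] by (simp add: gens_def)
    note x = gens_ends(5)[OF ab] and y = gens_ends(6)[OF ab] and z = gens_ends(6)[OF bd]
    have p: "p1 (bar_obj Q \<alpha> a) w \<in> carrier (Sp N (bar_obj Q \<alpha> a))"
      "p2 (bar_obj Q \<alpha> a) w \<in> carrier (Sp M (bar_obj Q \<alpha> a))"
      using biproductD(5,6)[OF bi[OF x]] w by (auto intro: module_hom_carrier)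
    have tw: "t (\<alpha>, a, b) w \<in> carrier (W (bar_obj Q \<alpha> b))" by (rule module_hom_carrier[OF t_hom[OF ab] w])
    interpret Nz: module K "Sp N (bar_obj Q \<alpha> d)" by (rule pwf_repD(5)[OF N z])
    let ?n = "act N (\<alpha>, a, b) (p1 (bar_obj Q \<alpha> a) w)" and ?c = "c \<alpha> a b (p2 (bar_obj Q \<alpha> a) w)"
      and ?m = "act M (\<alpha>, a, b) (p2 (bar_obj Q \<alpha> a) w)"
    have mem: "?n \<in> carrier (Sp N (bar_obj Q \<alpha> b))" "?c \<in> carrier (Sp N (bar_obj Q \<alpha> b))"
      "?m \<in> carrier (Sp M (bar_obj Q \<alpha> b))"
      using module_hom_carrier[OF act_hom[OF N ab] p(1)] module_hom_carrier[OF c_hom[OF ab] p(2)]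
        module_hom_carrier[OF act_hom[OF M ab] p(2)] by auto
    \<comment> \<open>In the first component the composition law reduces to the cocycle identity; in
      the second it is the composition law of \<open>M\<close>.\<close>
    have "c \<alpha> a d (p2 (bar_obj Q \<alpha> a) w) = act N (\<alpha>, b, d) ?c \<oplus>\<^bsub>Sp N (bar_obj Q \<alpha> d)\<^esub> c \<alpha> b d ?m"
      using c[OF gens_ends(1)[OF ab]] ab bd p(2) unfolding thread_cocycle_def by blast
    moreover have "act N (\<alpha>, b, d) (?n \<oplus>\<^bsub>Sp N (bar_obj Q \<alpha> b)\<^esub> ?c) =
        act N (\<alpha>, a, d) (p1 (bar_obj Q \<alpha> a) w) \<oplus>\<^bsub>Sp N (bar_obj Q \<alpha> d)\<^esub> act N (\<alpha>, b, d) ?c"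
      using module_hom_add[OF act_hom[OF N bd] mem(1,2)] act_comp[OF N ab bd p(1)] by simp
    ultimately have "p1 (bar_obj Q \<alpha> d) (t (\<alpha>, b, d) (t (\<alpha>, a, b) w)) = p1 (bar_obj Q \<alpha> d) (t (\<alpha>, a, d) w)"
      using module_hom_carrier[OF act_hom[OF N bd] mem(2)] module_hom_carrier[OF c_hom[OF bd] mem(3)]
        module_hom_carrier[OF act_hom[OF N ad] p(1)]
      by (simp add: p1_t[OF ab w] p2_t[OF ab w] p1_t[OF bd tw] p1_t[OF ad w] Nz.a_assoc)
    moreover have "p2 (bar_obj Q \<alpha> d) (t (\<alpha>, b, d) (t (\<alpha>, a, b) w)) = p2 (bar_obj Q \<alpha> d) (t (\<alpha>, a, d) w)"
      by (simp add: p2_t[OF ab w] p2_t[OF bd tw] p2_t[OF ad w] act_comp[OF M ab bd p(2)])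
    ultimately show "t (\<alpha>, b, d) (t (\<alpha>, a, b) w) = t (\<alpha>, a, d) w"
      by (rule biproduct_ext[OF bi[OF z] module_hom_carrier[OF t_hom[OF bd] tw] module_hom_carrier[OF t_hom[OF ad] w]])
  qed
  show thesis
  proof (rule that[of "thread_rep W t" i1 i2 p1 p2])
    show "is_pwf_rep C K (thread_rep W t)"
      by (rule is_pwf_rep_thread_rep[OF action]) (fact biproductD(1)[OF bi], fact biproductD(2)[OF bi])
    show "biproduct K (Sp N x) (Sp M x) (Sp (thread_rep W t) x) (i1 x) (i2 x) (p1 x) (p2 x)"
      if "x \<in> tc_objects Q P" for x using bi[OF that] by simp
    fix \<alpha> a b w assume g: "(\<alpha>, a, b) \<in> gens Q P" and "w \<in> carrier (Sp (thread_rep W t) (bar_obj Q \<alpha> a))"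
    then have w: "w \<in> carrier (W (bar_obj Q \<alpha> a))" by simp
    show "p1 (bar_obj Q \<alpha> b) (act (thread_rep W t) (\<alpha>, a, b) w) =
        act N (\<alpha>, a, b) (p1 (bar_obj Q \<alpha> a) w) \<oplus>\<^bsub>Sp N (bar_obj Q \<alpha> b)\<^esub> c \<alpha> a b (p2 (bar_obj Q \<alpha> a) w)"
      "p2 (bar_obj Q \<alpha> b) (act (thread_rep W t) (\<alpha>, a, b) w) = act M (\<alpha>, a, b) (p2 (bar_obj Q \<alpha> a) w)"
      unfolding act_thread_rep[OF action g w] by (rule p1_t[OF g w], rule p2_t[OF g w])
  qed
qed

end

section \<open>Vanishing of Ext\<close>

text \<open>The linear algebra at one object. The map \<open>j\<close> has components
  \<open>\<kappa>\<close> and \<open>d1\<close> and is injective because \<open>\<kappa>\<close>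
  inverts \<open>d0\<close> on the kernel of \<open>d1\<close>. Its image is the preimage of
  \<open>im d1\<close> under \<open>q2\<close>, that is, the kernel of \<open>d2\<close> after
  \<open>q2\<close>.\<close>

lemma splice_exact:
  assumes mods: "module K Z" "module K A" "module K M" "module K T"
    and homs: "d0 \<in> module_hom K Z A" "d1 \<in> module_hom K A M" "d2 \<in> module_hom K M T"
    and exact: "d0 ` carrier Z = {v \<in> carrier A. d1 v = \<zero>\<^bsub>M\<^esub>}"
      "d1 ` carrier A = {v \<in> carrier M. d2 v = \<zero>\<^bsub>T\<^esub>}"
    and \<kappa>: "\<kappa> \<in> module_hom K A Z" "\<And>z. z \<in> carrier Z \<Longrightarrow> \<kappa> (d0 z) = z"
    and F: "biproduct K Z A F i1 i2 p1 p2" and E: "biproduct K Z M E j1 j2 q1 q2"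
  defines "j \<equiv> \<lambda>v. j1 (\<kappa> v) \<oplus>\<^bsub>E\<^esub> j2 (d1 v)"
  shows "inj_on i1 (carrier Z)"
    and "i1 ` carrier Z = {w \<in> carrier F. j (p2 w) = \<zero>\<^bsub>E\<^esub>}"
    and "(\<lambda>w. j (p2 w)) ` carrier F = {w \<in> carrier E. d2 (q2 w) = \<zero>\<^bsub>T\<^esub>}"
    and "(\<lambda>w. d2 (q2 w)) ` carrier E = d2 ` carrier M"
proof -
  interpret Z: module K Z by fact
  interpret A: module K A by fact
  interpret M: module K M by fact
  note F' = biproductD[OF F] and E' = biproductD[OF E]
  interpret F: vectorspace K F by (rule F'(1))
  interpret E: vectorspace K E by (rule E'(1))
  note d0c = module_hom_carrier[OF homs(1)] and d1c = module_hom_carrier[OF homs(2)]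
    and \<kappa>c = module_hom_carrier[OF \<kappa>(1)]
  have d1d0: "d1 (d0 z) = \<zero>\<^bsub>M\<^esub>" if "z \<in> carrier Z" for z using that exact(1) by blast
  have d0_zero: "d0 \<zero>\<^bsub>Z\<^esub> = \<zero>\<^bsub>A\<^esub>" by (rule module_hom_zero[OF mods(1,2) homs(1)])
  have j: "j v \<in> carrier E" "q1 (j v) = \<kappa> v" "q2 (j v) = d1 v" if "v \<in> carrier A" for v
    using biproduct_pair[OF E mods(1,3) \<kappa>c[OF that] d1c[OF that]] by (simp_all add: j_def)
  have q_zero: "q1 \<zero>\<^bsub>E\<^esub> = \<zero>\<^bsub>Z\<^esub>" "q2 \<zero>\<^bsub>E\<^esub> = \<zero>\<^bsub>M\<^esub>"
    using module_hom_zero[OF E.module_axioms] mods(1,3) E'(5,6) by auto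
  have j_zero: "j v = \<zero>\<^bsub>E\<^esub> \<longleftrightarrow> v = \<zero>\<^bsub>A\<^esub>" if v: "v \<in> carrier A" for v
  proof
    assume "j v = \<zero>\<^bsub>E\<^esub>"
    then have *: "\<kappa> v = \<zero>\<^bsub>Z\<^esub>" "d1 v = \<zero>\<^bsub>M\<^esub>" using j(2,3)[OF v] q_zero by simp_all
    then obtain z where "z \<in> carrier Z" "v = d0 z" using exact(1) v by auto
    then show "v = \<zero>\<^bsub>A\<^esub>" using * \<kappa>(2) d0_zero by auto
  next
    assume "v = \<zero>\<^bsub>A\<^esub>"
    then have "\<kappa> v = \<zero>\<^bsub>Z\<^esub>" "d1 v = \<zero>\<^bsub>M\<^esub>"
      using module_hom_zero[OF mods(2,1) \<kappa>(1)] module_hom_zero[OF mods(2,3) homs(2)] by simp_all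
    then show "j v = \<zero>\<^bsub>E\<^esub>"
      using j[OF v] q_zero by (auto intro: biproduct_ext[OF E])
  qed
  show "inj_on i1 (carrier Z)"
    using F'(7) by (metis inj_onI)
  show "i1 ` carrier Z = {w \<in> carrier F. j (p2 w) = \<zero>\<^bsub>E\<^esub>}"
  proof (intro equalityI subsetI)
    fix w assume "w \<in> i1 ` carrier Z"
    then show "w \<in> {w \<in> carrier F. j (p2 w) = \<zero>\<^bsub>E\<^esub>}"
      using F'(8) j_zero[of "\<zero>\<^bsub>A\<^esub>"] module_hom_carrier[OF F'(3)] by auto
  next
    fix w assume "w \<in> {w \<in> carrier F. j (p2 w) = \<zero>\<^bsub>E\<^esub>}"
    then have w: "w \<in> carrier F" and "p2 w = \<zero>\<^bsub>A\<^esub>"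
      using j_zero module_hom_carrier[OF F'(6)] by auto
    moreover have "i2 \<zero>\<^bsub>A\<^esub> = \<zero>\<^bsub>F\<^esub>" by (rule module_hom_zero[OF mods(2) F.module_axioms F'(4)])
    moreover have "p1 w \<in> carrier Z" "i1 (p1 w) \<in> carrier F"
      using w F'(3,5) by (auto intro: module_hom_carrier)
    ultimately have "w = i1 (p1 w)" using F'(11)[OF w] by simp
    then show "w \<in> i1 ` carrier Z" using \<open>p1 w \<in> carrier Z\<close> by blast
  qed
  show "(\<lambda>w. j (p2 w)) ` carrier F = {w \<in> carrier E. d2 (q2 w) = \<zero>\<^bsub>T\<^esub>}"
  proof (intro equalityI subsetI)
    fix e assume "e \<in> (\<lambda>w. j (p2 w)) ` carrier F"
    then obtain v where v: "v \<in> carrier A" "e = j v" using module_hom_carrier[OF F'(6)] by auto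
    then show "e \<in> {w \<in> carrier E. d2 (q2 w) = \<zero>\<^bsub>T\<^esub>}" using j exact(2) by auto
  next
    fix e assume "e \<in> {w \<in> carrier E. d2 (q2 w) = \<zero>\<^bsub>T\<^esub>}"
    then have e: "e \<in> carrier E" and "q2 e \<in> d1 ` carrier A"
      using exact(2) module_hom_carrier[OF E'(6)] by auto
    then obtain a where a: "a \<in> carrier A" "q2 e = d1 a" by auto
    have q1e: "q1 e \<in> carrier Z" using module_hom_carrier[OF E'(5) e] .
    \<comment> \<open>Adding \<open>d0 ?z\<close> to a preimage \<open>a\<close> of
      \<open>q2 e\<close> leaves \<open>d1\<close> unchanged and corrects \<open>\<kappa> a\<close>
      to \<open>q1 e\<close>.\<close>
    let ?z = "q1 e \<ominus>\<^bsub>Z\<^esub> \<kappa> a"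
    let ?v = "a \<oplus>\<^bsub>A\<^esub> d0 ?z"
    have z: "?z \<in> carrier Z" using q1e \<kappa>c[OF a(1)] by simp
    have v: "?v \<in> carrier A" using a(1) d0c[OF z] by simp
    have "\<kappa> ?v = \<kappa> a \<oplus>\<^bsub>Z\<^esub> ?z"
      using module_hom_add[OF \<kappa>(1) a(1) d0c[OF z]] \<kappa>(2)[OF z] by simp
    also have "\<dots> = q1 e"
      using q1e \<kappa>c[OF a(1)] by (simp add: Z.minus_eq Z.a_lcomm[of "\<kappa> a"] Z.r_neg)
    finally have "q1 (j ?v) = q1 e" using j(2)[OF v] by simp
    moreover have "q2 (j ?v) = q2 e"
      using j(3)[OF v] module_hom_add[OF homs(2) a(1) d0c[OF z]] d1d0[OF z] a d1c[OF a(1)] by simp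
    ultimately have "e = j ?v"
      using biproduct_ext[OF E e j(1)[OF v]] by simp
    also have "\<dots> = j (p2 (i2 ?v))" using F'(10)[OF v] by simp
    finally show "e \<in> (\<lambda>w. j (p2 w)) ` carrier F" using module_hom_carrier[OF F'(4) v] by blast
  qed
  have "q2 ` carrier E = carrier M"
  proof (intro equalityI subsetI)
    fix v assume v: "v \<in> carrier M"
    then show "v \<in> q2 ` carrier E" using E'(10)[OF v] module_hom_carrier[OF E'(4) v] by (metis imageI)
  qed (use module_hom_carrier[OF E'(6)] in auto)
  then show "(\<lambda>w. d2 (q2 w)) ` carrier E = d2 ` carrier M" by (metis image_image)
qed

context thread_category
begin

text \<open>The retraction \<open>\<kappa>\<close> is chosen object by object, and its failure to be
  natural is a cocycle describing the extension of \<open>im d1\<close> by \<open>Z\<close>. The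
  cocycle is then extended from \<open>im d1\<close> to \<open>M\<close> on every thread.\<close>

lemma connecting_cocycle:
  fixes Z A M :: "(('v, 'a, 'p) tobj, ('v, 'a, 'p) tpath set, 'k, 'm) rep"
  assumes Z: "is_pwf_rep C K Z" and A: "is_pwf_rep C K A" and M: "is_pwf_rep C K M"
    and d0: "d0 \<in> rep_hom C K Z A" and d1: "d1 \<in> rep_hom C K A M"
    and inj: "\<And>x. x \<in> tc_objects Q P \<Longrightarrow> inj_on (d0 x) (carrier (Sp Z x))"
    and exact: "\<And>x. x \<in> tc_objects Q P \<Longrightarrow>
      d0 x ` carrier (Sp Z x) = {v \<in> carrier (Sp A x). d1 x v = \<zero>\<^bsub>Sp M x\<^esub>}"
  obtains \<kappa> c where
    "\<And>x. x \<in> tc_objects Q P \<Longrightarrow> \<kappa> x \<in> module_hom K (Sp A x) (Sp Z x)"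
    "\<And>x z. x \<in> tc_objects Q P \<Longrightarrow> z \<in> carrier (Sp Z x) \<Longrightarrow> \<kappa> x (d0 x z) = z"
    "\<And>\<alpha>. \<alpha> \<in> arcs Q \<Longrightarrow> thread_cocycle Z M \<alpha> (\<lambda>x. carrier (Sp M x)) (c \<alpha>)"
    "\<And>\<alpha> a b v. (\<alpha>, a, b) \<in> gens Q P \<Longrightarrow> v \<in> carrier (Sp A (bar_obj Q \<alpha> a)) \<Longrightarrow>
      c \<alpha> a b (d1 (bar_obj Q \<alpha> a) v) =
        \<kappa> (bar_obj Q \<alpha> b) (act A (\<alpha>, a, b) v) \<ominus>\<^bsub>Sp Z (bar_obj Q \<alpha> b)\<^esub>
        act Z (\<alpha>, a, b) (\<kappa> (bar_obj Q \<alpha> a) v)"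
proof -
  have d0_hom: "d0 x \<in> module_hom K (Sp Z x) (Sp A x)" and d1_hom: "d1 x \<in> module_hom K (Sp A x) (Sp M x)"
    if "x \<in> tc_objects Q P" for x
    using d0 d1 that by (auto simp: rep_hom_def)
  have "\<exists>k. x \<in> tc_objects Q P \<longrightarrow> k \<in> module_hom K (Sp A x) (Sp Z x) \<and>
      (\<forall>z\<in>carrier (Sp Z x). k (d0 x z) = z)" for x
  proof (cases "x \<in> tc_objects Q P")
    case True
    obtain k where k: "k \<in> module_hom K (Sp A x) (Sp Z x)"
      "\<And>z. z \<in> carrier (Sp Z x) \<Longrightarrow> d0 x (k (d0 x z)) = d0 x z"
      by (rule generalized_inverse_exists[OF pwf_repD(3)[OF Z True] pwf_repD(3)[OF A True]
            pwf_repD(4)[OF A True] d0_hom[OF True]], rule that)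
    have "k (d0 x z) = z" if "z \<in> carrier (Sp Z x)" for z
      using k(2)[OF that] inj[OF True] that module_hom_carrier[OF k(1) module_hom_carrier[OF d0_hom[OF True] that]]
      by (simp add: inj_on_eq_iff)
    with k(1) show ?thesis by blast
  qed auto
  then obtain \<kappa> where \<kappa>: "\<And>x. x \<in> tc_objects Q P \<Longrightarrow> \<kappa> x \<in> module_hom K (Sp A x) (Sp Z x)"
    "\<And>x z. x \<in> tc_objects Q P \<Longrightarrow> z \<in> carrier (Sp Z x) \<Longrightarrow> \<kappa> x (d0 x z) = z" by metis
  have "\<exists>k. x \<in> tc_objects Q P \<longrightarrow> k \<in> module_hom K (Sp M x) (Sp A x) \<and>
      (\<forall>v\<in>carrier (Sp A x). d1 x (k (d1 x v)) = d1 x v)" for x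
  proof (cases "x \<in> tc_objects Q P")
    case True
    obtain k where "k \<in> module_hom K (Sp M x) (Sp A x)"
      "\<And>v. v \<in> carrier (Sp A x) \<Longrightarrow> d1 x (k (d1 x v)) = d1 x v"
      by (rule generalized_inverse_exists[OF pwf_repD(3)[OF A True] pwf_repD(3)[OF M True]
            pwf_repD(4)[OF M True] d1_hom[OF True]], rule that)
    then show ?thesis by blast
  qed auto
  then obtain s where s: "\<And>x. x \<in> tc_objects Q P \<Longrightarrow> s x \<in> module_hom K (Sp M x) (Sp A x)"
    "\<And>x v. x \<in> tc_objects Q P \<Longrightarrow> v \<in> carrier (Sp A x) \<Longrightarrow> d1 x (s x (d1 x v)) = d1 x v" by metis
  \<comment> \<open>The sign is the one for which the map with components \<open>\<kappa>\<close>
    and \<open>d1\<close> becomes a morphism into the extension built from \<open>c\<close>.\<close>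
  define D where "D \<alpha> a b v = \<kappa> (bar_obj Q \<alpha> b) (act A (\<alpha>, a, b) v) \<ominus>\<^bsub>Sp Z (bar_obj Q \<alpha> b)\<^esub>
        act Z (\<alpha>, a, b) (\<kappa> (bar_obj Q \<alpha> a) v)" for \<alpha> a b v
  have D_hom: "D \<alpha> a b \<in> module_hom K (Sp A (bar_obj Q \<alpha> a)) (Sp Z (bar_obj Q \<alpha> b))"
    if g: "(\<alpha>, a, b) \<in> gens Q P" for \<alpha> a b
    unfolding D_def using gens_ends(5,6)[OF g]
    by (intro module_hom_diff pwf_repD(5)[OF Z] module_hom_compose[OF act_hom[OF A g]]
        module_hom_compose[OF _ act_hom[OF Z g]] \<kappa>(1))
  \<comment> \<open>On the image of \<open>d0\<close> the retraction is inverse to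
    \<open>d0\<close>, which is natural.\<close>
  have D_d0: "D \<alpha> a b (d0 (bar_obj Q \<alpha> a) z) = \<zero>\<^bsub>Sp Z (bar_obj Q \<alpha> b)\<^esub>"
    if g: "(\<alpha>, a, b) \<in> gens Q P" and z: "z \<in> carrier (Sp Z (bar_obj Q \<alpha> a))" for \<alpha> a b z
  proof -
    note x = gens_ends(5)[OF g] and y = gens_ends(6)[OF g]
    interpret Zy: module K "Sp Z (bar_obj Q \<alpha> b)" by (rule pwf_repD(5)[OF Z y])
    have az: "act Z (\<alpha>, a, b) z \<in> carrier (Sp Z (bar_obj Q \<alpha> b))"
      by (rule module_hom_carrier[OF act_hom[OF Z g] z])
    show ?thesis
      using az by (simp add: D_def \<kappa>(2)[OF x z] \<kappa>(2)[OF y az] Zy.minus_eq Zy.r_neg flip: rep_hom_act[OF d0 g z])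
  qed
  \<comment> \<open>By exactness \<open>v\<close> and \<open>w\<close> differ by an element of the
    image of \<open>d0\<close>, so \<open>D\<close> depends on \<open>d1 v\<close> only.\<close>
  have D_eq: "D \<alpha> a b v = D \<alpha> a b w"
    if g: "(\<alpha>, a, b) \<in> gens Q P" and v: "v \<in> carrier (Sp A (bar_obj Q \<alpha> a))" "w \<in> carrier (Sp A (bar_obj Q \<alpha> a))"
      and eq: "d1 (bar_obj Q \<alpha> a) v = d1 (bar_obj Q \<alpha> a) w" for \<alpha> a b v w
  proof -
    note x = gens_ends(5)[OF g] and y = gens_ends(6)[OF g]
    interpret Zy: module K "Sp Z (bar_obj Q \<alpha> b)" by (rule pwf_repD(5)[OF Z y])
    interpret Ax: module K "Sp A (bar_obj Q \<alpha> a)" by (rule pwf_repD(5)[OF A x])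
    interpret Mx: module K "Sp M (bar_obj Q \<alpha> a)" by (rule pwf_repD(5)[OF M x])
    let ?u = "v \<ominus>\<^bsub>Sp A (bar_obj Q \<alpha> a)\<^esub> w"
    have "d1 (bar_obj Q \<alpha> a) ?u = \<zero>\<^bsub>Sp M (bar_obj Q \<alpha> a)\<^esub>"
      using module_hom_minus[OF Ax.module_axioms Mx.module_axioms d1_hom[OF x] v] eq
        module_hom_carrier[OF d1_hom[OF x] v(2)] by (simp add: Mx.minus_eq Mx.r_neg)
    moreover have "?u \<in> carrier (Sp A (bar_obj Q \<alpha> a))" using v by simp
    ultimately obtain z where "z \<in> carrier (Sp Z (bar_obj Q \<alpha> a))" "?u = d0 (bar_obj Q \<alpha> a) z"
      using exact[OF x] by blast
    then have "D \<alpha> a b v \<ominus>\<^bsub>Sp Z (bar_obj Q \<alpha> b)\<^esub> D \<alpha> a b w = \<zero>\<^bsub>Sp Z (bar_obj Q \<alpha> b)\<^esub>"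
      using D_d0[OF g] module_hom_minus[OF Ax.module_axioms Zy.module_axioms D_hom[OF g] v] by simp
    then show ?thesis
      using module_hom_carrier[OF D_hom[OF g]] v by (simp add: Zy.minus_eq_zero_iff)
  qed
  \<comment> \<open>\<open>D\<close> descends to \<open>im d1\<close>; the section \<open>s\<close>
    extends the descended map linearly to all of \<open>M\<close>, though the cocycle identity is
    claimed on the image \<open>I\<close> only.\<close>
  define c0 where "c0 \<alpha> a b u = D \<alpha> a b (s (bar_obj Q \<alpha> a) u)" for \<alpha> a b u
  have c0_d1: "c0 \<alpha> a b (d1 (bar_obj Q \<alpha> a) v) = D \<alpha> a b v"
    if g: "(\<alpha>, a, b) \<in> gens Q P" and v: "v \<in> carrier (Sp A (bar_obj Q \<alpha> a))" for \<alpha> a b v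
    unfolding c0_def
    by (rule D_eq[OF g module_hom_carrier[OF s(1)[OF gens_ends(5)[OF g]]
            module_hom_carrier[OF d1_hom[OF gens_ends(5)[OF g]] v]] v s(2)[OF gens_ends(5)[OF g] v]])
  define I where "I x = d1 x ` carrier (Sp A x)" for x
  have "thread_cocycle Z M \<alpha> I (c0 \<alpha>)" for \<alpha>
    unfolding thread_cocycle_def
  proof (intro conjI allI impI)
    fix a b assume g: "(\<alpha>, a, b) \<in> gens Q P"
    show "c0 \<alpha> a b \<in> module_hom K (Sp M (bar_obj Q \<alpha> a)) (Sp Z (bar_obj Q \<alpha> b))"
      unfolding c0_def by (rule module_hom_compose[OF s(1)[OF gens_ends(5)[OF g]] D_hom[OF g]])
  next
    fix a b d u assume ab: "(\<alpha>, a, b) \<in> gens Q P" and bd: "(\<alpha>, b, d) \<in> gens Q P" and "u \<in> I (bar_obj Q \<alpha> a)"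
    then obtain v where v: "v \<in> carrier (Sp A (bar_obj Q \<alpha> a))" "u = d1 (bar_obj Q \<alpha> a) v"
      by (auto simp: I_def)
    have ad: "(\<alpha>, a, d) \<in> gens Q P"
      using bar_order_trans[OF gens_ends(1,2)[OF ab] gens_ends(2)[OF bd]] gens_ends(1)[OF ab] by (simp add: gens_def)
    note x = gens_ends(5)[OF ab] and y = gens_ends(6)[OF ab] and z = gens_ends(6)[OF bd]
    interpret Zz: module K "Sp Z (bar_obj Q \<alpha> d)" by (rule pwf_repD(5)[OF Z z])
    have av: "act A (\<alpha>, a, b) v \<in> carrier (Sp A (bar_obj Q \<alpha> b))"
      by (rule module_hom_carrier[OF act_hom[OF A ab] v(1)])
    have k: "\<kappa> (bar_obj Q \<alpha> b) (act A (\<alpha>, a, b) v) \<in> carrier (Sp Z (bar_obj Q \<alpha> b))"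
      "\<kappa> (bar_obj Q \<alpha> a) v \<in> carrier (Sp Z (bar_obj Q \<alpha> a))"
      using module_hom_carrier[OF \<kappa>(1)[OF y] av] module_hom_carrier[OF \<kappa>(1)[OF x] v(1)] by auto
    have zk: "act Z (\<alpha>, a, b) (\<kappa> (bar_obj Q \<alpha> a) v) \<in> carrier (Sp Z (bar_obj Q \<alpha> b))"
      by (rule module_hom_carrier[OF act_hom[OF Z ab] k(2)])
    define p where "p = act Z (\<alpha>, b, d) (\<kappa> (bar_obj Q \<alpha> b) (act A (\<alpha>, a, b) v))"
    define q where "q = act Z (\<alpha>, a, d) (\<kappa> (bar_obj Q \<alpha> a) v)"
    define r where "r = \<kappa> (bar_obj Q \<alpha> d) (act A (\<alpha>, a, d) v)"
    have pqr: "p \<in> carrier (Sp Z (bar_obj Q \<alpha> d))" "q \<in> carrier (Sp Z (bar_obj Q \<alpha> d))"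
      "r \<in> carrier (Sp Z (bar_obj Q \<alpha> d))"
      using module_hom_carrier[OF act_hom[OF Z bd] k(1)] module_hom_carrier[OF act_hom[OF Z ad] k(2)]
        module_hom_carrier[OF \<kappa>(1)[OF z] module_hom_carrier[OF act_hom[OF A ad] v(1)]]
      by (auto simp: p_def q_def r_def)
    have "act Z (\<alpha>, b, d) (c0 \<alpha> a b u) = p \<ominus>\<^bsub>Sp Z (bar_obj Q \<alpha> d)\<^esub> q"
      using module_hom_minus[OF pwf_repD(5)[OF Z y] Zz.module_axioms act_hom[OF Z bd] k(1) zk]
      by (simp add: v(2) c0_d1[OF ab v(1)] D_def p_def q_def act_comp[OF Z ab bd k(2)])
    moreover have "c0 \<alpha> b d (act M (\<alpha>, a, b) u) = r \<ominus>\<^bsub>Sp Z (bar_obj Q \<alpha> d)\<^esub> p"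
      by (simp add: v(2) c0_d1[OF bd av] D_def p_def r_def act_comp[OF A ab bd v(1)] flip: rep_hom_act[OF d1 ab v(1)])
    moreover have "c0 \<alpha> a d u = r \<ominus>\<^bsub>Sp Z (bar_obj Q \<alpha> d)\<^esub> q"
      by (simp add: v(2) c0_d1[OF ad v(1)] D_def q_def r_def)
    \<comment> \<open>The identity telescopes: the mixed term \<open>p\<close>, which uses
      \<open>A\<close> up to \<open>b\<close> and \<open>Z\<close> from there on, cancels.\<close>
    moreover have "r \<ominus>\<^bsub>Sp Z (bar_obj Q \<alpha> d)\<^esub> q =
        (p \<ominus>\<^bsub>Sp Z (bar_obj Q \<alpha> d)\<^esub> q) \<oplus>\<^bsub>Sp Z (bar_obj Q \<alpha> d)\<^esub> (r \<ominus>\<^bsub>Sp Z (bar_obj Q \<alpha> d)\<^esub> p)"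
      using pqr by (simp add: Zz.minus_eq Zz.a_ac Zz.r_neg2)
    ultimately show "c0 \<alpha> a d u = act Z (\<alpha>, b, d) (c0 \<alpha> a b u) \<oplus>\<^bsub>Sp Z (bar_obj Q \<alpha> d)\<^esub>
        c0 \<alpha> b d (act M (\<alpha>, a, b) u)" by simp
  qed
  moreover have "I x \<subseteq> carrier (Sp M x)" if "x \<in> tc_objects Q P" for x
    using module_hom_carrier[OF d1_hom[OF that]] by (auto simp: I_def)
  moreover have "act M (\<alpha>, a, b) u \<in> I (bar_obj Q \<alpha> b)"
    if g: "(\<alpha>, a, b) \<in> gens Q P" and u: "u \<in> I (bar_obj Q \<alpha> a)" for \<alpha> a b u
  proof -
    obtain v where v: "v \<in> carrier (Sp A (bar_obj Q \<alpha> a))" "u = d1 (bar_obj Q \<alpha> a) v"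
      using u by (auto simp: I_def)
    then show ?thesis
      using rep_hom_act[OF d1 g v(1)] module_hom_carrier[OF act_hom[OF A g] v(1)]
      unfolding I_def by (metis imageI)
  qed
  ultimately have "\<exists>c. \<alpha> \<in> arcs Q \<longrightarrow> thread_cocycle Z M \<alpha> (\<lambda>x. carrier (Sp M x)) c \<and>
    (\<forall>a b. \<forall>u\<in>I (bar_obj Q \<alpha> a). (\<alpha>, a, b) \<in> gens Q P \<longrightarrow> c a b u = c0 \<alpha> a b u)" for \<alpha>
    using thread_cocycle_extension[OF M Z, of \<alpha> I "c0 \<alpha>"] by blast
  then obtain c where c: "\<And>\<alpha>. \<alpha> \<in> arcs Q \<Longrightarrow> thread_cocycle Z M \<alpha> (\<lambda>x. carrier (Sp M x)) (c \<alpha>)"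
    "\<And>\<alpha> a b u. \<alpha> \<in> arcs Q \<Longrightarrow> u \<in> I (bar_obj Q \<alpha> a) \<Longrightarrow> (\<alpha>, a, b) \<in> gens Q P \<Longrightarrow> c \<alpha> a b u = c0 \<alpha> a b u"
    by metis
  have "c \<alpha> a b (d1 (bar_obj Q \<alpha> a) v) = D \<alpha> a b v"
    if g: "(\<alpha>, a, b) \<in> gens Q P" and v: "v \<in> carrier (Sp A (bar_obj Q \<alpha> a))" for \<alpha> a b v
    using c(2)[OF gens_ends(1)[OF g] _ g, of "d1 (bar_obj Q \<alpha> a) v"] v c0_d1[OF g v] by (simp add: I_def)
  then show thesis
    by (intro that[OF \<kappa> c(1)]) (simp_all add: D_def)
qed

end

section \<open>Morphisms for comparing exact sequences\<close>

lemma rep_hom_compose: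
  assumes "\<phi> \<in> rep_hom C K L M" "\<psi> \<in> rep_hom C K M N"
  shows "(\<lambda>x v. \<psi> x (\<phi> x v)) \<in> rep_hom C K L N"
  unfolding rep_hom_def
proof (intro CollectI conjI ballI)
  fix x assume x: "x \<in> Ob C"
  have \<phi>: "\<phi> x \<in> module_hom K (Sp L x) (Sp M x)" and \<psi>: "\<psi> x \<in> module_hom K (Sp M x) (Sp N x)"
    using assms x by (simp_all add: rep_hom_def)
  show "(\<lambda>v. \<psi> x (\<phi> x v)) \<in> module_hom K (Sp L x) (Sp N x)"
    by (rule module_hom_compose[OF \<phi> \<psi>])
  fix y f v assume yfv: "y \<in> Ob C" "f \<in> Hom C x y" "v \<in> carrier (Sp L x)"
  have "\<phi> x v \<in> carrier (Sp M x)" by (rule module_hom_carrier[OF \<phi> yfv(3)])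
  then show "\<psi> y (\<phi> y (Ar L f v)) = Ar N f (\<psi> x (\<phi> x v))"
    using assms x yfv by (simp add: rep_hom_def)
qed

lemma rep_hom_ident: "(\<lambda>x v. v) \<in> rep_hom C K M M"
  by (simp add: rep_hom_def module_hom_ident)

context thread_category
begin

lemma rep_hom_module_hom:
  "\<phi> \<in> rep_hom C K M N \<Longrightarrow> x \<in> tc_objects Q P \<Longrightarrow> \<phi> x \<in> module_hom K (Sp M x) (Sp N x)"
  by (simp add: rep_hom_def)

lemma rep_hom_zero:
  assumes M: "is_pwf_rep C K M" and N: "is_pwf_rep C K N"
  shows "(\<lambda>x v. \<zero>\<^bsub>Sp N x\<^esub>) \<in> rep_hom C K M N"
proof (rule rep_homI[OF pwf_repD(1)[OF M] pwf_repD(1)[OF N]])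
  show "(\<lambda>v. \<zero>\<^bsub>Sp N x\<^esub>) \<in> module_hom K (Sp M x) (Sp N x)" if "x \<in> tc_objects Q P" for x
    by (rule module_hom_const_zero[OF pwf_repD(5)[OF N that]])
  show "\<zero>\<^bsub>Sp N (bar_obj Q \<alpha> b)\<^esub> = act N (\<alpha>, a, b) \<zero>\<^bsub>Sp N (bar_obj Q \<alpha> a)\<^esub>"
    if g: "(\<alpha>, a, b) \<in> gens Q P" for \<alpha> a b
    using module_hom_zero[OF _ _ act_hom[OF N g]] pwf_repD(5)[OF N] gens_ends(5,6)[OF g] by simp
qed

text \<open>Makes the direct sum a special case of \<open>extension_rep_exists\<close>.\<close>

lemma zero_thread_cocycle:
  assumes M: "is_pwf_rep C K M" and N: "is_pwf_rep C K N"
  shows "thread_cocycle N M \<alpha> I (\<lambda>a b u. \<zero>\<^bsub>Sp N (bar_obj Q \<alpha> b)\<^esub>)"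
  unfolding thread_cocycle_def
proof (intro conjI allI impI)
  fix a b assume g: "(\<alpha>, a, b) \<in> gens Q P"
  show "(\<lambda>u. \<zero>\<^bsub>Sp N (bar_obj Q \<alpha> b)\<^esub>) \<in> module_hom K (Sp M (bar_obj Q \<alpha> a)) (Sp N (bar_obj Q \<alpha> b))"
    by (rule module_hom_const_zero[OF pwf_repD(5)[OF N gens_ends(6)[OF g]]])
next
  fix a b d assume ab: "(\<alpha>, a, b) \<in> gens Q P" and bd: "(\<alpha>, b, d) \<in> gens Q P"
  interpret Nd: module K "Sp N (bar_obj Q \<alpha> d)" by (rule pwf_repD(5)[OF N gens_ends(6)[OF bd]])
  show "\<zero>\<^bsub>Sp N (bar_obj Q \<alpha> d)\<^esub> = act N (\<alpha>, b, d) \<zero>\<^bsub>Sp N (bar_obj Q \<alpha> b)\<^esub>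
      \<oplus>\<^bsub>Sp N (bar_obj Q \<alpha> d)\<^esub> \<zero>\<^bsub>Sp N (bar_obj Q \<alpha> d)\<^esub>"
    using module_hom_zero[OF pwf_repD(5)[OF N gens_ends(6)[OF ab]] Nd.module_axioms act_hom[OF N bd]] by simp
qed

text \<open>Only the two terms after \<open>Z\<close> are replaced, by \<open>F\<close>, the sum of
  \<open>Z\<close> and \<open>A\<close>, and by \<open>E\<close>. The new maps are
  \<open>i1\<close>, then \<open>j\<close> after \<open>p2\<close>, then \<open>d2\<close> after
  \<open>q2\<close>. A common source \<open>S\<close> of two morphisms suffices, since equivalence
  of sequences is generated by morphisms in both directions.\<close>

lemma splice_resolution:
  fixes X Z :: "(('v, 'a, 'p) tobj, ('v, 'a, 'p) tpath set, 'k, 'm) rep"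
  assumes pwf_X: "is_pwf_rep C K X" and pwf_Z: "is_pwf_rep C K Z" and n: "2 \<le> n"
    and universe: "\<And>n :: nat. \<exists>V :: ('k, 'm) module.
      vectorspace K V \<and> vectorspace.fin_dim K V \<and> vectorspace.dim K V = n"
    and seq: "(B, d) \<in> exact_seqs C K n X Z"
  shows "\<exists>S. seq_morphism C K n X Z S (B, d) \<and> seq_morphism C K n X Z S (trivial_seq n X Z)"
proof -
  let ?A = "B (Suc 0)" and ?M = "B (Suc (Suc 0))"
  let ?d0 = "d 0" and ?d1 = "d (Suc 0)" and ?d2 = "d (Suc (Suc 0))"
  have B0: "B 0 = Z" and Bn: "B (Suc n) = X"
    and pwf_B: "\<And>i. i \<le> Suc n \<Longrightarrow> is_pwf_rep C K (B i)"
    and d_hom: "\<And>i. i \<le> n \<Longrightarrow> d i \<in> rep_hom C K (B i) (B (Suc i))"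
    and inj: "\<And>x. x \<in> tc_objects Q P \<Longrightarrow> inj_on (d 0 x) (carrier (Sp Z x))"
    and exact: "\<And>x i. x \<in> tc_objects Q P \<Longrightarrow> i < n \<Longrightarrow> d i x ` carrier (Sp (B i) x) =
      {v \<in> carrier (Sp (B (Suc i)) x). d (Suc i) x v = \<zero>\<^bsub>Sp (B (Suc (Suc i))) x\<^esub>}"
    and surj: "\<And>x. x \<in> tc_objects Q P \<Longrightarrow> d n x ` carrier (Sp (B n) x) = carrier (Sp X x)"
    using seq by (auto simp: exact_seqs_def)
  have A: "is_pwf_rep C K ?A" and M: "is_pwf_rep C K ?M" and T: "is_pwf_rep C K (B (Suc (Suc (Suc 0))))"
    using pwf_B n by auto
  have d0: "?d0 \<in> rep_hom C K Z ?A" and d1: "?d1 \<in> rep_hom C K ?A ?M"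
    and d2: "?d2 \<in> rep_hom C K ?M (B (Suc (Suc (Suc 0))))"
    using d_hom[of 0] d_hom[of "Suc 0"] d_hom[of "Suc (Suc 0)"] n B0 by auto
  have exact0: "?d0 x ` carrier (Sp Z x) = {v \<in> carrier (Sp ?A x). ?d1 x v = \<zero>\<^bsub>Sp ?M x\<^esub>}"
    and exact1: "?d1 x ` carrier (Sp ?A x) =
      {v \<in> carrier (Sp ?M x). ?d2 x v = \<zero>\<^bsub>Sp (B (Suc (Suc (Suc 0)))) x\<^esub>}"
    if "x \<in> tc_objects Q P" for x
    using exact[OF that, of 0] exact[OF that, of "Suc 0"] n B0 by auto
  obtain \<kappa> c where \<kappa>: "\<And>x. x \<in> tc_objects Q P \<Longrightarrow> \<kappa> x \<in> module_hom K (Sp ?A x) (Sp Z x)"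
      "\<And>x z. x \<in> tc_objects Q P \<Longrightarrow> z \<in> carrier (Sp Z x) \<Longrightarrow> \<kappa> x (?d0 x z) = z"
    and c: "\<And>\<alpha>. \<alpha> \<in> arcs Q \<Longrightarrow> thread_cocycle Z ?M \<alpha> (\<lambda>x. carrier (Sp ?M x)) (c \<alpha>)"
    and c_d1: "\<And>\<alpha> a b v. (\<alpha>, a, b) \<in> gens Q P \<Longrightarrow> v \<in> carrier (Sp ?A (bar_obj Q \<alpha> a)) \<Longrightarrow>
      c \<alpha> a b (?d1 (bar_obj Q \<alpha> a) v) =
        \<kappa> (bar_obj Q \<alpha> b) (act ?A (\<alpha>, a, b) v) \<ominus>\<^bsub>Sp Z (bar_obj Q \<alpha> b)\<^esub>
        act Z (\<alpha>, a, b) (\<kappa> (bar_obj Q \<alpha> a) v)"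
    by (rule connecting_cocycle[OF pwf_Z A M d0 d1 inj exact0], assumption+, rule that)
  obtain E j1 j2 q1 q2 where E: "is_pwf_rep C K E"
    and biE: "\<And>x. x \<in> tc_objects Q P \<Longrightarrow> biproduct K (Sp Z x) (Sp ?M x) (Sp E x) (j1 x) (j2 x) (q1 x) (q2 x)"
    and q1_act: "\<And>\<alpha> a b w. (\<alpha>, a, b) \<in> gens Q P \<Longrightarrow> w \<in> carrier (Sp E (bar_obj Q \<alpha> a)) \<Longrightarrow>
      q1 (bar_obj Q \<alpha> b) (act E (\<alpha>, a, b) w) =
        act Z (\<alpha>, a, b) (q1 (bar_obj Q \<alpha> a) w) \<oplus>\<^bsub>Sp Z (bar_obj Q \<alpha> b)\<^esub> c \<alpha> a b (q2 (bar_obj Q \<alpha> a) w)"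
    and q2_act: "\<And>\<alpha> a b w. (\<alpha>, a, b) \<in> gens Q P \<Longrightarrow> w \<in> carrier (Sp E (bar_obj Q \<alpha> a)) \<Longrightarrow>
      q2 (bar_obj Q \<alpha> b) (act E (\<alpha>, a, b) w) = act ?M (\<alpha>, a, b) (q2 (bar_obj Q \<alpha> a) w)"
    by (rule extension_rep_exists[OF M pwf_Z universe c], assumption, rule that)
  obtain F i1 i2 p1 p2 where F: "is_pwf_rep C K F"
    and biF: "\<And>x. x \<in> tc_objects Q P \<Longrightarrow> biproduct K (Sp Z x) (Sp ?A x) (Sp F x) (i1 x) (i2 x) (p1 x) (p2 x)"
    and p1_act': "\<And>\<alpha> a b w. (\<alpha>, a, b) \<in> gens Q P \<Longrightarrow> w \<in> carrier (Sp F (bar_obj Q \<alpha> a)) \<Longrightarrow>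
      p1 (bar_obj Q \<alpha> b) (act F (\<alpha>, a, b) w) =
        act Z (\<alpha>, a, b) (p1 (bar_obj Q \<alpha> a) w) \<oplus>\<^bsub>Sp Z (bar_obj Q \<alpha> b)\<^esub> \<zero>\<^bsub>Sp Z (bar_obj Q \<alpha> b)\<^esub>"
    and p2_act: "\<And>\<alpha> a b w. (\<alpha>, a, b) \<in> gens Q P \<Longrightarrow> w \<in> carrier (Sp F (bar_obj Q \<alpha> a)) \<Longrightarrow>
      p2 (bar_obj Q \<alpha> b) (act F (\<alpha>, a, b) w) = act ?A (\<alpha>, a, b) (p2 (bar_obj Q \<alpha> a) w)"
    by (rule extension_rep_exists[OF A pwf_Z universe zero_thread_cocycle[OF A pwf_Z]], rule that)
  note r = pwf_repD(1)
  have q1_hom: "q1 x \<in> module_hom K (Sp E x) (Sp Z x)" and q2_hom: "q2 x \<in> module_hom K (Sp E x) (Sp ?M x)"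
    and p1_hom: "p1 x \<in> module_hom K (Sp F x) (Sp Z x)" and p2_hom: "p2 x \<in> module_hom K (Sp F x) (Sp ?A x)"
    and i1_hom: "i1 x \<in> module_hom K (Sp Z x) (Sp F x)"
    if "x \<in> tc_objects Q P" for x
    using biproductD[OF biE[OF that]] biproductD[OF biF[OF that]] by auto
  have p1_act: "p1 (bar_obj Q \<alpha> b) (act F (\<alpha>, a, b) w) = act Z (\<alpha>, a, b) (p1 (bar_obj Q \<alpha> a) w)"
    if g: "(\<alpha>, a, b) \<in> gens Q P" and w: "w \<in> carrier (Sp F (bar_obj Q \<alpha> a))" for \<alpha> a b w
  proof -
    interpret Zy: module K "Sp Z (bar_obj Q \<alpha> b)" by (rule pwf_repD(5)[OF pwf_Z gens_ends(6)[OF g]])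
    show ?thesis
      using p1_act'[OF g w] module_hom_carrier[OF act_hom[OF pwf_Z g] module_hom_carrier[OF p1_hom[OF gens_ends(5)[OF g]] w]]
      by simp
  qed
  have p1_rep: "p1 \<in> rep_hom C K F Z" by (rule rep_homI[OF r[OF F] r[OF pwf_Z] p1_hom p1_act])
  have p2_rep: "p2 \<in> rep_hom C K F ?A" by (rule rep_homI[OF r[OF F] r[OF A] p2_hom p2_act])
  have q2_rep: "q2 \<in> rep_hom C K E ?M" by (rule rep_homI[OF r[OF E] r[OF M] q2_hom q2_act])
  have i1_rep: "i1 \<in> rep_hom C K Z F"
  proof (rule rep_homI[OF r[OF pwf_Z] r[OF F] i1_hom])
    fix \<alpha> a b v assume g: "(\<alpha>, a, b) \<in> gens Q P" and v: "v \<in> carrier (Sp Z (bar_obj Q \<alpha> a))"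
    note x = gens_ends(5)[OF g] and y = gens_ends(6)[OF g]
    note bx = biproductD[OF biF[OF x]] and by_ = biproductD[OF biF[OF y]]
    have i: "i1 (bar_obj Q \<alpha> a) v \<in> carrier (Sp F (bar_obj Q \<alpha> a))" by (rule module_hom_carrier[OF bx(3) v])
    have av: "act Z (\<alpha>, a, b) v \<in> carrier (Sp Z (bar_obj Q \<alpha> b))" by (rule module_hom_carrier[OF act_hom[OF pwf_Z g] v])
    have "act ?A (\<alpha>, a, b) \<zero>\<^bsub>Sp ?A (bar_obj Q \<alpha> a)\<^esub> = \<zero>\<^bsub>Sp ?A (bar_obj Q \<alpha> b)\<^esub>"
      by (rule module_hom_zero[OF pwf_repD(5)[OF A x] pwf_repD(5)[OF A y] act_hom[OF A g]])
    then show "i1 (bar_obj Q \<alpha> b) (act Z (\<alpha>, a, b) v) = act F (\<alpha>, a, b) (i1 (bar_obj Q \<alpha> a) v)"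
      using p1_act[OF g i] p2_act[OF g i]
      by (intro biproduct_ext[OF biF[OF y] module_hom_carrier[OF by_(3) av]
            module_hom_carrier[OF act_hom[OF F g] i]])
        (simp_all add: bx(7,8)[OF v] by_(7,8)[OF av])
  qed
  \<comment> \<open>Embeds \<open>A\<close> into \<open>E\<close> over \<open>d1\<close>; it
    commutes with the actions because the values of \<open>c\<close> on \<open>im d1\<close> are the
    defect of naturality of \<open>\<kappa>\<close>.\<close>
  define j where "j x v = j1 x (\<kappa> x v) \<oplus>\<^bsub>Sp E x\<^esub> j2 x (?d1 x v)" for x v
  have d1_hom: "?d1 x \<in> module_hom K (Sp ?A x) (Sp ?M x)" if "x \<in> tc_objects Q P" for x
    by (rule rep_hom_module_hom[OF d1 that])
  have j: "j x v \<in> carrier (Sp E x)" "q1 x (j x v) = \<kappa> x v" "q2 x (j x v) = ?d1 x v"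
    if x: "x \<in> tc_objects Q P" and v: "v \<in> carrier (Sp ?A x)" for x v
    using biproduct_pair[OF biE[OF x] pwf_repD(5)[OF pwf_Z x] pwf_repD(5)[OF M x]
        module_hom_carrier[OF \<kappa>(1)[OF x] v] module_hom_carrier[OF d1_hom[OF x] v]]
    by (simp_all add: j_def)
  have j_rep: "j \<in> rep_hom C K ?A E"
  proof (rule rep_homI[OF r[OF A] r[OF E]])
    fix x assume x: "x \<in> tc_objects Q P"
    show "j x \<in> module_hom K (Sp ?A x) (Sp E x)"
      unfolding j_def using biproductD[OF biE[OF x]]
      by (intro module_hom_plus pwf_repD(5)[OF E x] module_hom_compose[OF \<kappa>(1)[OF x]]
          module_hom_compose[OF d1_hom[OF x]])
  next
    fix \<alpha> a b v assume g: "(\<alpha>, a, b) \<in> gens Q P" and v: "v \<in> carrier (Sp ?A (bar_obj Q \<alpha> a))"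
    note x = gens_ends(5)[OF g] and y = gens_ends(6)[OF g]
    note jx = j[OF x v]
    have av: "act ?A (\<alpha>, a, b) v \<in> carrier (Sp ?A (bar_obj Q \<alpha> b))" by (rule module_hom_carrier[OF act_hom[OF A g] v])
    note jy = j[OF y av]
    interpret Zy: module K "Sp Z (bar_obj Q \<alpha> b)" by (rule pwf_repD(5)[OF pwf_Z y])
    have mem: "\<kappa> (bar_obj Q \<alpha> b) (act ?A (\<alpha>, a, b) v) \<in> carrier (Sp Z (bar_obj Q \<alpha> b))"
      "act Z (\<alpha>, a, b) (\<kappa> (bar_obj Q \<alpha> a) v) \<in> carrier (Sp Z (bar_obj Q \<alpha> b))"
      using module_hom_carrier[OF \<kappa>(1)[OF y] av]
        module_hom_carrier[OF act_hom[OF pwf_Z g] module_hom_carrier[OF \<kappa>(1)[OF x] v]] by auto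
    have "q1 (bar_obj Q \<alpha> b) (act E (\<alpha>, a, b) (j (bar_obj Q \<alpha> a) v)) = \<kappa> (bar_obj Q \<alpha> b) (act ?A (\<alpha>, a, b) v)"
      using mem unfolding q1_act[OF g jx(1)] jx(2,3) c_d1[OF g v]
      by (simp add: Zy.minus_eq Zy.a_lcomm[of "act Z (\<alpha>, a, b) (\<kappa> (bar_obj Q \<alpha> a) v)"] Zy.r_neg)
    moreover have "q2 (bar_obj Q \<alpha> b) (act E (\<alpha>, a, b) (j (bar_obj Q \<alpha> a) v)) = ?d1 (bar_obj Q \<alpha> b) (act ?A (\<alpha>, a, b) v)"
      unfolding q2_act[OF g jx(1)] jx(3) rep_hom_act[OF d1 g v] ..
    ultimately show "j (bar_obj Q \<alpha> b) (act ?A (\<alpha>, a, b) v) = act E (\<alpha>, a, b) (j (bar_obj Q \<alpha> a) v)"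
      using jy by (intro biproduct_ext[OF biE[OF y] jy(1) module_hom_carrier[OF act_hom[OF E g] jx(1)]]) simp_all
  qed
  \<comment> \<open>On the summand \<open>Z\<close> this has to be \<open>d0\<close>, so that the
    morphism to the given sequence is the identity on \<open>Z\<close>; on \<open>A\<close> it is
    the identity.\<close>
  define h1 where "h1 x w = ?d0 x (p1 x w) \<oplus>\<^bsub>Sp ?A x\<^esub> p2 x w" for x w
  have d0_hom: "?d0 x \<in> module_hom K (Sp Z x) (Sp ?A x)" if "x \<in> tc_objects Q P" for x
    by (rule rep_hom_module_hom[OF d0 that])
  have h1_rep: "h1 \<in> rep_hom C K F ?A"
  proof (rule rep_homI[OF r[OF F] r[OF A]])
    fix x assume x: "x \<in> tc_objects Q P"
    show "h1 x \<in> module_hom K (Sp F x) (Sp ?A x)"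
      unfolding h1_def
      by (intro module_hom_plus pwf_repD(5)[OF A x] module_hom_compose[OF p1_hom[OF x] d0_hom[OF x]] p2_hom[OF x])
  next
    fix \<alpha> a b v assume g: "(\<alpha>, a, b) \<in> gens Q P" and v: "v \<in> carrier (Sp F (bar_obj Q \<alpha> a))"
    note x = gens_ends(5)[OF g]
    have m: "p1 (bar_obj Q \<alpha> a) v \<in> carrier (Sp Z (bar_obj Q \<alpha> a))"
      "p2 (bar_obj Q \<alpha> a) v \<in> carrier (Sp ?A (bar_obj Q \<alpha> a))"
      using module_hom_carrier[OF p1_hom[OF x] v] module_hom_carrier[OF p2_hom[OF x] v] by auto
    show "h1 (bar_obj Q \<alpha> b) (act F (\<alpha>, a, b) v) = act ?A (\<alpha>, a, b) (h1 (bar_obj Q \<alpha> a) v)"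
      unfolding h1_def p1_act[OF g v] p2_act[OF g v] rep_hom_act[OF d0 g m(1)]
        module_hom_add[OF act_hom[OF A g] module_hom_carrier[OF d0_hom[OF x] m(1)] m(2)] ..
  qed
  define B' where "B' i = (if i = Suc 0 then F else if i = Suc (Suc 0) then E else B i)" for i
  define d' where "d' i = (if i = 0 then i1 else if i = Suc 0 then (\<lambda>x w. j x (p2 x w))
    else if i = Suc (Suc 0) then (\<lambda>x w. ?d2 x (q2 x w)) else d i)" for i
  have B'0: "B' 0 = Z" and B'n: "B' (Suc n) = X" using B0 Bn n by (auto simp: B'_def)
  have pwf_B': "is_pwf_rep C K (B' i)" if "i \<le> Suc n" for i
    using pwf_B[OF that] E F by (simp add: B'_def)
  have d'_rep: "d' i \<in> rep_hom C K (B' i) (B' (Suc i))" if "i \<le> n" for i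
  proof -
    consider "i = 0" | "i = Suc 0" | "i = Suc (Suc 0)" | "i > Suc (Suc 0)" by linarith
    then show ?thesis
      using i1_rep B0 rep_hom_compose[OF p2_rep j_rep] rep_hom_compose[OF q2_rep d2] d_hom[OF that]
      by cases (auto simp: d'_def B'_def)
  qed
  have splice: "inj_on (i1 x) (carrier (Sp Z x))"
    "i1 x ` carrier (Sp Z x) = {w \<in> carrier (Sp F x). j x (p2 x w) = \<zero>\<^bsub>Sp E x\<^esub>}"
    "(\<lambda>w. j x (p2 x w)) ` carrier (Sp F x) =
      {w \<in> carrier (Sp E x). ?d2 x (q2 x w) = \<zero>\<^bsub>Sp (B (Suc (Suc (Suc 0)))) x\<^esub>}"
    "(\<lambda>w. ?d2 x (q2 x w)) ` carrier (Sp E x) = ?d2 x ` carrier (Sp ?M x)"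
    if x: "x \<in> tc_objects Q P" for x
    using splice_exact[OF pwf_repD(5)[OF pwf_Z x] pwf_repD(5)[OF A x] pwf_repD(5)[OF M x] pwf_repD(5)[OF T x]
        d0_hom[OF x] d1_hom[OF x] rep_hom_module_hom[OF d2 x] exact0[OF x] exact1[OF x]
        \<kappa>(1)[OF x] \<kappa>(2)[OF x] biF[OF x] biE[OF x]]
    by (simp_all add: j_def)
  have exact': "d' i x ` carrier (Sp (B' i) x) =
      {v \<in> carrier (Sp (B' (Suc i)) x). d' (Suc i) x v = \<zero>\<^bsub>Sp (B' (Suc (Suc i))) x\<^esub>}"
    if x: "x \<in> tc_objects Q P" and i: "i < n" for x i
  proof -
    \<comment> \<open>For \<open>i = 2\<close> the kernel is the old one, and
      \<open>splice(4)\<close> says that the incoming image is the old one as well.\<close>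
    consider "i = 0" | "i = Suc 0" | "i = Suc (Suc 0)" | "i > Suc (Suc 0)" by linarith
    then show ?thesis
      using splice[OF x] exact[OF x i] B0 by cases (auto simp: d'_def B'_def)
  qed
  have surj': "d' n x ` carrier (Sp (B' n) x) = carrier (Sp X x)" if x: "x \<in> tc_objects Q P" for x
    using n surj[OF x] splice(4)[OF x] by (auto simp: d'_def B'_def)
  have S: "(B', d') \<in> exact_seqs C K n X Z"
    unfolding exact_seqs_def using B'0 B'n pwf_B' d'_rep exact' surj' splice(1) by (simp add: d'_def)
  have j_d1: "q2 x (j x (p2 x w)) = ?d1 x (h1 x w)"
    if x: "x \<in> tc_objects Q P" and w: "w \<in> carrier (Sp F x)" for x w
  proof -
    interpret Mx: module K "Sp ?M x" by (rule pwf_repD(5)[OF M x])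
    have m: "p1 x w \<in> carrier (Sp Z x)" "p2 x w \<in> carrier (Sp ?A x)"
      using module_hom_carrier[OF p1_hom[OF x] w] module_hom_carrier[OF p2_hom[OF x] w] by auto
    have "?d1 x (?d0 x (p1 x w)) = \<zero>\<^bsub>Sp ?M x\<^esub>" using exact0[OF x] m(1) by blast
    then show ?thesis
      using module_hom_add[OF d1_hom[OF x] module_hom_carrier[OF d0_hom[OF x] m(1)] m(2)]
        module_hom_carrier[OF d1_hom[OF x] m(2)] j(3)[OF x m(2)] by (simp add: h1_def)
  qed
  have h1_i1: "h1 x (i1 x z) = ?d0 x z" if x: "x \<in> tc_objects Q P" and z: "z \<in> carrier (Sp Z x)" for x z
  proof -
    interpret Ax: module K "Sp ?A x" by (rule pwf_repD(5)[OF A x])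
    show ?thesis
      using biproductD(7,8)[OF biF[OF x] z] module_hom_carrier[OF d0_hom[OF x] z] by (simp add: h1_def)
  qed
  define h where "h i = (if i = Suc 0 then h1 else if i = Suc (Suc 0) then q2 else (\<lambda>x v. v))" for i
  have "h i \<in> rep_hom C K (B' i) (B i)" for i
    using h1_rep q2_rep rep_hom_ident[of C K "B i"] by (simp add: h_def B'_def)
  moreover have "h (Suc i) x (d' i x v) = d i x (h i x v)"
    if x: "x \<in> tc_objects Q P" and v: "v \<in> carrier (Sp (B' i) x)" for i x v
  proof -
    consider "i = 0" | "i = Suc 0" | "i = Suc (Suc 0)" | "i > Suc (Suc 0)" by linarith
    then show ?thesis
      using v h1_i1[OF x] j_d1[OF x] B0 by cases (auto simp: d'_def h_def B'_def)
  qed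
  ultimately have to_seq: "seq_morphism C K n X Z (B', d') (B, d)"
    unfolding seq_morphism_def using S seq n by (auto simp: h_def intro!: exI[of _ h])
  define BT where "BT i = (if i \<le> 1 then Z else if n \<le> i then X else zero_rep)" for i
  define dT where "dT i = (\<lambda>x v. if i = 0 \<or> i = n then v else \<zero>\<^bsub>Sp (BT (Suc i)) x\<^esub>)" for i
  have T_eq: "trivial_seq n X Z = (BT, dT)"
    by (simp add: trivial_seq_def Let_def BT_def dT_def fun_eq_iff)
  have T: "(BT, dT) \<in> exact_seqs C K n X Z"
    using trivial_seq_exact[OF field_K pwf_X pwf_Z n] T_eq by simp
  then have pwf_BT: "is_pwf_rep C K (BT i)" if "i \<le> Suc n" for i
    using that by (auto simp: exact_seqs_def)
  \<comment> \<open>The second copy of \<open>Z\<close> receives the retraction \<open>p1\<close>,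
    the first copy of \<open>X\<close> receives \<open>d' n\<close>, and the terms between receive
    zero. The squares commute because \<open>p1\<close> splits \<open>i1\<close> and consecutive
    maps compose to zero; \<open>2 \<le> n\<close> keeps the positions \<open>1\<close> and
    \<open>n\<close> apart.\<close>
  define k where "k i = (if i = 0 \<or> i = Suc n then (\<lambda>x v. v) else if i = Suc 0 then p1
    else if i = n then d' n else (\<lambda>x v. \<zero>\<^bsub>Sp (BT i) x\<^esub>))" for i
  have "k i \<in> rep_hom C K (B' i) (BT i)" if i: "i \<le> Suc n" for i
  proof -
    consider "i = 0" | "i = Suc n" | "i = Suc 0" | "i = n" "1 < n" | "1 < i" "i < n" using n i by linarith
    then show ?thesis
    proof cases
      case 5
      then show ?thesis
        using rep_hom_zero[OF pwf_B'[OF i] pwf_BT[OF i]] by (simp add: k_def)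
    qed (use n B'0 B'n rep_hom_ident[of C K Z] rep_hom_ident[of C K X] p1_rep d'_rep[of n] in
        \<open>auto simp: k_def BT_def B'_def\<close>)
  qed
  moreover have "k (Suc i) x (d' i x v) = dT i x (k i x v)"
    if x: "x \<in> tc_objects Q P" and i: "i \<le> n" and v: "v \<in> carrier (Sp (B' i) x)" for i x v
  proof -
    consider "i = 0" | "i = n" "1 < n" | "0 < i" "Suc i = n" | "0 < i" "Suc i < n" using n i by linarith
    then show ?thesis
    proof cases
      case 1
      then show ?thesis
        using n v B'0 biproductD(7)[OF biF[OF x], of v] by (simp add: k_def dT_def d'_def)
    next
      case 3
      then have "d' n x (d' i x v) = \<zero>\<^bsub>Sp X x\<^esub>"
        using exact'[OF x, of i] v B'n by auto
      then show ?thesis using 3 n by (auto simp: k_def dT_def BT_def)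
    qed (use n in \<open>auto simp: k_def dT_def\<close>)
  qed
  ultimately have "seq_morphism C K n X Z (B', d') (BT, dT)"
    unfolding seq_morphism_def using S T n by (auto simp: k_def intro!: exI[of _ k])
  with to_seq show ?thesis unfolding T_eq by blast
qed

text \<open>The two morphisms out of the spliced sequence form a zigzag from any sequence to the
  trivial one. Exactness of the trivial sequence shows that its class occurs, so the set is a
  singleton and not empty.\<close>

theorem Ext_vanishes:
  fixes X Z :: "(('v, 'a, 'p) tobj, ('v, 'a, 'p) tpath set, 'k, 'm) rep"
  assumes "is_pwf_rep C K X" "is_pwf_rep C K Z" "2 \<le> n"
    and "\<And>n :: nat. \<exists>V :: ('k, 'm) module.
      vectorspace K V \<and> vectorspace.fin_dim K V \<and> vectorspace.dim K V = n"
  shows "Ext C K n X Z = {Ext_zero C K n X Z}"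
proof -
  have "seq_class C K n X Z S = Ext_zero C K n X Z" if S: "S \<in> exact_seqs C K n X Z" for S
  proof -
    obtain S' where "seq_morphism C K n X Z S' S" "seq_morphism C K n X Z S' (trivial_seq n X Z)"
      using splice_resolution[OF assms(1-4), of "fst S" "snd S"] S by auto
    then have "equivclp (seq_morphism C K n X Z) S (trivial_seq n X Z)"
      by (meson converse_r_into_equivclp equivclp_trans r_into_equivclp)
    then show ?thesis
      unfolding seq_class_def Ext_zero_def by (auto intro: equivclp_trans equivclp_sym)
  qed
  then show ?thesis
    using trivial_seq_exact[OF field_K assms(1-3)] by (auto simp: Ext_def)
qed

end

theorem theorem3p1:
  fixes Q :: "('v, 'a) pre_digraph" and P :: "'a \<Rightarrow> 'p rel"
    and C :: "(('v, 'a, 'p) tobj, ('v, 'a, 'p) tpath set) cat"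
    and K :: "('k, 'r) ring_scheme"
  assumes "thread_quiver Q P" and "C = thread_cat Q P"
    and "field K"
    \<comment> \<open>the universe \<open>'m\<close> contains vector spaces of every finite dimension\<close>
    and "\<And>n :: nat. \<exists>V :: ('k, 'm) module.
      vectorspace K V \<and> vectorspace.fin_dim K V \<and> vectorspace.dim K V = n"
  shows "(\<forall>X Y :: (('v, 'a, 'p) tobj, ('v, 'a, 'p) tpath set, 'k, 'm) rep.
      is_pwf_rep C K X \<longrightarrow> is_pwf_rep C K Y \<longrightarrow> Ext C K 2 X Y = {Ext_zero C K 2 X Y}) \<and>
    (\<forall>(X :: (('v, 'a, 'p) tobj, ('v, 'a, 'p) tpath set, 'k, 'm) rep) Y n.
      is_pwf_rep C K X \<longrightarrow> is_pwf_rep C K Y \<longrightarrow> 2 \<le> n \<longrightarrow> Ext C K n X Y = {Ext_zero C K n X Y})"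
proof -
  interpret thread_category Q P K
    by (rule thread_category.intro) (fact assms)+
  show ?thesis
    unfolding assms(2) using Ext_vanishes[OF _ _ _ assms(4)] by auto
qed

end
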